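(* Let $m\ge 2$, let $G$ be a path-connected topological group, and let $f_i\colon X\to G$ be continuous maps for $1\le i\le m$. Let $(f_1,\dots,f_m)\colon X\to G^m$ be the map $x\mapsto (f_1(x),\dots,f_m(x))$ and let $F_m\colon G^m\to G^{m-1}$ be the map $F_m(x_1,\dots,x_m)=(x_1x_2^{-1},x_2x_3^{-1},\dots,x_{m-1}x_m^{-1})$. Then $$\mathsf{D}(f_1,\dots,f_m)=\mathsf{cat}\big(F_m\circ(f_1,\dots,f_m)\big),\qquad \mathsf{dD}(f_1,\dots,f_m)=\mathsf{dcat}\big(F_m\circ(f_1,\dots,f_m)\big),$$ and $$\mathsf{D}^{\mathcal D}(f_1,\dots,f_m)=\mathsf{cat}_1\big(F_m\circ(f_1,\dots,f_m)\big),\qquad \mathsf{dD}^{\mathcal D}(f_1,\dots,f_m)=\mathsf{dcat}_1\big(F_m\circ(f_1,\dots,f_m)\big).$$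
   Context: For a (Hurewicz) fibration $p\colon E\to B$, $\mathsf{secat}(p)$ is the least integer $n\ge 0$ such that $B$ is covered by $n+1$ open sets over each of which $p$ has a continuous partial section ($\infty$ if none exists). For $k\ge1$ let $E_k(p)$ be the space of probability measures $\sum_{i=1}^k\lambda_ie_i$ on $E$ ($\lambda_i\ge0$, $\sum\lambda_i=1$) supported on at most $k$ points, all lying in a single fiber of $p$, as a subspace of the space $\mathcal B_k(E)$ of probability measures on $E$ with support of size at most $k$; here $\mathcal B_k(E)$ carries the metric topology of the L\'evy--Prokhorov metric when $E$ is metrizable (the results are asserted to hold equally for the quotient topology from the symmetric join $\ast^kE/\Sigma_k$). Let $p_k\colon E_k(p)\to B$, $p_k(\sum\lambda_ie_i)=p(e_i)$, which is a fibration. Then $\mathsf{dsecat}(p)$ is the least $n\ge0$ such that $p_{n+1}$ has a continuous section. Fix times $0=t_1<t_2<\dots<t_m=1$ and let $\pi^Y_m\colon Y^I\to Y^m$, $\gamma\mapsto(\gamma(t_1),\dots,\gamma(t_m))$. For maps $f_1,\dots,f_m\colon X\to Y$, $\mathsf{D}(f_1,\dots,f_m)$ is the least $n\ge0$ such that $X$ is covered by $n+1$ open sets on each of which the restrictions of all the $f_i$ are mutually homotopic (as maps into $Y$); equivalently it is $\mathsf{secat}$ of the pullback fibration $(f_1,\dots,f_m)^*\pi^Y_m$. Also $\mathsf{dD}(f_1,\dots,f_m):=\mathsf{dsecat}((f_1,\dots,f_m)^*\pi^Y_m)$. For a map $f\colon X\to Y$, with $P_0(Y)\subset Y^I$ the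 paths ending at a basepoint $y_0$ and $p^Y\colon P_0(Y)\to Y$, $\gamma\mapsto\gamma(0)$: $\mathsf{cat}(f):=\mathsf{secat}(f^*p^Y)$ and $\mathsf{dcat}(f):=\mathsf{dsecat}(f^*p^Y)$. In the diagonal statements, spaces whose (universal) coverings are used are assumed connected, locally path-connected and semi-locally simply connected. With $\widetilde p^Y\colon\widetilde Y\to Y$ the universal covering: $\mathsf{cat}_1(f):=\mathsf{secat}(f^*\widetilde p^Y)$, $\mathsf{dcat}_1(f):=\mathsf{dsecat}(f^*\widetilde p^Y)$. With $\pi=\pi_1(Y,y_0)$, let $\widehat\pi^Y_m\colon\widehat Y^m\to Y^m$ be the connected covering corresponding to the diagonal subgroup $\Delta<\pi^m$ (so $\widehat Y^m$ is the orbit space of the diagonal $\pi$-action on $\widetilde Y^m$). Then $\mathsf{D}^{\mathcal D}(f_1,\dots,f_m)$ is the least $n\ge0$ such that $X$ is covered by $n+1$ open sets $U_j$ such that, for each $j$ and each basepoint $u_j\in U_j$, the homomorphism $\pi_1(U_j,u_j)\to\pi_1(Y^m,(f_1(u_j),\dots,f_m(u_j)))$ induced by $(f_1,\dots,f_m)|_{U_j}$ takes values in a subgroup conjugate to $\Delta$; equivalently it is $\mathsf{secat}((f_1,\dots,f_m)^*\widehat\pi^Y_m)$. And $\mathsf{dD}^{\mathcal D}(f_1,\dots,f_m):=\mathsf{dsecat}((f_1,\dots,f_m)^*\widehat\pi^Y_m)$.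
   Formalization: The equality for D^𝒟 is proved for all X when D^𝒟 is read as the secat of the pulled-back covering; for the π₁ description X is assumed locally path-connected, since otherwise the two descriptions differ (e.g. X the Warsaw circle, G the circle) and the equality fails. *)

theory Defs
  imports "HOL-Analysis.Analysis" "HOL-Probability.Probability" "HOL-Algebra.Group"
    "HOL-Library.Extended_Nat"
begin

section \<open>Spaces of maps and products\<close>

abbreviation power_space :: "'a topology \<Rightarrow> nat \<Rightarrow> (nat \<Rightarrow> 'a) topology" where
  "power_space Y m \<equiv> product_topology (\<lambda>_. Y) {1..m}"

definition tuple :: "nat \<Rightarrow> (nat \<Rightarrow> 'x \<Rightarrow> 'a) \<Rightarrow> 'x \<Rightarrow> nat \<Rightarrow> 'a" where
  "tuple m f x = (\<lambda>i\<in>{1..m}. f i x)"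

text \<open>The compact-open topology on the set of paths in \<open>Y\<close>. Paths are required to be extensional
  on the unit interval, so that a path is determined by its values there.\<close>

definition path_space :: "'a topology \<Rightarrow> (real \<Rightarrow> 'a) topology" where
  "path_space Y = topology_generated_by
     {{\<gamma>. pathin Y \<gamma> \<and> \<gamma> \<in> extensional {0..1} \<and> \<gamma> ` K \<subseteq> U} | K U.
        compactin (top_of_set {0..1}) K \<and> openin Y U}"

definition based_path_space :: "'a topology \<Rightarrow> 'a \<Rightarrow> (real \<Rightarrow> 'a) topology" where
  "based_path_space Y y\<^sub>0 = subtopology (path_space Y) {\<gamma>. \<gamma> 1 = y\<^sub>0}"

definition eval_times :: "nat \<Rightarrow> (nat \<Rightarrow> real) \<Rightarrow> (real \<Rightarrow> 'a) \<Rightarrow> nat \<Rightarrow> 'a" where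
  "eval_times m t \<gamma> = (\<lambda>i\<in>{1..m}. \<gamma> (t i))"

text \<open>Total space of \<open>f\<^sup>*q\<close>; its projection to \<open>X\<close> is \<^const>\<open>fst\<close>.\<close>

definition pullback :: "'x topology \<Rightarrow> ('x \<Rightarrow> 'a) \<Rightarrow> 'e topology \<Rightarrow> ('e \<Rightarrow> 'a) \<Rightarrow> ('x \<times> 'e) topology" where
  "pullback X f E q = subtopology (prod_topology X E) {(x, e). f x = q e}"


section \<open>Sectional category\<close>

definition open_cover_number :: "'b topology \<Rightarrow> ('b set \<Rightarrow> bool) \<Rightarrow> enat" where
  "open_cover_number B P = Inf {enat n | n. \<exists>U :: nat \<Rightarrow> 'b set.
     (\<forall>j\<le>n. openin B (U j) \<and> P (U j)) \<and> topspace B = (\<Union>j\<le>n. U j)}"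

definition secat :: "'e topology \<Rightarrow> 'b topology \<Rightarrow> ('e \<Rightarrow> 'b) \<Rightarrow> enat" where
  "secat E B p = open_cover_number B
     (\<lambda>U. \<exists>s. continuous_map (subtopology B U) E s \<and> (\<forall>x\<in>U. p (s x) = x))"


section \<open>Finitely supported probability measures\<close>

definition barycentres :: "'e topology \<Rightarrow> nat \<Rightarrow> 'e pmf set" where
  "barycentres E k = {\<mu>. finite (set_pmf \<mu>) \<and> card (set_pmf \<mu>) \<le> k \<and> set_pmf \<mu> \<subseteq> topspace E}"

text \<open>A \<open>'e barycentre_topology\<close> assigns to \<open>E\<close> and \<open>k\<close> a topology on \<^term>\<open>barycentres E k\<close>.
  Two of them are considered.\<close>

type_synonym 'e barycentre_topology = "'e topology \<Rightarrow> nat \<Rightarrow> 'e pmf topology"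

subsection \<open>The metric topology\<close>

definition metrizes :: "('e \<Rightarrow> 'e \<Rightarrow> real) \<Rightarrow> 'e topology \<Rightarrow> bool" where
  "metrizes d E \<longleftrightarrow> Metric_space (topspace E) d \<and> Metric_space.mtopology (topspace E) d = E"

definition thickening :: "'e topology \<Rightarrow> ('e \<Rightarrow> 'e \<Rightarrow> real) \<Rightarrow> real \<Rightarrow> 'e set \<Rightarrow> 'e set" where
  "thickening E d \<epsilon> A = {x \<in> topspace E. \<exists>a\<in>A. d a x < \<epsilon>}"

definition levy_prokhorov :: "'e topology \<Rightarrow> ('e \<Rightarrow> 'e \<Rightarrow> real) \<Rightarrow> 'e pmf \<Rightarrow> 'e pmf \<Rightarrow> real" where
  "levy_prokhorov E d \<mu> \<nu> = Inf {\<epsilon>. \<epsilon> > 0 \<and>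
     (\<forall>A \<in> sigma_sets (topspace E) {U. openin E U}.
        measure_pmf.prob \<mu> A \<le> measure_pmf.prob \<nu> (thickening E d \<epsilon> A) + \<epsilon> \<and>
        measure_pmf.prob \<nu> A \<le> measure_pmf.prob \<mu> (thickening E d \<epsilon> A) + \<epsilon>)}"

definition levy_prokhorov_topology :: "('e \<Rightarrow> 'e \<Rightarrow> real) \<Rightarrow> 'e barycentre_topology" where
  "levy_prokhorov_topology d E k = Metric_space.mtopology (barycentres E k) (levy_prokhorov E d)"

subsection \<open>The quotient topology of the symmetric join\<close>

definition simplex_space :: "nat \<Rightarrow> (nat \<Rightarrow> real) topology" where
  "simplex_space k = subtopology (power_space euclideanreal k)
     {w. (\<forall>i\<in>{1..k}. 0 \<le> w i) \<and> (\<Sum>i\<in>{1..k}. w i) = 1}"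

text \<open>\<open>(w, e)\<close> is sent to the measure \<open>w\<^sub>1 e\<^sub>1 + \<dots> + w\<^sub>k e\<^sub>k\<close>: the image under \<open>e\<close> of the measure
  on \<open>{1..k}\<close> with weights \<open>w\<close>.\<close>

definition barycentre :: "nat \<Rightarrow> (nat \<Rightarrow> real) \<times> (nat \<Rightarrow> 'e) \<Rightarrow> 'e pmf" where
  "barycentre k = (\<lambda>(w, e). map_pmf e (embed_pmf (\<lambda>i. if i \<in> {1..k} then w i else 0)))"

text \<open>The \<open>k\<close>-fold join, the symmetric join (its \<open>\<Sigma>\<^sub>k\<close>-orbit space) and the space of measures are
  successive quotients of \<open>\<Delta>\<^sup>k\<^sup>-\<^sup>1 \<times> E\<^sup>k\<close>, so the last one carries the quotient topology of
  \<^const>\<open>barycentre\<close>.\<close>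

definition symmetric_join_topology :: "'e barycentre_topology" where
  "symmetric_join_topology E k = topology (\<lambda>W. W \<subseteq> barycentres E k \<and>
     openin (prod_topology (simplex_space k) (power_space E k))
       {z \<in> topspace (prod_topology (simplex_space k) (power_space E k)). barycentre k z \<in> W})"

lemma openin_symmetric_join_topology:
  "openin (symmetric_join_topology E k) W \<longleftrightarrow> W \<subseteq> barycentres E k \<and>
     openin (prod_topology (simplex_space k) (power_space E k))
       {z \<in> topspace (prod_topology (simplex_space k) (power_space E k)). barycentre k z \<in> W}"
proof -
  let ?Z = "prod_topology (simplex_space k) (power_space E k)"
  let ?pre = "\<lambda>W. {z \<in> topspace ?Z. barycentre k z \<in> W}"
  have "?pre (V \<inter> W) = ?pre V \<inter> ?pre W" and "?pre (\<Union>\<K>) = (\<Union>W\<in>\<K>. ?pre W)" for V W \<K>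
    by auto
  then have "istopology (\<lambda>W. W \<subseteq> barycentres E k \<and> openin ?Z (?pre W))"
    unfolding istopology_def by (auto simp only: intro!: openin_Int openin_Union)
  then show ?thesis
    by (simp add: symmetric_join_topology_def topology_inverse')
qed


section \<open>Distributional sectional category\<close>

text \<open>The space \<open>E\<^sub>k(p)\<close> and the map \<open>p\<^sub>k\<close>.\<close>

definition fibre_measures ::
    "'e barycentre_topology \<Rightarrow> 'e topology \<Rightarrow> ('e \<Rightarrow> 'b) \<Rightarrow> nat \<Rightarrow> 'e pmf topology" where
  "fibre_measures \<T> E p k = subtopology (\<T> E k) {\<mu>. \<exists>b. \<forall>e\<in>set_pmf \<mu>. p e = b}"

definition fibre_proj :: "('e \<Rightarrow> 'b) \<Rightarrow> 'e pmf \<Rightarrow> 'b" where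
  "fibre_proj p \<mu> = the_elem (p ` set_pmf \<mu>)"

definition dsecat ::
    "'e barycentre_topology \<Rightarrow> 'e topology \<Rightarrow> 'b topology \<Rightarrow> ('e \<Rightarrow> 'b) \<Rightarrow> enat" where
  "dsecat \<T> E B p = Inf {enat n | n. \<exists>s. continuous_map B (fibre_measures \<T> E p (n + 1)) s \<and>
     (\<forall>b\<in>topspace B. fibre_proj p (s b) = b)}"


section \<open>Homotopic distance and category of maps\<close>

definition path_pullback ::
    "'x topology \<Rightarrow> 'a topology \<Rightarrow> nat \<Rightarrow> (nat \<Rightarrow> real) \<Rightarrow> (nat \<Rightarrow> 'x \<Rightarrow> 'a) \<Rightarrow> ('x \<times> (real \<Rightarrow> 'a)) topology" where
  "path_pullback X Y m t f = pullback X (tuple m f) (path_space Y) (eval_times m t)"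

definition based_path_pullback ::
    "'x topology \<Rightarrow> 'a topology \<Rightarrow> 'a \<Rightarrow> ('x \<Rightarrow> 'a) \<Rightarrow> ('x \<times> (real \<Rightarrow> 'a)) topology" where
  "based_path_pullback X Y y\<^sub>0 f = pullback X f (based_path_space Y y\<^sub>0) (\<lambda>\<gamma>. \<gamma> 0)"

definition D_maps :: "'x topology \<Rightarrow> 'a topology \<Rightarrow> nat \<Rightarrow> (nat \<Rightarrow> 'x \<Rightarrow> 'a) \<Rightarrow> enat" where
  "D_maps X Y m f = open_cover_number X
     (\<lambda>U. \<forall>i\<in>{1..m}. \<forall>j\<in>{1..m}. homotopic_with (\<lambda>_. True) (subtopology X U) Y (f i) (f j))"

definition dD_maps ::
    "('x \<times> (real \<Rightarrow> 'a)) barycentre_topology \<Rightarrow> 'x topology \<Rightarrow> 'a topology \<Rightarrow> nat \<Rightarrow> (nat \<Rightarrow> real)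
       \<Rightarrow> (nat \<Rightarrow> 'x \<Rightarrow> 'a) \<Rightarrow> enat" where
  "dD_maps \<T> X Y m t f = dsecat \<T> (path_pullback X Y m t f) X fst"

definition cat_map :: "'x topology \<Rightarrow> 'a topology \<Rightarrow> 'a \<Rightarrow> ('x \<Rightarrow> 'a) \<Rightarrow> enat" where
  "cat_map X Y y\<^sub>0 f = secat (based_path_pullback X Y y\<^sub>0 f) X fst"

definition dcat_map ::
    "('x \<times> (real \<Rightarrow> 'a)) barycentre_topology \<Rightarrow> 'x topology \<Rightarrow> 'a topology \<Rightarrow> 'a \<Rightarrow> ('x \<Rightarrow> 'a) \<Rightarrow> enat" where
  "dcat_map \<T> X Y y\<^sub>0 f = dsecat \<T> (based_path_pullback X Y y\<^sub>0 f) X fst"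


section \<open>Fundamental group\<close>

definition path_homotopic :: "'a topology \<Rightarrow> (real \<Rightarrow> 'a) \<Rightarrow> (real \<Rightarrow> 'a) \<Rightarrow> bool" where
  "path_homotopic Y p q \<longleftrightarrow>
     homotopic_with (\<lambda>r. r 0 = p 0 \<and> r 1 = p 1) (top_of_set {0..1}) Y p q"

text \<open>\<^const>\<open>joinpaths\<close> and \<^const>\<open>reversepath\<close> are restricted to the class of topological spaces,
  hence the following copies of them.\<close>

definition join_paths :: "(real \<Rightarrow> 'a) \<Rightarrow> (real \<Rightarrow> 'a) \<Rightarrow> real \<Rightarrow> 'a" where
  "join_paths p q = (\<lambda>s. if s \<le> 1 / 2 then p (2 * s) else q (2 * s - 1))"

definition reverse_path :: "(real \<Rightarrow> 'a) \<Rightarrow> real \<Rightarrow> 'a" where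
  "reverse_path p = (\<lambda>s. p (1 - s))"

definition path_class :: "'a topology \<Rightarrow> (real \<Rightarrow> 'a) \<Rightarrow> (real \<Rightarrow> 'a) set" where
  "path_class Y p = {q. path_homotopic Y p q}"

text \<open>The underlying set of the fundamental group; the group operation is not needed below, since
  conjugation of subgroups is a special case of change of basepoint.\<close>

definition pi1 :: "'a topology \<Rightarrow> 'a \<Rightarrow> (real \<Rightarrow> 'a) set set" where
  "pi1 Y y = path_class Y ` {p. pathin Y p \<and> p 0 = y \<and> p 1 = y}"

text \<open>The homomorphism induced by \<open>f\<close> (into \<open>Z\<close>), and the change-of-basepoint isomorphism along
  \<open>\<sigma>\<close>. All members of the unions are equal.\<close>

definition pi1_map :: "'b topology \<Rightarrow> ('a \<Rightarrow> 'b) \<Rightarrow> (real \<Rightarrow> 'a) set \<Rightarrow> (real \<Rightarrow> 'b) set" where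
  "pi1_map Z f c = (\<Union>p\<in>c. path_class Z (f \<circ> p))"

definition pi1_transport :: "'a topology \<Rightarrow> (real \<Rightarrow> 'a) \<Rightarrow> (real \<Rightarrow> 'a) set \<Rightarrow> (real \<Rightarrow> 'a) set" where
  "pi1_transport Y \<sigma> c = (\<Union>p\<in>c. path_class Y (join_paths (reverse_path \<sigma>) (join_paths p \<sigma>)))"

definition diagonal_point :: "nat \<Rightarrow> 'a \<Rightarrow> nat \<Rightarrow> 'a" where
  "diagonal_point m y = (\<lambda>i\<in>{1..m}. y)"

text \<open>The diagonal subgroup of \<open>\<pi>\<^sub>1(Y, y\<^sub>0)\<^sup>m = \<pi>\<^sub>1(Y\<^sup>m, (y\<^sub>0, \<dots>, y\<^sub>0))\<close>.\<close>

definition pi1_diagonal :: "'a topology \<Rightarrow> 'a \<Rightarrow> nat \<Rightarrow> (real \<Rightarrow> nat \<Rightarrow> 'a) set set" where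
  "pi1_diagonal Y y\<^sub>0 m = pi1_map (power_space Y m) (diagonal_point m) ` pi1 Y y\<^sub>0"

text \<open>The subgroups of \<open>\<pi>\<^sub>1(Y\<^sup>m, y)\<close> conjugate to the diagonal subgroup: its transports along the
  paths from \<open>(y\<^sub>0, \<dots>, y\<^sub>0)\<close> to \<open>y\<close>. Any two such paths differ by a loop, so for a fixed path these
  are exactly the conjugates of the transported diagonal subgroup.\<close>

definition conjugate_diagonals ::
    "'a topology \<Rightarrow> 'a \<Rightarrow> nat \<Rightarrow> (nat \<Rightarrow> 'a) \<Rightarrow> (real \<Rightarrow> nat \<Rightarrow> 'a) set set set" where
  "conjugate_diagonals Y y\<^sub>0 m y =
     {pi1_transport (power_space Y m) \<sigma> ` pi1_diagonal Y y\<^sub>0 m | \<sigma>.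
        pathin (power_space Y m) \<sigma> \<and> \<sigma> 0 = diagonal_point m y\<^sub>0 \<and> \<sigma> 1 = y}"


section \<open>Coverings\<close>

definition covering_map :: "'e topology \<Rightarrow> 'b topology \<Rightarrow> ('e \<Rightarrow> 'b) \<Rightarrow> bool" where
  "covering_map E B p \<longleftrightarrow> continuous_map E B p \<and> p ` topspace E = topspace B \<and>
     (\<forall>b\<in>topspace B. \<exists>U. openin B U \<and> b \<in> U \<and>
        (\<exists>\<V>. \<Union>\<V> = {e \<in> topspace E. p e \<in> U} \<and> (\<forall>V\<in>\<V>. openin E V) \<and> pairwise disjnt \<V> \<and>
             (\<forall>V\<in>\<V>. homeomorphic_map (subtopology E V) (subtopology B U) p)))"

definition simply_connected_space :: "'a topology \<Rightarrow> bool" where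
  "simply_connected_space Y \<longleftrightarrow> path_connected_space Y \<and>
     (\<forall>y\<in>topspace Y. pi1 Y y = {path_class Y (\<lambda>_. y)})"

definition semilocally_simply_connected_space :: "'a topology \<Rightarrow> bool" where
  "semilocally_simply_connected_space Y \<longleftrightarrow>
     (\<forall>y\<in>topspace Y. \<exists>U. openin Y U \<and> y \<in> U \<and>
        pi1_map Y id ` pi1 (subtopology Y U) y = {path_class Y (\<lambda>_. y)})"

definition universal_covering :: "'e topology \<Rightarrow> 'b topology \<Rightarrow> ('e \<Rightarrow> 'b) \<Rightarrow> bool" where
  "universal_covering E B p \<longleftrightarrow> covering_map E B p \<and> simply_connected_space E"

definition diagonal_covering ::
    "'e topology \<Rightarrow> 'a topology \<Rightarrow> 'a \<Rightarrow> nat \<Rightarrow> ('e \<Rightarrow> nat \<Rightarrow> 'a) \<Rightarrow> bool" where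
  "diagonal_covering E Y y\<^sub>0 m p \<longleftrightarrow>
     covering_map E (power_space Y m) p \<and> connected_space E \<and>
     (\<exists>e\<in>topspace E. p e = diagonal_point m y\<^sub>0 \<and>
        pi1_map (power_space Y m) p ` pi1 E e = pi1_diagonal Y y\<^sub>0 m)"


section \<open>The invariants defined by coverings\<close>

text \<open>The coverings in question are unique only up to isomorphism, so they are arguments.\<close>

definition cat1_map :: "'x topology \<Rightarrow> 'e topology \<Rightarrow> ('e \<Rightarrow> 'a) \<Rightarrow> ('x \<Rightarrow> 'a) \<Rightarrow> enat" where
  "cat1_map X E q f = secat (pullback X f E q) X fst"

definition dcat1_map ::
    "('x \<times> 'e) barycentre_topology \<Rightarrow> 'x topology \<Rightarrow> 'e topology \<Rightarrow> ('e \<Rightarrow> 'a) \<Rightarrow> ('x \<Rightarrow> 'a) \<Rightarrow> enat" where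
  "dcat1_map \<T> X E q f = dsecat \<T> (pullback X f E q) X fst"

definition D_diagonal :: "'x topology \<Rightarrow> 'a topology \<Rightarrow> 'a \<Rightarrow> nat \<Rightarrow> (nat \<Rightarrow> 'x \<Rightarrow> 'a) \<Rightarrow> enat" where
  "D_diagonal X Y y\<^sub>0 m f = open_cover_number X
     (\<lambda>U. \<forall>u\<in>U. \<exists>H \<in> conjugate_diagonals Y y\<^sub>0 m (tuple m f u).
        pi1_map (power_space Y m) (tuple m f) ` pi1 (subtopology X U) u \<subseteq> H)"

text \<open>For locally path-connected \<open>X\<close> the next number agrees with \<^const>\<open>D_diagonal\<close>, by the lifting
  criterion.\<close>

definition D_diagonal_secat ::
    "'x topology \<Rightarrow> 'e topology \<Rightarrow> nat \<Rightarrow> ('e \<Rightarrow> nat \<Rightarrow> 'a) \<Rightarrow> (nat \<Rightarrow> 'x \<Rightarrow> 'a) \<Rightarrow> enat" where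
  "D_diagonal_secat X E m r f = secat (pullback X (tuple m f) E r) X fst"

definition dD_diagonal ::
    "('x \<times> 'e) barycentre_topology \<Rightarrow> 'x topology \<Rightarrow> 'e topology \<Rightarrow> nat \<Rightarrow> ('e \<Rightarrow> nat \<Rightarrow> 'a)
       \<Rightarrow> (nat \<Rightarrow> 'x \<Rightarrow> 'a) \<Rightarrow> enat" where
  "dD_diagonal \<T> X E m r f = dsecat \<T> (pullback X (tuple m f) E r) X fst"


section \<open>Topological groups\<close>

definition topological_group :: "('g, 'z) monoid_scheme \<Rightarrow> 'g topology \<Rightarrow> bool" where
  "topological_group G T \<longleftrightarrow> group G \<and> carrier G = topspace T \<and>
     continuous_map (prod_topology T T) T (\<lambda>(x, y). x \<otimes>\<^bsub>G\<^esub> y) \<and>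
     continuous_map T T (\<lambda>x. inv\<^bsub>G\<^esub> x)"

definition quotients_map :: "('g, 'z) monoid_scheme \<Rightarrow> nat \<Rightarrow> (nat \<Rightarrow> 'g) \<Rightarrow> nat \<Rightarrow> 'g" where
  "quotients_map G m x = (\<lambda>i\<in>{1..m - 1}. x i \<otimes>\<^bsub>G\<^esub> inv\<^bsub>G\<^esub> x (i + 1))"

end

theory Submission
  imports Defs
begin

text \<open>Put \<open>h = F\<^sub>m \<circ> (f\<^sub>1, \<dots>, f\<^sub>m)\<close>. Each side of each equation asks for sections, or for sections valued in
  finitely supported measures, of a space over \<open>X\<close>: a pullback along \<open>(f\<^sub>1, \<dots>, f\<^sub>m)\<close> of a space over
  \<open>G\<^sup>m\<close> on the left, a pullback along \<open>h\<close> of a space over \<open>G\<^sup>m\<^sup>-\<^sup>1\<close> on the right. Composition with a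
  continuous map over \<open>X\<close> turns sections into sections (\<open>secat_fibre_map_le\<close>), and pushing measures
  forward does the same for measures (\<open>dsecat_fibre_map_le\<close>). So it is enough to find continuous maps
  over \<open>X\<close> in both directions. The homotopies that define \<open>D\<close> correspond to sections as well
  (\<open>homotopic_if_section\<close>, \<open>section_if_homotopic\<close>). Pushing forward is continuous for both topologies
  on measures: for the symmetric join by functoriality of the quotient (\<open>functorial_symmetric_join\<close>),
  for the Levy-Prokhorov metric because continuity at a finitely supported measure only involves the
  finitely many points of its support (\<open>functorial_levy_prokhorov\<close>).

  The maps over \<open>X\<close> come from the shear \<open>W : G \<times> G\<^sup>m\<^sup>-\<^sup>1 \<rightarrow> G\<^sup>m\<close>, whose \<open>i\<close>-th coordinate is
  \<open>z\<^sub>i z\<^sub>i\<^sub>+\<^sub>1 \<dots> z\<^sub>m\<^sub>-\<^sub>1 g\<close>. It satisfies \<open>W (x\<^sub>m, F\<^sub>m x) = x\<close>, so a point of \<open>G\<^sup>m\<close> is known from its last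
  coordinate and its image under \<open>F\<^sub>m\<close>, and it maps \<open>G \<times> {1}\<close> onto the diagonal.

  For path spaces, a path \<open>\<gamma>\<close> with \<open>\<gamma> (t\<^sub>i) = f\<^sub>i x\<close> restricts to paths from \<open>f\<^sub>i x\<close> to \<open>f\<^sub>i\<^sub>+\<^sub>1 x\<close>; dividing
  on the right by the end point gives a path from \<open>h x\<close> to \<open>1\<close> (\<open>fibre_map_to_based\<close>). Conversely, when
  the coordinates of a path from \<open>h x\<close> to \<open>1\<close> are run through one after the other, the \<open>j\<close>-th during
  \<open>[t\<^sub>j, t\<^sub>j\<^sub>+\<^sub>1]\<close>, the first coordinate of the shear with \<open>g = f\<^sub>m x\<close> is a path through the points \<open>f\<^sub>i x\<close>
  (\<open>fibre_map_of_based\<close>). A fixed path from \<open>1\<close> to the base point, multiplied pointwise, moves the end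
  point. These paths are combined by group multiplication instead of concatenation.

  For coverings, the lifting criterion (\<open>covering_lifting_criterion\<close>) lifts \<open>E \<rightarrow> G\<^sup>m \<rightarrow> G\<^sup>m\<^sup>-\<^sup>1\<close> to \<open>C\<close>,
  because the images in \<open>G\<^sup>m\<close> of loops of \<open>E\<close> are diagonal up to homotopy and \<open>F\<^sub>m\<close> is constant on the diagonal; and it lifts
  \<open>W \<circ> (id \<times> q) : G \<times> C \<rightarrow> G\<^sup>m\<close> to \<open>E\<close>, because \<open>C\<close> is simply connected, so that loops of \<open>G \<times> C\<close> become
  diagonal up to homotopy in \<open>G\<^sup>m\<close>. Finally \<open>(f\<^sub>1, \<dots>, f\<^sub>m)\<close> sends the loops of an open set into a conjugate of the
  diagonal subgroup if and only if \<open>h\<close> sends them to null-homotopic loops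
  (\<open>quotients_conjugate_diagonal_null\<close>, \<open>null_quotients_conjugate_diagonal\<close>), and for locally
  path-connected \<open>X\<close> that means that \<open>h\<close> lifts to \<open>C\<close> over that set.\<close>

section \<open>Path spaces, powers and pullbacks\<close>

abbreviation unit_interval :: "real topology" where
  "unit_interval \<equiv> top_of_set {0..1}"

lemma topspace_path_space:
  "topspace (path_space Y) = {\<gamma>. pathin Y \<gamma> \<and> \<gamma> \<in> extensional {0..1}}" (is "?L = ?R")
proof -
  have "topspace (path_space Y) =
     \<Union>{{\<gamma>. pathin Y \<gamma> \<and> \<gamma> \<in> extensional {0..1} \<and> \<gamma> ` K \<subseteq> U} | K U.
        compactin unit_interval K \<and> openin Y U}" (is "_ = \<Union>?S")
    by (simp add: path_space_def)
  moreover have "?R \<in> ?S"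
    by (rule CollectI, rule exI[of _ "{}"], rule exI[of _ "topspace Y"]) simp
  moreover have "A \<subseteq> ?R" if "A \<in> ?S" for A
    using that by blast
  ultimately show ?thesis by blast
qed

text \<open>Evaluation is jointly continuous for an arbitrary target because the unit interval is locally
  compact: a path that takes \<open>s\<close> into an open set takes a compact neighbourhood of \<open>s\<close> into it.\<close>

lemma continuous_map_path_eval:
  "continuous_map (prod_topology (path_space Y) unit_interval) Y (\<lambda>(\<gamma>, s). \<gamma> s)"
  unfolding continuous_map_def
proof (intro conjI allI impI)
  let ?I = "unit_interval"
  let ?Z = "prod_topology (path_space Y) ?I"
  show "(\<lambda>(\<gamma>, s). \<gamma> s) \<in> topspace ?Z \<rightarrow> topspace Y"
    by (auto simp: topspace_path_space pathin_def continuous_map_def)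
  fix U assume U: "openin Y U"
  show "openin ?Z {z \<in> topspace ?Z. (case z of (\<gamma>, s) \<Rightarrow> \<gamma> s) \<in> U}"
  proof (subst openin_subopen, clarsimp)
    fix \<gamma> and s :: real
    assume \<gamma>: "\<gamma> \<in> topspace (path_space Y)" and s: "0 \<le> s" "s \<le> 1" and sU: "\<gamma> s \<in> U"
    have "openin ?I {x \<in> {0..1}. \<gamma> x \<in> U}"
      using \<gamma> U by (auto simp: topspace_path_space pathin_def continuous_map_def)
    then obtain O' where O': "open O'" "{x \<in> {0..1}. \<gamma> x \<in> U} = O' \<inter> {0..1}"
      by (auto simp: openin_open Int_commute)
    then obtain e where e: "e > 0" "cball s e \<subseteq> O'"
      using s sU by (metis (no_types, lifting) IntE atLeastAtMost_iff mem_Collect_eq open_contains_cball)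
    define K where "K = cball s e \<inter> {0..1}"
    define V where "V = {\<beta>. pathin Y \<beta> \<and> \<beta> \<in> extensional {0..1} \<and> \<beta> ` K \<subseteq> U}"
    have "compactin ?I K"
      unfolding K_def by (auto simp: compactin_subtopology intro!: compact_Int)
    then have "openin (path_space Y) V"
      unfolding path_space_def V_def using U by (intro topology_generated_by_Basis) auto
    moreover have "openin ?I (ball s e \<inter> {0..1})"
      using openin_open_Int[OF open_ball, of "{0..1}" s e] by (simp add: Int_commute)
    ultimately have "openin ?Z (V \<times> (ball s e \<inter> {0..1}))"
      by (simp add: openin_prod_Times_iff)
    moreover have "(\<gamma>, s) \<in> V \<times> (ball s e \<inter> {0..1})"
      using \<gamma> s e O' by (auto simp: V_def K_def topspace_path_space)
    moreover have "V \<times> (ball s e \<inter> {0..1})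
        \<subseteq> {z \<in> topspace (path_space Y) \<times> {0..1}. (case z of (\<gamma>, s) \<Rightarrow> \<gamma> s) \<in> U}"
      by (auto simp: V_def K_def topspace_path_space image_subset_iff)
    ultimately show "\<exists>T. openin ?Z T \<and> (\<gamma>, s) \<in> T \<and>
        T \<subseteq> {z \<in> topspace (path_space Y) \<times> {0..1}. (case z of (\<gamma>, s) \<Rightarrow> \<gamma> s) \<in> U}"
      by blast
  qed
qed

text \<open>The other half of the exponential law. For compact \<open>K\<close>, the \<open>z\<close> for which \<open>F z\<close> takes some point
  of \<open>K\<close> outside \<open>U\<close> form a closed set, because the projection \<open>Z \<times> K \<rightarrow> Z\<close> is a closed map.\<close>

lemma continuous_map_path_curry:
  assumes F: "continuous_map (prod_topology Z unit_interval) Y (\<lambda>(z, s). F z s)"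
  shows "continuous_map Z (path_space Y) (\<lambda>z. \<lambda>s\<in>{0..1}. F z s)"
  unfolding path_space_def
proof (rule continuous_on_generated_topo)
  let ?I = "unit_interval"
  let ?S = "{{\<gamma>. pathin Y \<gamma> \<and> \<gamma> \<in> extensional {0..1} \<and> \<gamma> ` K \<subseteq> U} | K U.
        compactin ?I K \<and> openin Y U}"
  have path: "pathin Y (\<lambda>s\<in>{0..1}. F z s)" if "z \<in> topspace Z" for z
  proof -
    have "continuous_map ?I Y ((\<lambda>(z, s). F z s) \<circ> (\<lambda>s. (z, s)))"
      by (rule continuous_map_compose[OF _ F]) (use that in \<open>simp add: continuous_map_pairwise o_def\<close>)
    then show ?thesis
      unfolding pathin_def by (rule continuous_map_eq) auto
  qed
  then show "(\<lambda>z. \<lambda>s\<in>{0..1}. F z s) ` topspace Z \<subseteq> \<Union>?S"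
  proof (intro image_subsetI UnionI)
    show "{\<gamma>. pathin Y \<gamma> \<and> \<gamma> \<in> extensional {0..1} \<and> \<gamma> ` {} \<subseteq> topspace Y} \<in> ?S"
      by blast
  qed (auto simp: path)
  fix A assume "A \<in> ?S"
  then obtain K U where A: "A = {\<gamma>. pathin Y \<gamma> \<and> \<gamma> \<in> extensional {0..1} \<and> \<gamma> ` K \<subseteq> U}"
    and K: "compactin ?I K" and U: "openin Y U" by blast
  have K01: "K \<subseteq> {0..1}" and "compact K"
    using K by (auto simp: compactin_subtopology)
  let ?K = "top_of_set K"
  have FK: "continuous_map (prod_topology Z ?K) Y (\<lambda>(z, s). F z s)"
    using continuous_map_from_subtopology[OF F, of "topspace Z \<times> K"] K01
    by (simp add: prod_topology_subtopology subtopology_subtopology inf.absorb2 Times_Int_Times)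
  have "closedin (prod_topology Z ?K) {w \<in> topspace (prod_topology Z ?K). (\<lambda>(z, s). F z s) w \<in> topspace Y - U}"
    by (rule closedin_continuous_map_preimage[OF FK]) (use U in auto)
  moreover have "closed_map (prod_topology Z ?K) Z fst"
    using \<open>compact K\<close> by (intro closed_map_fst) (simp add: compact_space_subtopology)
  ultimately have "closedin Z (fst ` {w \<in> topspace (prod_topology Z ?K). (\<lambda>(z, s). F z s) w \<in> topspace Y - U})"
    by (auto simp: closed_map_def)
  moreover have "(\<lambda>z. \<lambda>s\<in>{0..1}. F z s) -` A \<inter> topspace Z
     = topspace Z - fst ` {w \<in> topspace (prod_topology Z ?K). (\<lambda>(z, s). F z s) w \<in> topspace Y - U}"
    (is "?L = ?R")
  proof -
    have mem: "F z s \<in> topspace Y" if "z \<in> topspace Z" "s \<in> K" for z s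
      using continuous_map_image_subset_topspace[OF FK] that by (force simp: image_subset_iff)
    have "z \<in> ?L \<longleftrightarrow> z \<in> topspace Z \<and> (\<forall>s\<in>K. F z s \<in> U)" for z
      using path K01 by (auto simp: A image_subset_iff subset_iff)
    moreover have "z \<in> ?R \<longleftrightarrow> z \<in> topspace Z \<and> (\<forall>s\<in>K. F z s \<in> U)" for z
      using mem by (force simp: image_iff)
    ultimately show ?thesis by blast
  qed
  ultimately show "openin Z ((\<lambda>z. \<lambda>s\<in>{0..1}. F z s) -` A \<inter> topspace Z)"
    by auto
qed

lemma continuous_map_path_apply:
  assumes "continuous_map Z (path_space Y) p" "continuous_map Z unit_interval s"
  shows "continuous_map Z Y (\<lambda>z. p z (s z))"
proof -
  have "continuous_map Z (prod_topology (path_space Y) unit_interval) (\<lambda>z. (p z, s z))"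
    using assms by (simp add: continuous_map_pairwise o_def)
  from continuous_map_compose[OF this continuous_map_path_eval] show ?thesis
    by (simp add: o_def)
qed

lemma continuous_map_into_power_space:
  "continuous_map Z (power_space Y m) (\<lambda>z. \<lambda>i\<in>{1..m}. a i z) \<longleftrightarrow>
     (\<forall>i\<in>{1..m}. continuous_map Z Y (a i))"
proof -
  have "continuous_map Z Y (\<lambda>z. if i \<in> {1..m} then a i z else undefined) \<longleftrightarrow> continuous_map Z Y (a i)"
    if "i \<in> {1..m}" for i using that by simp
  then show ?thesis
    by (auto simp: continuous_map_componentwise restrict_def extensional_def)
qed

lemma continuous_map_power_coord:
  assumes "continuous_map Z (power_space Y n) b" "i \<in> {1..n}"
  shows "continuous_map Z Y (\<lambda>z. b z i)"
  using continuous_map_compose[OF assms(1) continuous_map_product_projection[OF assms(2)]] by (simp add: o_def)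

lemma continuous_map_locally:
  assumes "\<And>z. z \<in> topspace Z \<Longrightarrow> \<exists>N. openin Z N \<and> z \<in> N \<and> continuous_map (subtopology Z N) Y g"
  shows "continuous_map Z Y g"
proof (rule pasting_lemma[where I = "{N. openin Z N \<and> continuous_map (subtopology Z N) Y g}" and T = id and f = "\<lambda>_. g"])
qed (use assms in auto)

lemma continuous_map_into_pullback:
  "continuous_map Z (pullback X f E q) s \<longleftrightarrow>
     continuous_map Z X (\<lambda>z. fst (s z)) \<and> continuous_map Z E (\<lambda>z. snd (s z)) \<and>
     (\<forall>z\<in>topspace Z. f (fst (s z)) = q (snd (s z)))"
  unfolding pullback_def continuous_map_in_subtopology continuous_map_pairwise
  by (auto simp: o_def case_prod_unfold)

lemma topspace_pullback:
  "topspace (pullback X f E q) = {(x, e). x \<in> topspace X \<and> e \<in> topspace E \<and> f x = q e}"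
  by (auto simp: pullback_def)

lemma continuous_map_pullback_fst: "continuous_map (pullback X f E q) X fst"
  and continuous_map_pullback_snd: "continuous_map (pullback X f E q) E snd"
  unfolding pullback_def
  by (auto intro!: continuous_map_from_subtopology continuous_map_fst continuous_map_snd)

lemma pullback_section_iff:
  assumes "openin X U"
  shows "(\<exists>s. continuous_map (subtopology X U) (pullback X f E q) s \<and> (\<forall>x\<in>U. fst (s x) = x)) \<longleftrightarrow>
         (\<exists>c. continuous_map (subtopology X U) E c \<and> (\<forall>x\<in>U. f x = q (c x)))" (is "?L \<longleftrightarrow> ?R")
proof
  have U: "topspace (subtopology X U) = U"
    using openin_subset[OF assms] by (rule topspace_subtopology_subset)
  show ?R if ?L
  proof -
    from that obtain s where "continuous_map (subtopology X U) (pullback X f E q) s" "\<forall>x\<in>U. fst (s x) = x"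
      by blast
    then show ?thesis
      unfolding continuous_map_into_pullback U by (intro exI[of _ "\<lambda>z. snd (s z)"]) auto
  qed
  show ?L if ?R
  proof -
    from that obtain c where "continuous_map (subtopology X U) E c" "\<forall>x\<in>U. f x = q (c x)"
      by blast
    then show ?thesis
      by (intro exI[of _ "\<lambda>x. (x, c x)"]) (auto simp: continuous_map_into_pullback U continuous_map_from_subtopology)
  qed
qed

section \<open>Sectional categories and maps over the base\<close>

lemma open_cover_number_cong:
  assumes "\<And>U. openin B U \<Longrightarrow> P U \<longleftrightarrow> Q U"
  shows "open_cover_number B P = open_cover_number B Q"
proof -
  have "(\<forall>j\<le>n. openin B (U j) \<and> P (U j)) \<longleftrightarrow> (\<forall>j\<le>n. openin B (U j) \<and> Q (U j))" for n :: nat and U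
    using assms by blast
  then show ?thesis
    unfolding open_cover_number_def by simp
qed

lemma open_cover_number_mono:
  assumes "\<And>U. openin B U \<Longrightarrow> P U \<Longrightarrow> Q U"
  shows "open_cover_number B Q \<le> open_cover_number B P"
  unfolding open_cover_number_def by (rule Inf_superset_mono) (use assms in blast)

definition fibre_map :: "'e topology \<Rightarrow> ('e \<Rightarrow> 'b) \<Rightarrow> 'f topology \<Rightarrow> ('f \<Rightarrow> 'b) \<Rightarrow> ('e \<Rightarrow> 'f) \<Rightarrow> bool" where
  "fibre_map E p E' p' \<phi> \<longleftrightarrow> continuous_map E E' \<phi> \<and> (\<forall>e\<in>topspace E. p' (\<phi> e) = p e)"

lemma fibre_map_pullback:
  assumes "continuous_map (pullback X f E q) E' \<phi>"
    and "\<And>x e. x \<in> topspace X \<Longrightarrow> e \<in> topspace E \<Longrightarrow> f x = q e \<Longrightarrow> f' x = q' (\<phi> (x, e))"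
  shows "fibre_map (pullback X f E q) fst (pullback X f' E' q') fst (\<lambda>w. (fst w, \<phi> w))"
  using assms unfolding fibre_map_def continuous_map_into_pullback
  by (auto simp: topspace_pullback continuous_map_pullback_fst)

lemma section_fibre_map:
  assumes "fibre_map E p E' p' \<phi>" "openin B U"
    and "\<exists>s. continuous_map (subtopology B U) E s \<and> (\<forall>x\<in>U. p (s x) = x)"
  shows "\<exists>s. continuous_map (subtopology B U) E' s \<and> (\<forall>x\<in>U. p' (s x) = x)"
proof -
  from assms(3) obtain s where s: "continuous_map (subtopology B U) E s" "\<forall>x\<in>U. p (s x) = x"
    by blast
  have "s x \<in> topspace E" if "x \<in> U" for x
    using continuous_map_image_subset_topspace[OF s(1)] openin_subset[OF assms(2)] that by auto
  with s assms(1) show ?thesis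
    by (intro exI[of _ "\<phi> \<circ> s"]) (auto simp: fibre_map_def intro: continuous_map_compose)
qed

lemma secat_fibre_map_le:
  assumes "fibre_map E p E' p' \<phi>"
  shows "secat E' B p' \<le> secat E B p"
  unfolding secat_def
  by (rule open_cover_number_mono) (rule section_fibre_map[OF assms])

text \<open>What the topologies on measures must satisfy for push-forward to compare values of \<^const>\<open>dsecat\<close>.\<close>

definition functorial_on :: "'e barycentre_topology \<Rightarrow> 'e topology \<Rightarrow> 'f barycentre_topology \<Rightarrow> 'f topology \<Rightarrow> bool" where
  "functorial_on \<T> E \<T>' E' \<longleftrightarrow>
     (\<forall>k \<phi>. continuous_map E E' \<phi> \<longrightarrow> continuous_map (\<T> E k) (\<T>' E' k) (map_pmf \<phi>)) \<and>
     (\<forall>k. topspace (\<T> E k) = barycentres E k)"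

text \<open>A map over the base sends a measure supported in the fibre over \<open>b\<close> to a measure supported in the
  fibre over \<open>b\<close>, and it does not enlarge supports.\<close>

lemma dsecat_fibre_map_le:
  assumes \<phi>: "fibre_map E p E' p' \<phi>" and \<T>: "functorial_on \<T> E \<T>' E'"
  shows "dsecat \<T>' E' B p' \<le> dsecat \<T> E B p"
  unfolding dsecat_def
proof (rule Inf_superset_mono, clarify)
  fix n s
  assume s: "continuous_map B (fibre_measures \<T> E p (n + 1)) s" and sec: "\<forall>b\<in>topspace B. fibre_proj p (s b) = b"
  have supp: "set_pmf (s b) \<subseteq> topspace E" and fib: "\<exists>c. \<forall>e\<in>set_pmf (s b). p e = c" if "b \<in> topspace B" for b
    using continuous_map_image_subset_topspace[OF s] \<T> that
    by (auto simp: fibre_measures_def functorial_on_def barycentres_def image_subset_iff)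
  have p': "p' ` set_pmf (map_pmf \<phi> (s b)) = p ` set_pmf (s b)" if "b \<in> topspace B" for b
    using supp[OF that] \<phi> by (force simp: fibre_map_def image_image)
  have "continuous_map B (fibre_measures \<T>' E' p' (n + 1)) (\<lambda>b. map_pmf \<phi> (s b))"
    unfolding fibre_measures_def continuous_map_in_subtopology
  proof
    have "continuous_map B (\<T> E (n + 1)) s"
      using s by (simp add: fibre_measures_def continuous_map_in_subtopology)
    moreover have "continuous_map (\<T> E (n + 1)) (\<T>' E' (n + 1)) (map_pmf \<phi>)"
      using \<phi> \<T> by (simp add: fibre_map_def functorial_on_def)
    ultimately show "continuous_map B (\<T>' E' (n + 1)) (\<lambda>b. map_pmf \<phi> (s b))"
      using continuous_map_compose by (fastforce simp: o_def)
    show "(\<lambda>b. map_pmf \<phi> (s b)) \<in> topspace B \<rightarrow> {\<mu>. \<exists>b. \<forall>e\<in>set_pmf \<mu>. p' e = b}"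
    proof
      fix b assume b: "b \<in> topspace B"
      obtain c where "\<forall>e\<in>set_pmf (s b). p e = c" using fib[OF b] by blast
      then have "\<forall>e\<in>set_pmf (map_pmf \<phi> (s b)). p' e = c"
        using p'[OF b] by (metis (mono_tags) image_iff)
      then show "map_pmf \<phi> (s b) \<in> {\<mu>. \<exists>b. \<forall>e\<in>set_pmf \<mu>. p' e = b}" by blast
    qed
  qed
  moreover have "fibre_proj p' (map_pmf \<phi> (s b)) = b" if "b \<in> topspace B" for b
    using p'[OF that] sec that by (simp add: fibre_proj_def)
  ultimately show "\<exists>n'. enat n = enat n' \<and> (\<exists>s. continuous_map B (fibre_measures \<T>' E' p' (n' + 1)) s \<and>
      (\<forall>b\<in>topspace B. fibre_proj p' (s b) = b))"
    by blast
qed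

section \<open>Functoriality of the symmetric join\<close>

text \<open>The weights on \<open>{1..k}\<close> add up to one, so \<^const>\<open>embed_pmf\<close> really is the measure with these
  weights.\<close>

lemma set_pmf_simplex:
  assumes "w \<in> topspace (simplex_space k)"
  shows "set_pmf (embed_pmf (\<lambda>i. if i \<in> {1..k} then w i else 0)) \<subseteq> {1..k}"
proof -
  let ?w = "\<lambda>i::nat. if i \<in> {1..k} then w i else 0"
  have w: "\<forall>i\<in>{1..k}. 0 \<le> w i" "(\<Sum>i\<in>{1..k}. w i) = 1"
    using assms by (auto simp: simplex_space_def)
  have "(\<integral>\<^sup>+ i. ennreal (?w i) \<partial>count_space UNIV) = (\<integral>\<^sup>+ i. ennreal (w i) * indicator {1..k} i \<partial>count_space UNIV)"
    by (intro nn_integral_cong) auto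
  also have "\<dots> = (\<integral>\<^sup>+ i. ennreal (w i) \<partial>count_space {1..k})"
    by (simp add: nn_integral_count_space_indicator)
  also have "\<dots> = (\<Sum>i\<in>{1..k}. ennreal (w i))"
    by (simp add: nn_integral_count_space_finite)
  also have "\<dots> = 1"
    using w by (subst sum_ennreal) auto
  finally have "pmf (embed_pmf ?w) i = ?w i" for i
    using w by (intro pmf_embed_pmf) auto
  then show ?thesis
    by (auto simp: set_pmf_iff split: if_splits)
qed

lemma barycentre_in_barycentres:
  assumes "w \<in> topspace (simplex_space k)" "e \<in> topspace (power_space E k)"
  shows "barycentre k (w, e) \<in> barycentres E k"
proof -
  let ?\<mu> = "embed_pmf (\<lambda>i. if i \<in> {1..k} then w i else 0)"
  have "set_pmf (barycentre k (w, e)) \<subseteq> e ` {1..k}"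
    using set_pmf_simplex[OF assms(1)] by (auto simp: barycentre_def)
  moreover have "e ` {1..k} \<subseteq> topspace E"
    using assms(2) by auto
  moreover have "card (e ` {1..k}) \<le> k"
    using card_image_le[of "{1..k}" e] by simp
  moreover have "card (set_pmf (barycentre k (w, e))) \<le> card (e ` {1..k})"
    using calculation(1) by (intro card_mono) auto
  moreover have "finite (set_pmf (barycentre k (w, e)))"
    using calculation(1) by (rule finite_subset) simp
  ultimately show ?thesis
    unfolding barycentres_def by auto
qed

lemma map_pmf_in_barycentres:
  assumes "continuous_map E E' \<phi>" "\<mu> \<in> barycentres E k"
  shows "map_pmf \<phi> \<mu> \<in> barycentres E' k"
proof -
  have "card (\<phi> ` set_pmf \<mu>) \<le> card (set_pmf \<mu>)"
    using assms(2) by (intro card_image_le) (simp add: barycentres_def)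
  then show ?thesis
    using assms(2) continuous_map_image_subset_topspace[OF assms(1)] by (auto simp: barycentres_def)
qed

lemma topspace_symmetric_join_topology:
  "topspace (symmetric_join_topology E k) = barycentres E k"
proof
  show "topspace (symmetric_join_topology E k) \<subseteq> barycentres E k"
    using openin_topspace openin_symmetric_join_topology by blast
  have "{z \<in> topspace (prod_topology (simplex_space k) (power_space E k)). barycentre k z \<in> barycentres E k}
      = topspace (prod_topology (simplex_space k) (power_space E k))"
    using barycentre_in_barycentres by fastforce
  then have "openin (symmetric_join_topology E k) (barycentres E k)"
    unfolding openin_symmetric_join_topology by (simp only: openin_topspace order_refl simp_thms)
  then show "barycentres E k \<subseteq> topspace (symmetric_join_topology E k)"
    by (rule openin_subset)
qed

text \<open>The push-forward is covered by the map \<open>(w, e) \<mapsto> (w, \<phi> \<circ> e)\<close> of the spaces of which the measures are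
  quotients.\<close>

lemma functorial_symmetric_join: "functorial_on symmetric_join_topology E symmetric_join_topology E'"
  unfolding functorial_on_def topspace_symmetric_join_topology
proof (intro conjI allI impI refl)
  fix k and \<phi> :: "'a \<Rightarrow> 'b"
  assume \<phi>: "continuous_map E E' \<phi>"
  let ?Z = "prod_topology (simplex_space k) (power_space E k)"
  let ?Z' = "prod_topology (simplex_space k) (power_space E' k)"
  let ?F = "\<lambda>(w, e). (w, \<lambda>i\<in>{1..k}. \<phi> (e i))"
  have "continuous_map ?Z (power_space E k) snd"
    by (rule continuous_map_snd)
  then have "continuous_map ?Z E' (\<lambda>z. \<phi> (snd z i))" if "i \<in> {1..k}" for i
  proof -
    have "continuous_map (power_space E k) E (\<lambda>e. e i)"
      using that by (rule continuous_map_product_projection)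
    from continuous_map_compose[OF continuous_map_compose[OF \<open>continuous_map ?Z (power_space E k) snd\<close> this] \<phi>]
    show ?thesis by (simp add: o_def)
  qed
  then have "continuous_map ?Z (power_space E' k) (\<lambda>z. \<lambda>i\<in>{1..k}. \<phi> (snd z i))"
    unfolding continuous_map_into_power_space by blast
  then have F: "continuous_map ?Z ?Z' ?F"
    by (simp add: continuous_map_pairwise o_def case_prod_unfold continuous_map_fst del: One_nat_def)
  have bary: "barycentre k (?F z) = map_pmf \<phi> (barycentre k z)" if "z \<in> topspace ?Z" for z
  proof -
    obtain w e where z: "z = (w, e)" "w \<in> topspace (simplex_space k)" using \<open>z \<in> topspace ?Z\<close> by auto
    have "set_pmf (embed_pmf (\<lambda>i. if i \<in> {1..k} then w i else 0)) \<subseteq> {1..k}"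
      using z by (intro set_pmf_simplex)
    then show ?thesis
      unfolding z barycentre_def prod.case pmf.map_comp
      by (intro pmf.map_cong0) (auto simp: restrict_def)
  qed
  show "continuous_map (symmetric_join_topology E k) (symmetric_join_topology E' k) (map_pmf \<phi>)"
    unfolding continuous_map_def topspace_symmetric_join_topology
  proof (intro conjI allI impI)
    show "map_pmf \<phi> \<in> barycentres E k \<rightarrow> barycentres E' k"
      using map_pmf_in_barycentres[OF \<phi>] by blast
    fix W assume W: "openin (symmetric_join_topology E' k) W"
    have "{z \<in> topspace ?Z. barycentre k z \<in> {\<mu> \<in> barycentres E k. map_pmf \<phi> \<mu> \<in> W}}
        = {z \<in> topspace ?Z. ?F z \<in> {z' \<in> topspace ?Z'. barycentre k z' \<in> W}}" (is "?L = ?R")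
    proof (rule Collect_cong, rule conj_cong[OF refl])
      fix z assume z: "z \<in> topspace ?Z"
      moreover have "?F z \<in> topspace ?Z'"
        using continuous_map_image_subset_topspace[OF F] z by blast
      moreover have "barycentre k z \<in> barycentres E k"
        using z barycentre_in_barycentres by fastforce
      ultimately show "barycentre k z \<in> {\<mu> \<in> barycentres E k. map_pmf \<phi> \<mu> \<in> W} \<longleftrightarrow>
          ?F z \<in> {z' \<in> topspace ?Z'. barycentre k z' \<in> W}"
        using bary[OF z] by simp
    qed
    also have "openin ?Z \<dots>"
      using W by (intro openin_continuous_map_preimage[OF F]) (simp add: openin_symmetric_join_topology)
    finally show "openin (symmetric_join_topology E k) {\<mu> \<in> barycentres E k. map_pmf \<phi> \<mu> \<in> W}"
      unfolding openin_symmetric_join_topology by blast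
  qed
qed

section \<open>Functoriality of the Levy-Prokhorov topology\<close>

text \<open>One half of the condition on \<open>\<epsilon>\<close> in the definition of the Levy-Prokhorov distance. Splitting the
  condition lets the triangle inequality and the push-forward be treated one direction at a time.\<close>

definition prokhorov_close :: "'e topology \<Rightarrow> ('e \<Rightarrow> 'e \<Rightarrow> real) \<Rightarrow> real \<Rightarrow> 'e pmf \<Rightarrow> 'e pmf \<Rightarrow> bool" where
  "prokhorov_close E d \<epsilon> \<mu> \<nu> \<longleftrightarrow> (\<forall>A \<in> sigma_sets (topspace E) {U. openin E U}.
     measure_pmf.prob \<mu> A \<le> measure_pmf.prob \<nu> (thickening E d \<epsilon> A) + \<epsilon>)"

lemma levy_prokhorov_alt:
  "levy_prokhorov E d \<mu> \<nu> = Inf {\<epsilon>. \<epsilon> > 0 \<and> prokhorov_close E d \<epsilon> \<mu> \<nu> \<and> prokhorov_close E d \<epsilon> \<nu> \<mu>}"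
  unfolding levy_prokhorov_def prokhorov_close_def by (simp add: ball_conj_distrib)

lemma prokhorov_close_mono:
  assumes "prokhorov_close E d \<epsilon> \<mu> \<nu>" "\<epsilon> \<le> \<delta>"
  shows "prokhorov_close E d \<delta> \<mu> \<nu>"
  unfolding prokhorov_close_def
proof
  fix A assume "A \<in> sigma_sets (topspace E) {U. openin E U}"
  then have "measure_pmf.prob \<mu> A \<le> measure_pmf.prob \<nu> (thickening E d \<epsilon> A) + \<epsilon>"
    using assms(1) by (auto simp: prokhorov_close_def)
  also have "measure_pmf.prob \<nu> (thickening E d \<epsilon> A) \<le> measure_pmf.prob \<nu> (thickening E d \<delta> A)"
    using assms(2) by (intro measure_pmf.finite_measure_mono) (auto simp: thickening_def intro: order_less_le_trans)
  finally show "measure_pmf.prob \<mu> A \<le> measure_pmf.prob \<nu> (thickening E d \<delta> A) + \<delta>"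
    using assms(2) by simp
qed

text \<open>Hence the infimum defining the distance is taken over a nonempty set.\<close>

lemma prokhorov_close_1: "prokhorov_close E d 1 \<mu> \<nu>"
  unfolding prokhorov_close_def by (auto intro: order_trans[OF measure_pmf.prob_le_1])

lemma levy_prokhorov_lessD:
  assumes "levy_prokhorov E d \<mu> \<nu> < \<epsilon>"
  shows "prokhorov_close E d \<epsilon> \<mu> \<nu>" "prokhorov_close E d \<epsilon> \<nu> \<mu>"
proof -
  have "{\<epsilon>. \<epsilon> > 0 \<and> prokhorov_close E d \<epsilon> \<mu> \<nu> \<and> prokhorov_close E d \<epsilon> \<nu> \<mu>} \<noteq> {}"
    using prokhorov_close_1 by (metis (mono_tags, lifting) empty_iff mem_Collect_eq zero_less_one)
  from cInf_lessD[OF this] assms obtain \<delta> where "prokhorov_close E d \<delta> \<mu> \<nu>" "prokhorov_close E d \<delta> \<nu> \<mu>" "\<delta> < \<epsilon>"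
    unfolding levy_prokhorov_alt by blast
  then show "prokhorov_close E d \<epsilon> \<mu> \<nu>" "prokhorov_close E d \<epsilon> \<nu> \<mu>"
    by (auto intro: prokhorov_close_mono)
qed

lemma levy_prokhorov_leI:
  assumes "\<epsilon> > 0" "prokhorov_close E d \<epsilon> \<mu> \<nu>" "prokhorov_close E d \<epsilon> \<nu> \<mu>"
  shows "levy_prokhorov E d \<mu> \<nu> \<le> \<epsilon>"
  unfolding levy_prokhorov_alt using assms by (intro cInf_lower bdd_belowI[of _ 0]) auto

lemma levy_prokhorov_nonneg: "0 \<le> levy_prokhorov E d \<mu> \<nu>"
proof -
  have "1 \<in> {\<epsilon>. \<epsilon> > 0 \<and> prokhorov_close E d \<epsilon> \<mu> \<nu> \<and> prokhorov_close E d \<epsilon> \<nu> \<mu>}"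
    by (simp add: prokhorov_close_1)
  then show ?thesis
    unfolding levy_prokhorov_alt by (intro cInf_greatest) auto
qed

lemma levy_prokhorov_commute: "levy_prokhorov E d \<mu> \<nu> = levy_prokhorov E d \<nu> \<mu>"
  unfolding levy_prokhorov_alt by (simp add: conj_commute conj_left_commute)

lemma finite_in_sigma_sets:
  assumes "metrizes d E" "finite A" "A \<subseteq> topspace E"
  shows "A \<in> sigma_sets (topspace E) {U. openin E U}"
proof -
  interpret Metric_space "topspace E" d using assms by (simp add: metrizes_def)
  have "closedin mtopology A"
    using closedin_Hausdorff_finite[OF Hausdorff_space_mtopology] assms by simp
  then have "openin E (topspace E - A)"
    using assms by (simp add: metrizes_def closedin_def)
  then have "topspace E - (topspace E - A) \<in> sigma_sets (topspace E) {U. openin E U}"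
    by (intro sigma_sets.Compl sigma_sets.Basic) simp
  then show ?thesis
    using assms(3) by (simp add: double_diff)
qed

text \<open>A finitely supported measure only sees the intersection of a set with its support, so finite test
  sets suffice. They are Borel in a metrizable space, so the closeness of two measures can be applied to
  the intersection of a support with any set, such as a thickening or a preimage.\<close>

lemma prokhorov_close_finite_imp:
  assumes "\<And>A. finite A \<Longrightarrow> A \<subseteq> set_pmf \<mu> \<Longrightarrow> measure_pmf.prob \<mu> A \<le> measure_pmf.prob \<nu> (thickening E d \<epsilon> A) + \<epsilon>"
    and "finite (set_pmf \<mu>)"
  shows "prokhorov_close E d \<epsilon> \<mu> \<nu>"
  unfolding prokhorov_close_def
proof
  fix A
  have "measure_pmf.prob \<mu> A = measure_pmf.prob \<mu> (A \<inter> set_pmf \<mu>)"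
    by (simp add: measure_Int_set_pmf)
  also have "\<dots> \<le> measure_pmf.prob \<nu> (thickening E d \<epsilon> (A \<inter> set_pmf \<mu>)) + \<epsilon>"
    using assms by auto
  also have "measure_pmf.prob \<nu> (thickening E d \<epsilon> (A \<inter> set_pmf \<mu>)) \<le> measure_pmf.prob \<nu> (thickening E d \<epsilon> A)"
    by (intro measure_pmf.finite_measure_mono) (auto simp: thickening_def)
  finally show "measure_pmf.prob \<mu> A \<le> measure_pmf.prob \<nu> (thickening E d \<epsilon> A) + \<epsilon>" by simp
qed

lemma prokhorov_close_trans:
  assumes E: "metrizes d E" and "prokhorov_close E d \<epsilon> \<mu> \<nu>" "prokhorov_close E d \<delta> \<nu> \<rho>"
    and \<mu>: "\<mu> \<in> barycentres E k" and \<nu>: "\<nu> \<in> barycentres E k"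
  shows "prokhorov_close E d (\<epsilon> + \<delta>) \<mu> \<rho>"
proof (rule prokhorov_close_finite_imp)
  interpret Metric_space "topspace E" d using E by (simp add: metrizes_def)
  show "finite (set_pmf \<mu>)" using \<mu> by (simp add: barycentres_def)
  fix A assume A: "finite A" "A \<subseteq> set_pmf \<mu>"
  let ?A = "thickening E d \<epsilon> A \<inter> set_pmf \<nu>"
  have AE: "A \<subseteq> topspace E" using A \<mu> by (auto simp: barycentres_def)
  have "measure_pmf.prob \<mu> A \<le> measure_pmf.prob \<nu> (thickening E d \<epsilon> A) + \<epsilon>"
    using assms(2) finite_in_sigma_sets[OF E] A AE by (simp add: prokhorov_close_def)
  also have "measure_pmf.prob \<nu> (thickening E d \<epsilon> A) = measure_pmf.prob \<nu> ?A"
    by (simp add: measure_Int_set_pmf)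
  also have "measure_pmf.prob \<nu> ?A \<le> measure_pmf.prob \<rho> (thickening E d \<delta> ?A) + \<delta>"
    using assms(3) \<nu> finite_in_sigma_sets[OF E, of ?A] by (auto simp: prokhorov_close_def barycentres_def)
  also have "measure_pmf.prob \<rho> (thickening E d \<delta> ?A) \<le> measure_pmf.prob \<rho> (thickening E d (\<epsilon> + \<delta>) A)"
  proof (rule measure_pmf.finite_measure_mono)
    show "thickening E d \<delta> ?A \<subseteq> thickening E d (\<epsilon> + \<delta>) A"
    proof
      fix x assume "x \<in> thickening E d \<delta> ?A"
      then obtain a b where ab: "a \<in> A" "b \<in> topspace E" "d a b < \<epsilon>" "d b x < \<delta>" "x \<in> topspace E"
        by (auto simp: thickening_def)
      then have "d a x < \<epsilon> + \<delta>"
        using triangle[of a b x] AE by auto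
      with ab show "x \<in> thickening E d (\<epsilon> + \<delta>) A"
        by (auto simp: thickening_def)
    qed
  qed simp
  finally show "measure_pmf.prob \<mu> A \<le> measure_pmf.prob \<rho> (thickening E d (\<epsilon> + \<delta>) A) + (\<epsilon> + \<delta>)" by simp
qed

text \<open>For small \<open>\<epsilon>\<close> the \<open>\<epsilon>\<close>-neighbourhood of \<open>x\<close> contains no point of the finite support of \<open>\<nu>\<close> other
  than \<open>x\<close>.\<close>

lemma levy_prokhorov_zeroD:
  assumes E: "metrizes d E" and "levy_prokhorov E d \<mu> \<nu> = 0"
    and \<mu>: "\<mu> \<in> barycentres E k" and \<nu>: "\<nu> \<in> barycentres E k"
  shows "pmf \<mu> x \<le> pmf \<nu> x"
proof (cases "x \<in> set_pmf \<mu>")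
  case True
  interpret Metric_space "topspace E" d using E by (simp add: metrizes_def)
  have x: "x \<in> topspace E" using True \<mu> by (auto simp: barycentres_def)
  \<comment> \<open>The element 1 keeps the set nonempty when the support of \<open>\<nu>\<close> is contained in \<open>{x}\<close>.\<close>
  let ?D = "insert 1 (d x ` (set_pmf \<nu> - {x}))"
  have fin: "finite ?D" using \<nu> by (simp add: barycentres_def)
  have pos: "Min ?D > 0"
    using fin x \<nu> by (subst Min_gr_iff) (auto simp: barycentres_def less_le)
  have "pmf \<mu> x \<le> pmf \<nu> x + \<epsilon>" if \<epsilon>: "0 < \<epsilon>" "\<epsilon> < Min ?D" for \<epsilon>
  proof -
    have "prokhorov_close E d \<epsilon> \<mu> \<nu>"
      using assms(2) \<epsilon> by (intro levy_prokhorov_lessD) simp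
    then have "measure_pmf.prob \<mu> {x} \<le> measure_pmf.prob \<nu> (thickening E d \<epsilon> {x}) + \<epsilon>"
      using finite_in_sigma_sets[OF E, of "{x}"] x by (simp add: prokhorov_close_def)
    also have "measure_pmf.prob \<nu> (thickening E d \<epsilon> {x}) = measure_pmf.prob \<nu> (thickening E d \<epsilon> {x} \<inter> set_pmf \<nu>)"
      by (simp add: measure_Int_set_pmf)
    also have "\<dots> \<le> measure_pmf.prob \<nu> {x}"
    proof (rule measure_pmf.finite_measure_mono)
      have "d x y \<ge> Min ?D" if "y \<in> set_pmf \<nu>" "y \<noteq> x" for y
        using fin that by (intro Min_le) auto
      then show "thickening E d \<epsilon> {x} \<inter> set_pmf \<nu> \<subseteq> {x}"
        using \<epsilon> by (fastforce simp: thickening_def)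
    qed simp
    finally show ?thesis by (simp add: measure_pmf_single)
  qed
  note step = this
  show ?thesis
  proof (rule field_le_epsilon)
    fix \<epsilon> :: real assume "\<epsilon> > 0"
    then have "pmf \<mu> x \<le> pmf \<nu> x + min \<epsilon> (Min ?D / 2)"
      using pos by (intro step) (simp_all only: min_less_iff_conj min_less_iff_disj zero_less_divide_iff, simp_all)
    also have "\<dots> \<le> pmf \<nu> x + \<epsilon>" by simp
    finally show "pmf \<mu> x \<le> pmf \<nu> x + \<epsilon>" .
  qed
next
  case False
  then show ?thesis by (simp add: set_pmf_iff)
qed

lemma Metric_space_levy_prokhorov:
  assumes E: "metrizes d E"
  shows "Metric_space (barycentres E k) (levy_prokhorov E d)"
proof
  interpret Metric_space "topspace E" d using E by (simp add: metrizes_def)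
  fix \<mu> \<nu> \<rho>
  show "0 \<le> levy_prokhorov E d \<mu> \<nu>" by (rule levy_prokhorov_nonneg)
  show "levy_prokhorov E d \<mu> \<nu> = levy_prokhorov E d \<nu> \<mu>" by (rule levy_prokhorov_commute)
  assume \<mu>: "\<mu> \<in> barycentres E k" and \<nu>: "\<nu> \<in> barycentres E k"
  show "levy_prokhorov E d \<mu> \<nu> = 0 \<longleftrightarrow> \<mu> = \<nu>"
  proof
    assume "levy_prokhorov E d \<mu> \<nu> = 0"
    then have "pmf \<mu> x \<le> pmf \<nu> x" "pmf \<nu> x \<le> pmf \<mu> x" for x
      using levy_prokhorov_zeroD[OF E] \<mu> \<nu> levy_prokhorov_commute by metis+
    then show "\<mu> = \<nu>" by (intro pmf_eqI antisym)
  next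
    assume [simp]: "\<mu> = \<nu>"
    have "levy_prokhorov E d \<mu> \<nu> \<le> 0 + \<epsilon>" if "\<epsilon> > 0" for \<epsilon>
    proof -
      have "prokhorov_close E d \<epsilon> \<nu> \<nu>"
      proof (rule prokhorov_close_finite_imp)
        show "finite (set_pmf \<nu>)" using \<nu> by (simp add: barycentres_def)
        fix A assume "A \<subseteq> set_pmf \<nu>"
        moreover have "set_pmf \<nu> \<subseteq> topspace E" using \<nu> by (simp add: barycentres_def)
        ultimately have "A \<subseteq> thickening E d \<epsilon> A"
          using that by (force simp: thickening_def)
        then have "measure_pmf.prob \<nu> A \<le> measure_pmf.prob \<nu> (thickening E d \<epsilon> A)"
          by (intro measure_pmf.finite_measure_mono) auto
        then show "measure_pmf.prob \<nu> A \<le> measure_pmf.prob \<nu> (thickening E d \<epsilon> A) + \<epsilon>"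
          using that by simp
      qed
      then show ?thesis using that by (simp add: levy_prokhorov_leI)
    qed
    then have "levy_prokhorov E d \<mu> \<nu> \<le> 0" by (rule field_le_epsilon)
    then show "levy_prokhorov E d \<mu> \<nu> = 0" using levy_prokhorov_nonneg by (rule antisym)
  qed
  assume \<rho>: "\<rho> \<in> barycentres E k"
  show "levy_prokhorov E d \<mu> \<rho> \<le> levy_prokhorov E d \<mu> \<nu> + levy_prokhorov E d \<nu> \<rho>"
  proof (rule field_le_epsilon)
    fix \<epsilon> :: real assume \<epsilon>: "\<epsilon> > 0"
    let ?a = "levy_prokhorov E d \<mu> \<nu> + \<epsilon> / 2" and ?b = "levy_prokhorov E d \<nu> \<rho> + \<epsilon> / 2"
    have "prokhorov_close E d ?a \<mu> \<nu>" "prokhorov_close E d ?a \<nu> \<mu>" "prokhorov_close E d ?b \<nu> \<rho>" "prokhorov_close E d ?b \<rho> \<nu>"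
      using \<epsilon> levy_prokhorov_commute[of E d \<nu> \<mu>] levy_prokhorov_commute[of E d \<rho> \<nu>]
      by (auto intro!: levy_prokhorov_lessD)
    then have "prokhorov_close E d (?a + ?b) \<mu> \<rho>" "prokhorov_close E d (?b + ?a) \<rho> \<mu>"
      using prokhorov_close_trans[OF E] \<mu> \<nu> \<rho> by blast+
    then have "levy_prokhorov E d \<mu> \<rho> \<le> ?a + ?b"
      using \<epsilon> levy_prokhorov_nonneg[of E d \<mu> \<nu>] levy_prokhorov_nonneg[of E d \<nu> \<rho>]
      by (intro levy_prokhorov_leI) (auto simp: add.commute)
    then show "levy_prokhorov E d \<mu> \<rho> \<le> levy_prokhorov E d \<mu> \<nu> + levy_prokhorov E d \<nu> \<rho> + \<epsilon>"
      by simp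
  qed
qed

text \<open>It is enough to control \<open>\<phi>\<close> near the support of \<open>\<mu>\<close>. For the first direction, a set \<open>A\<close> is tested on
  the part of the support that \<open>\<phi>\<close> sends into \<open>A\<close>. For the second, the same inequality
  \<open>\<mu> B \<le> \<nu> (thickening B) + \<delta>\<close> is applied to the part of the support that \<open>\<phi>\<close> sends outside the
  thickening of \<open>A\<close>; the complements give the required bound for \<open>\<nu>\<close>.\<close>

lemma prokhorov_close_map_pmf:
  assumes E: "metrizes d E" and E': "metrizes d' E'" and \<phi>: "\<phi> \<in> topspace E \<rightarrow> topspace E'"
    and \<mu>: "\<mu> \<in> barycentres E k" and \<nu>: "\<nu> \<in> barycentres E k" and "\<delta> \<le> \<epsilon>"
    and ball: "\<And>e x. e \<in> set_pmf \<mu> \<Longrightarrow> x \<in> topspace E \<Longrightarrow> d e x < \<delta> \<Longrightarrow> d' (\<phi> e) (\<phi> x) < \<epsilon>"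
    and close: "prokhorov_close E d \<delta> \<mu> \<nu>"
  shows "prokhorov_close E' d' \<epsilon> (map_pmf \<phi> \<mu>) (map_pmf \<phi> \<nu>)"
    and "prokhorov_close E' d' \<epsilon> (map_pmf \<phi> \<nu>) (map_pmf \<phi> \<mu>)"
proof -
  interpret E: Metric_space "topspace E" d using E by (simp add: metrizes_def)
  interpret E': Metric_space "topspace E'" d' using E' by (simp add: metrizes_def)
  let ?S = "set_pmf \<mu>"
  have S: "finite ?S" "?S \<subseteq> topspace E" and \<nu>S: "set_pmf \<nu> \<subseteq> topspace E"
    using \<mu> \<nu> by (auto simp: barycentres_def)
  have sub: "measure_pmf.prob \<mu> B \<le> measure_pmf.prob \<nu> (thickening E d \<delta> B) + \<delta>" if "B \<subseteq> ?S" for B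
    using close finite_in_sigma_sets[OF E, of B] that S by (meson finite_subset prokhorov_close_def order_trans)
  show "prokhorov_close E' d' \<epsilon> (map_pmf \<phi> \<mu>) (map_pmf \<phi> \<nu>)"
    unfolding prokhorov_close_def
  proof
    fix A
    let ?B = "\<phi> -` A \<inter> ?S"
    have "measure_pmf.prob (map_pmf \<phi> \<mu>) A = measure_pmf.prob \<mu> ?B"
      by (simp add: measure_Int_set_pmf)
    also have "\<dots> \<le> measure_pmf.prob \<nu> (thickening E d \<delta> ?B) + \<delta>"
      by (rule sub) simp
    also have "measure_pmf.prob \<nu> (thickening E d \<delta> ?B) \<le> measure_pmf.prob \<nu> (\<phi> -` thickening E' d' \<epsilon> A)"
      using \<phi> ball by (intro measure_pmf.finite_measure_mono) (auto simp: thickening_def)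
    finally show "measure_pmf.prob (map_pmf \<phi> \<mu>) A \<le> measure_pmf.prob (map_pmf \<phi> \<nu>) (thickening E' d' \<epsilon> A) + \<epsilon>"
      using \<open>\<delta> \<le> \<epsilon>\<close> by simp
  qed
  show "prokhorov_close E' d' \<epsilon> (map_pmf \<phi> \<nu>) (map_pmf \<phi> \<mu>)"
    unfolding prokhorov_close_def
  proof
    fix A assume "A \<in> sigma_sets (topspace E') {U. openin E' U}"
    let ?T = "\<phi> -` thickening E' d' \<epsilon> A"
    let ?C = "?S - ?T"
    have "measure_pmf.prob \<nu> (\<phi> -` A) = measure_pmf.prob \<nu> (\<phi> -` A \<inter> set_pmf \<nu>)"
      by (simp add: measure_Int_set_pmf)
    also have "\<dots> \<le> measure_pmf.prob \<nu> (- thickening E d \<delta> ?C)"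
    proof (rule measure_pmf.finite_measure_mono)
      have False if "x \<in> \<phi> -` A" "x \<in> thickening E d \<delta> ?C" for x
      proof -
        from that obtain c where c: "c \<in> ?S" "c \<notin> ?T" "d c x < \<delta>" "x \<in> topspace E"
          by (auto simp: thickening_def)
        then have "d' (\<phi> x) (\<phi> c) < \<epsilon>" using ball E'.commute by metis
        moreover have "\<phi> c \<in> topspace E'" using c S \<phi> by auto
        ultimately show False using c that by (auto simp: thickening_def)
      qed
      then show "\<phi> -` A \<inter> set_pmf \<nu> \<subseteq> - thickening E d \<delta> ?C" by blast
    qed simp
    also have "\<dots> = 1 - measure_pmf.prob \<nu> (thickening E d \<delta> ?C)"
      using measure_pmf.prob_compl[of "thickening E d \<delta> ?C" \<nu>] by (simp add: Compl_eq_Diff_UNIV)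
    also have "\<dots> \<le> 1 - measure_pmf.prob \<mu> ?C + \<delta>"
      using sub[of ?C] by simp
    also have "measure_pmf.prob \<mu> ?C = measure_pmf.prob \<mu> (- ?T)"
      using measure_Int_set_pmf[of \<mu> "- ?T"] by (simp add: Diff_eq Int_commute)
    also have "1 - measure_pmf.prob \<mu> (- ?T) = measure_pmf.prob \<mu> ?T"
      using measure_pmf.prob_compl[of ?T \<mu>] by (simp add: Compl_eq_Diff_UNIV)
    finally show "measure_pmf.prob (map_pmf \<phi> \<nu>) A \<le> measure_pmf.prob (map_pmf \<phi> \<mu>) (thickening E' d' \<epsilon> A) + \<epsilon>"
      using \<open>\<delta> \<le> \<epsilon>\<close> by simp
  qed
qed

text \<open>Since the support of \<open>\<mu>\<close> is finite, continuity of \<open>\<phi>\<close> at its points yields a single \<open>\<delta>\<close>.\<close>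

lemma functorial_levy_prokhorov:
  assumes E: "metrizes d E" and E': "metrizes d' E'"
  shows "functorial_on (levy_prokhorov_topology d) E (levy_prokhorov_topology d') E'"
  unfolding functorial_on_def
proof (intro conjI allI impI)
  fix k
  interpret L: Metric_space "barycentres E k" "levy_prokhorov E d"
    by (rule Metric_space_levy_prokhorov[OF E])
  show top: "topspace (levy_prokhorov_topology d E k) = barycentres E k"
    by (simp add: levy_prokhorov_topology_def)
  interpret L': Metric_space "barycentres E' k" "levy_prokhorov E' d'"
    by (rule Metric_space_levy_prokhorov[OF E'])
  interpret E: Metric_space "topspace E" d using E by (simp add: metrizes_def)
  interpret E': Metric_space "topspace E'" d' using E' by (simp add: metrizes_def)
  fix \<phi> assume \<phi>: "continuous_map E E' \<phi>"
  have \<phi>_top: "\<phi> \<in> topspace E \<rightarrow> topspace E'"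
    using \<phi> by (auto simp: continuous_map_def)
  show "continuous_map (levy_prokhorov_topology d E k) (levy_prokhorov_topology d' E' k) (map_pmf \<phi>)"
    unfolding continuous_map_def top
  proof (intro conjI allI impI)
    show "map_pmf \<phi> \<in> barycentres E k \<rightarrow> topspace (levy_prokhorov_topology d' E' k)"
      using map_pmf_in_barycentres[OF \<phi>] by (auto simp: levy_prokhorov_topology_def)
    fix W assume "openin (levy_prokhorov_topology d' E' k) W"
    then have W: "openin L'.mtopology W" by (simp add: levy_prokhorov_topology_def)
    have "\<exists>\<delta>>0. L.mball \<mu> \<delta> \<subseteq> {\<mu> \<in> barycentres E k. map_pmf \<phi> \<mu> \<in> W}"
      if \<mu>: "\<mu> \<in> barycentres E k" and \<mu>W: "map_pmf \<phi> \<mu> \<in> W" for \<mu>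
    proof -
      obtain r where r: "r > 0" "L'.mball (map_pmf \<phi> \<mu>) r \<subseteq> W"
        using W \<mu>W unfolding L'.openin_mtopology by blast
      \<comment> \<open>Half of \<open>r\<close>, since closeness only yields a non-strict bound on the distance.\<close>
      define \<epsilon> where "\<epsilon> = r / 2"
      have \<epsilon>: "\<epsilon> > 0" using r by (simp add: \<epsilon>_def)
      have S: "finite (set_pmf \<mu>)" "set_pmf \<mu> \<subseteq> topspace E" using \<mu> by (auto simp: barycentres_def)
      have "\<exists>\<delta>>0. \<forall>x\<in>topspace E. d e x < \<delta> \<longrightarrow> d' (\<phi> e) (\<phi> x) < \<epsilon>" if e: "e \<in> set_pmf \<mu>" for e
      proof -
        have "openin E' (E'.mball (\<phi> e) \<epsilon>)"
          using E' E'.openin_mball by (simp add: metrizes_def)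
        then have "openin E {x \<in> topspace E. \<phi> x \<in> E'.mball (\<phi> e) \<epsilon>}"
          by (rule openin_continuous_map_preimage[OF \<phi>])
        then have "openin E.mtopology {x \<in> topspace E. \<phi> x \<in> E'.mball (\<phi> e) \<epsilon>}"
          using E by (simp add: metrizes_def)
        moreover have "e \<in> {x \<in> topspace E. \<phi> x \<in> E'.mball (\<phi> e) \<epsilon>}"
        proof -
          have "e \<in> topspace E" "\<phi> e \<in> topspace E'" using e S \<phi>_top by auto
          then show ?thesis using \<epsilon> E'.zero[of "\<phi> e" "\<phi> e"] by simp
        qed
        ultimately obtain \<delta> where "\<delta> > 0" "E.mball e \<delta> \<subseteq> {x \<in> topspace E. \<phi> x \<in> E'.mball (\<phi> e) \<epsilon>}"
          unfolding E.openin_mtopology by blast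
        then show ?thesis using e S by (intro exI[of _ \<delta>]) (auto simp: subset_iff)
      qed
      then obtain \<delta> where \<delta>: "\<And>e. e \<in> set_pmf \<mu> \<Longrightarrow> \<delta> e > 0"
        "\<And>e x. e \<in> set_pmf \<mu> \<Longrightarrow> x \<in> topspace E \<Longrightarrow> d e x < \<delta> e \<Longrightarrow> d' (\<phi> e) (\<phi> x) < \<epsilon>"
        by metis
      define \<delta>0 where "\<delta>0 = Min (insert \<epsilon> (\<delta> ` set_pmf \<mu>))"
      have \<delta>0: "\<delta>0 > 0" "\<delta>0 \<le> \<epsilon>" "\<And>e. e \<in> set_pmf \<mu> \<Longrightarrow> \<delta>0 \<le> \<delta> e"
        using S \<epsilon> \<delta>(1) by (auto simp: \<delta>0_def Min_gr_iff intro: Min_le)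
      have "map_pmf \<phi> \<nu> \<in> W" if \<nu>: "\<nu> \<in> L.mball \<mu> \<delta>0" for \<nu>
      proof -
        have "prokhorov_close E d \<delta>0 \<mu> \<nu>" "\<nu> \<in> barycentres E k"
          using \<nu> levy_prokhorov_lessD(1)[of E d \<mu> \<nu> \<delta>0] by auto
        then have "prokhorov_close E' d' \<epsilon> (map_pmf \<phi> \<mu>) (map_pmf \<phi> \<nu>)" "prokhorov_close E' d' \<epsilon> (map_pmf \<phi> \<nu>) (map_pmf \<phi> \<mu>)"
          using prokhorov_close_map_pmf[OF E E' \<phi>_top \<mu>, of \<nu> \<delta>0 \<epsilon>] \<delta>(2) \<delta>0 by (meson order_less_le_trans)+
        then have "levy_prokhorov E' d' (map_pmf \<phi> \<mu>) (map_pmf \<phi> \<nu>) \<le> \<epsilon>"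
          using \<epsilon> by (intro levy_prokhorov_leI)
        also have "\<epsilon> < r" using r by (simp add: \<epsilon>_def)
        finally have "map_pmf \<phi> \<nu> \<in> L'.mball (map_pmf \<phi> \<mu>) r"
          using map_pmf_in_barycentres[OF \<phi>] \<mu> \<open>\<nu> \<in> barycentres E k\<close> by simp
        then show ?thesis using r by blast
      qed
      then show ?thesis using \<delta>0 by (intro exI[of _ \<delta>0]) auto
    qed
    then show "openin (levy_prokhorov_topology d E k) {\<mu> \<in> barycentres E k. map_pmf \<phi> \<mu> \<in> W}"
      unfolding levy_prokhorov_topology_def L.openin_mtopology by blast
  qed
qed

section \<open>Path homotopy\<close>

lemma path_homotopic_iff:
  "path_homotopic Y p q \<longleftrightarrow>
     (\<exists>h. continuous_map (prod_topology unit_interval unit_interval) Y h \<and>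
          (\<forall>t\<in>{0..1}. h (0, t) = p t) \<and> (\<forall>t\<in>{0..1}. h (1, t) = q t) \<and>
          (\<forall>s\<in>{0..1}. h (s, 0) = p 0 \<and> h (s, 1) = p 1))"
  unfolding path_homotopic_def by (subst homotopic_with) auto

lemma path_homotopic_pathin:
  assumes "path_homotopic Y p q" shows "pathin Y p" "pathin Y q"
  using homotopic_with_imp_continuous_maps[OF assms[unfolded path_homotopic_def]]
  by (auto simp: pathin_def)

lemma path_homotopic_ends:
  assumes "path_homotopic Y p q" shows "q 0 = p 0" "q 1 = p 1"
  using homotopic_with_imp_property[OF assms[unfolded path_homotopic_def]] by auto

lemma pathin_in_topspace: "pathin Y p \<Longrightarrow> s \<in> {0..1} \<Longrightarrow> p s \<in> topspace Y"
  using path_image_subset_topspace by blast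

lemma path_homotopic_eq:
  assumes "pathin Y p" "\<And>t. t \<in> {0..1} \<Longrightarrow> p t = q t"
  shows "path_homotopic Y p q"
  unfolding path_homotopic_def
  by (rule homotopic_with_equal) (use assms in \<open>auto simp: pathin_def\<close>)

lemma path_homotopic_refl: "pathin Y p \<Longrightarrow> path_homotopic Y p p"
  by (rule path_homotopic_eq) simp_all

lemma path_homotopic_sym:
  assumes "path_homotopic Y p q" shows "path_homotopic Y q p"
proof -
  have "homotopic_with (\<lambda>r. r 0 = p 0 \<and> r 1 = p 1) unit_interval Y q p"
    using assms homotopic_with_sym by (fastforce simp: path_homotopic_def)
  then show ?thesis
    using path_homotopic_ends[OF assms] by (simp add: path_homotopic_def)
qed

lemma path_homotopic_trans:
  assumes "path_homotopic Y p q" "path_homotopic Y q r" shows "path_homotopic Y p r"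
proof -
  have "homotopic_with (\<lambda>u. u 0 = p 0 \<and> u 1 = p 1) unit_interval Y q r"
    using assms(2) path_homotopic_ends[OF assms(1)] by (simp add: path_homotopic_def)
  then show ?thesis
    using assms(1) homotopic_with_trans unfolding path_homotopic_def by blast
qed

lemma path_homotopic_compose:
  assumes "path_homotopic Y p q" "continuous_map Y Z f"
  shows "path_homotopic Z (f \<circ> p) (f \<circ> q)"
  using assms unfolding path_homotopic_def
  by (rule homotopic_with_compose_continuous_map_left) auto

lemma path_homotopic_pair:
  assumes "path_homotopic A p q" "path_homotopic B p' q'"
  shows "path_homotopic (prod_topology A B) (\<lambda>t. (p t, p' t)) (\<lambda>t. (q t, q' t))"
proof -
  obtain h h' where
    "continuous_map (prod_topology unit_interval unit_interval) A h" "\<forall>t\<in>{0..1}. h (0, t) = p t"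
    "\<forall>t\<in>{0..1}. h (1, t) = q t" "\<forall>s\<in>{0..1}. h (s, 0) = p 0 \<and> h (s, 1) = p 1"
    "continuous_map (prod_topology unit_interval unit_interval) B h'" "\<forall>t\<in>{0..1}. h' (0, t) = p' t"
    "\<forall>t\<in>{0..1}. h' (1, t) = q' t" "\<forall>s\<in>{0..1}. h' (s, 0) = p' 0 \<and> h' (s, 1) = p' 1"
    using assms unfolding path_homotopic_iff by blast
  then show ?thesis
    unfolding path_homotopic_iff
    by (intro exI[of _ "\<lambda>z. (h z, h' z)"]) (simp add: continuous_map_pairwise o_def)
qed

text \<open>All the relations of the fundamental groupoid that are used below (a path followed by its reverse is
  trivial, and so on) are instances of this: both sides run through one and the same path, with
  parametrizations that agree at the ends and are therefore linearly homotopic.\<close>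

lemma path_homotopic_reparametrize:
  assumes p: "pathin Y p" and a: "continuous_on {0..1} a" "a ` {0..1} \<subseteq> {0..1}"
    and b: "continuous_on {0..1} b" "b ` {0..1} \<subseteq> {0..1}" and ab: "a 0 = b 0" "a 1 = b 1"
  shows "path_homotopic Y (p \<circ> a) (p \<circ> b)"
proof -
  let ?c = "\<lambda>(s, t). (1 - s) * a t + s * b t"
  have snd: "continuous_on ({0..1} \<times> {0..1}) (snd :: real \<times> real \<Rightarrow> real)"
    "snd ` ({0..1} \<times> {0..1}) \<subseteq> {0..1::real}"
    by (auto intro: continuous_intros)
  have "continuous_on ({0..1} \<times> {0..1}) (\<lambda>z::real \<times> real. a (snd z))"
    by (rule continuous_on_compose2[OF a(1) snd])
  moreover have "continuous_on ({0..1} \<times> {0..1}) (\<lambda>z::real \<times> real. b (snd z))"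
    by (rule continuous_on_compose2[OF b(1) snd])
  ultimately have "continuous_on ({0..1} \<times> {0..1}) ?c"
    unfolding case_prod_unfold by (intro continuous_intros)
  moreover have "?c z \<in> {0..1}" if z': "z \<in> {0..1} \<times> {0..1}" for z
  proof -
    obtain s t where z: "z = (s, t)" "s \<in> {0..1}" "t \<in> {0..1}" using z' by blast
    have "convex {0..1::real}" by simp
    moreover have "a t \<in> {0..1}" "b t \<in> {0..1}" using a(2) b(2) z(3) by (simp_all only: image_subset_iff)
    ultimately have "(1 - s) *\<^sub>R a t + s *\<^sub>R b t \<in> {0..1}"
      using z unfolding convex_alt by auto
    then show ?thesis by (simp add: z)
  qed
  ultimately have "continuous_map (prod_topology unit_interval unit_interval) unit_interval ?c"
    by (auto simp: prod_topology_subtopology_eu)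
  from continuous_map_compose[OF this p[unfolded pathin_def]] show ?thesis
    unfolding path_homotopic_iff
    by (intro exI[of _ "p \<circ> ?c"]) (auto simp: ab algebra_simps)
qed

lemma path_class_eq_iff:
  assumes "pathin Y p"
  shows "path_class Y p = path_class Y q \<longleftrightarrow> path_homotopic Y p q"
proof
  assume "path_class Y p = path_class Y q"
  moreover have "p \<in> path_class Y p" by (simp add: path_class_def path_homotopic_refl assms)
  ultimately show "path_homotopic Y p q" by (simp add: path_class_def path_homotopic_sym)
next
  assume "path_homotopic Y p q"
  then show "path_class Y p = path_class Y q"
    by (auto simp: path_class_def intro: path_homotopic_trans path_homotopic_sym)
qed

text \<open>The maps between fundamental groups are defined as unions over representatives; this evaluates them
  on the class of one representative.\<close>

lemma path_class_UN_eq: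
  assumes p: "pathin Y p" and \<Phi>: "\<And>q. path_homotopic Y p q \<Longrightarrow> path_homotopic Z (\<Phi> p) (\<Phi> q)"
  shows "(\<Union>q\<in>path_class Y p. path_class Z (\<Phi> q)) = path_class Z (\<Phi> p)"
proof -
  have "path_class Z (\<Phi> q) = path_class Z (\<Phi> p)" if "q \<in> path_class Y p" for q
    using \<Phi>[of q] that path_class_eq_iff[of Z "\<Phi> p" "\<Phi> q"] path_homotopic_pathin[of Z "\<Phi> p" "\<Phi> q"]
    by (simp add: path_class_def)
  moreover have "p \<in> path_class Y p" by (simp add: path_class_def path_homotopic_refl p)
  ultimately show ?thesis by blast
qed

lemma pi1_map_path_class:
  assumes "pathin Y p" "continuous_map Y Z f"
  shows "pi1_map Z f (path_class Y p) = path_class Z (f \<circ> p)"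
  unfolding pi1_map_def using assms
  by (intro path_class_UN_eq path_homotopic_compose)

lemma pi1_map_image_pi1:
  assumes "continuous_map Y Z f"
  shows "pi1_map Z f ` pi1 Y y = {path_class Z (f \<circ> p) | p. pathin Y p \<and> p 0 = y \<and> p 1 = y}"
  using pi1_map_path_class[OF _ assms] unfolding pi1_def by (auto simp: image_iff) 

lemma unit_interval_affine:
  "pathin Y p \<Longrightarrow> continuous_map (top_of_set {a..b}) unit_interval \<phi> \<Longrightarrow>
     continuous_map (top_of_set {a..b}) Y (\<lambda>t. p (\<phi> t))"
  unfolding pathin_def using continuous_map_compose[of _ unit_interval \<phi> Y p] by (auto simp: o_def)

lemma pathin_join:
  assumes p: "pathin Y p" and q: "pathin Y q" and "p 1 = q 0"
  shows "pathin Y (join_paths p q)"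
  unfolding join_paths_def pathin_def
proof (rule continuous_map_cases_le)
  have 1: "subtopology unit_interval {x \<in> topspace unit_interval. x \<le> 1/2} = top_of_set {0..1/2}"
    by (auto simp: subtopology_subtopology intro!: arg_cong[where f = top_of_set])
  have 2: "subtopology unit_interval {x \<in> topspace unit_interval. 1/2 \<le> x} = top_of_set {1/2..1}"
    by (auto simp: subtopology_subtopology intro!: arg_cong[where f = top_of_set])
  show "continuous_map (subtopology unit_interval {x \<in> topspace unit_interval. x \<le> 1/2}) Y (\<lambda>x. p (2 * x))"
    unfolding 1 by (rule unit_interval_affine[OF p]) (auto intro!: continuous_intros)
  show "continuous_map (subtopology unit_interval {x \<in> topspace unit_interval. 1/2 \<le> x}) Y (\<lambda>x. q (2 * x - 1))"
    unfolding 2 by (rule unit_interval_affine[OF q]) (auto intro!: continuous_intros)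
  fix x :: real assume x: "x = 1 / 2"
  show "p (2 * x) = q (2 * x - 1)" unfolding x using assms(3) by simp
qed auto

lemma pathin_reverse:
  assumes "pathin Y p" shows "pathin Y (reverse_path p)"
  unfolding reverse_path_def pathin_def
  by (rule unit_interval_affine[OF assms]) (auto intro!: continuous_intros)

lemma join_paths_ends [simp]: "join_paths p q 0 = p 0" "join_paths p q 1 = q 1"
  by (simp_all add: join_paths_def)

lemma reverse_path_ends [simp]: "reverse_path p 0 = p 1" "reverse_path p 1 = p 0"
  by (simp_all add: reverse_path_def)

lemma path_homotopic_join:
  assumes "path_homotopic Y p p'" "path_homotopic Y q q'" "p 1 = q 0"
  shows "path_homotopic Y (join_paths p q) (join_paths p' q')"
proof -
  let ?II = "prod_topology unit_interval unit_interval"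
  obtain h where h: "continuous_map ?II Y h" "\<forall>t\<in>{0..1}. h (0, t) = p t" "\<forall>t\<in>{0..1}. h (1, t) = p' t"
      "\<forall>s\<in>{0..1}. h (s, 0) = p 0 \<and> h (s, 1) = p 1"
    using assms(1) unfolding path_homotopic_iff by blast
  obtain k where k: "continuous_map ?II Y k" "\<forall>t\<in>{0..1}. k (0, t) = q t" "\<forall>t\<in>{0..1}. k (1, t) = q' t"
      "\<forall>s\<in>{0..1}. k (s, 0) = q 0 \<and> k (s, 1) = q 1"
    using assms(2) unfolding path_homotopic_iff by blast
  have sub: "subtopology ?II {z \<in> topspace ?II. snd z \<le> 1/2} = top_of_set ({0..1} \<times> {0..1/2})"
    "subtopology ?II {z \<in> topspace ?II. 1/2 \<le> snd z} = top_of_set ({0..1} \<times> {1/2..1})"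
    by (auto simp: subtopology_subtopology intro!: arg_cong[where f = top_of_set])
  have "continuous_map ?II Y (\<lambda>z. if snd z \<le> 1/2 then h (fst z, 2 * snd z) else k (fst z, 2 * snd z - 1))"
  proof (rule continuous_map_cases_le)
    have "continuous_map (top_of_set ({0..1} \<times> {0..1/2})) ?II (\<lambda>z. (fst z, 2 * snd z))"
      by (auto intro!: continuous_intros)
    from continuous_map_compose[OF this h(1)]
    show "continuous_map (subtopology ?II {z \<in> topspace ?II. snd z \<le> 1/2}) Y (\<lambda>z. h (fst z, 2 * snd z))"
      unfolding sub by (simp only: o_def)
    have "continuous_map (top_of_set ({0..1} \<times> {1/2..1})) ?II (\<lambda>z. (fst z, 2 * snd z - 1))"
      by (auto intro!: continuous_intros)
    from continuous_map_compose[OF this k(1)]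
    show "continuous_map (subtopology ?II {z \<in> topspace ?II. 1/2 \<le> snd z}) Y (\<lambda>z. k (fst z, 2 * snd z - 1))"
      unfolding sub by (simp only: o_def)
    fix z assume z: "z \<in> topspace ?II" "snd z = 1/2"
    have "fst z \<in> {0..1}" using z(1) by auto
    then show "h (fst z, 2 * snd z) = k (fst z, 2 * snd z - 1)"
      unfolding z(2) using h(4) k(4) assms(3) by simp
  qed (auto intro!: continuous_intros)
  then show ?thesis
    unfolding path_homotopic_iff
    using h k by (intro exI[of _ "\<lambda>z. if snd z \<le> 1/2 then h (fst z, 2 * snd z) else k (fst z, 2 * snd z - 1)"])
      (auto simp: join_paths_def)
qed

lemma pi1_transport_path_class:
  assumes p: "pathin Y p" and \<sigma>: "pathin Y \<sigma>" and ends: "p 0 = \<sigma> 0" "p 1 = \<sigma> 0"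
  shows "pi1_transport Y \<sigma> (path_class Y p) = path_class Y (join_paths (reverse_path \<sigma>) (join_paths p \<sigma>))"
  unfolding pi1_transport_def
  using assms by (intro path_class_UN_eq path_homotopic_join path_homotopic_refl pathin_reverse) auto

text \<open>The path that runs back along \<open>\<sigma>\<close>, waits, and runs forward along \<open>\<sigma>\<close>, as a reparametrization of \<open>\<sigma>\<close>.\<close>

lemma join_reverse_const:
  assumes "s \<in> {0..1}"
  shows "join_paths (reverse_path \<sigma>) (join_paths (\<lambda>_. \<sigma> 0) \<sigma>) s = \<sigma> (max (1 - 2 * s) (max 0 (4 * s - 3)))"
proof -
  consider "s \<le> 1/2" | "1/2 < s" "s \<le> 3/4" | "3/4 < s" by linarith
  then show ?thesis
    using assms by cases (auto simp: join_paths_def reverse_path_def max_def algebra_simps)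
qed

lemma join_reverse_const_homotopic:
  assumes \<sigma>: "pathin Y \<sigma>"
  shows "path_homotopic Y (join_paths (reverse_path \<sigma>) (join_paths (\<lambda>_. \<sigma> 0) \<sigma>)) (\<lambda>_. \<sigma> 1)"
proof -
  let ?a = "\<lambda>s::real. max (1 - 2 * s) (max 0 (4 * s - 3))"
  have "path_homotopic Y (\<sigma> \<circ> ?a) (\<sigma> \<circ> (\<lambda>_. 1))"
    by (rule path_homotopic_reparametrize[OF \<sigma>]) (auto intro!: continuous_intros)
  then have "path_homotopic Y (\<sigma> \<circ> ?a) (\<lambda>_. \<sigma> 1)" by (simp add: o_def)
  moreover have "path_homotopic Y (\<sigma> \<circ> ?a) (join_paths (reverse_path \<sigma>) (join_paths (\<lambda>_. \<sigma> 0) \<sigma>))"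
    by (rule path_homotopic_eq[OF path_homotopic_pathin(1)[OF calculation]])
       (simp only: o_apply join_reverse_const)
  ultimately show ?thesis by (blast intro: path_homotopic_trans path_homotopic_sym)
qed

text \<open>Conjugating a loop \<open>p\<close> by \<open>g\<close> and then back again. Both paths are reparametrizations of
  \<open>\<omega> = g \<cdot> p \<cdot> g\<^sup>-\<^sup>1\<close>: the loop \<open>p\<close> is its part from \<open>1/2\<close> to \<open>3/4\<close>, and the longer path starts at \<open>1/2\<close>,
  goes back to \<open>0\<close>, forward to \<open>1\<close>, and back to \<open>3/4\<close>.\<close>

lemma join_conjugate_homotopic:
  assumes g: "pathin Y g" and p: "pathin Y p" and ends: "p 0 = g 1" "p 1 = g 1"
  defines "\<omega> \<equiv> join_paths g (join_paths p (reverse_path g))"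
  shows "path_homotopic Y (join_paths (reverse_path g) (join_paths \<omega> g)) p"
proof -
  \<comment> \<open>The three linear pieces of \<open>?a\<close> meet at \<open>s = 1/2\<close> and \<open>s = 3/4\<close>.\<close>
  let ?a = "\<lambda>s::real. max (1/2 - s) (min (4 * s - 2) (7/4 - s))"
  let ?b = "\<lambda>s::real. 1/2 + s / 4"
  have \<omega>: "pathin Y \<omega>"
    unfolding \<omega>_def using g p ends by (intro pathin_join pathin_reverse) auto
  have hom: "path_homotopic Y (\<omega> \<circ> ?a) (\<omega> \<circ> ?b)"
  proof (rule path_homotopic_reparametrize[OF \<omega>])
    show "continuous_on {0..1} ?a" "continuous_on {0..1} ?b"
      by (intro continuous_intros; simp)+
    show "?a ` {0..1} \<subseteq> {0..1}" "?b ` {0..1} \<subseteq> {0..1}"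
      by (auto simp: max_def min_def)
  qed simp_all
  have "(\<omega> \<circ> ?a) s = join_paths (reverse_path g) (join_paths \<omega> g) s" if s: "s \<in> {0..1}" for s
  proof -
    consider "s \<le> 1/2" | "1/2 < s" "s \<le> 3/4" | "3/4 < s" "s < 1" | "s = 1" using s by fastforce
    then show ?thesis
    proof cases
      case 1
      then have "?a s = 1/2 - s" by (simp add: max_def min_def)
      then show ?thesis using 1 s by (simp add: join_paths_def reverse_path_def \<omega>_def algebra_simps)
    next
      case 2
      then have "?a s = 4 * s - 2" by (simp add: max_def min_def)
      moreover have "join_paths (reverse_path g) (join_paths \<omega> g) s = \<omega> (4 * s - 2)"
        using 2 by (simp add: join_paths_def algebra_simps)
      ultimately show ?thesis by simp
    next
      case 3
      then have "?a s = 7/4 - s" by (simp add: max_def min_def)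
      moreover have "\<omega> (7/4 - s) = g (4 * s - 3)"
        using 3 by (simp add: \<omega>_def join_paths_def reverse_path_def algebra_simps)
      moreover have "join_paths (reverse_path g) (join_paths \<omega> g) s = g (4 * s - 3)"
        using 3 by (simp add: join_paths_def algebra_simps)
      ultimately show ?thesis by simp
    next
      case 4
      then show ?thesis using ends by (simp add: \<omega>_def join_paths_def reverse_path_def)
    qed
  qed
  then have 1: "path_homotopic Y (\<omega> \<circ> ?a) (join_paths (reverse_path g) (join_paths \<omega> g))"
    using path_homotopic_pathin(1)[OF hom] by (intro path_homotopic_eq)
  have "(\<omega> \<circ> ?b) s = p s" if s: "s \<in> {0..1}" for s
    using s ends by (cases "s = 0") (auto simp: \<omega>_def join_paths_def)
  then have 2: "path_homotopic Y (\<omega> \<circ> ?b) p"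
    using path_homotopic_pathin(2)[OF hom] by (intro path_homotopic_eq)
  show ?thesis
    using path_homotopic_trans[OF path_homotopic_sym[OF 1] path_homotopic_trans[OF hom 2]] .
qed

lemma connected_unit_interval: "connected_space unit_interval"
  by (simp add: connected_space_subtopology)

section \<open>Covering maps\<close>

text \<open>A sheet \<open>V\<close> over the evenly covered set \<open>U\<close>, together with the inverse \<open>\<sigma>\<close> of the homeomorphism from
  \<open>V\<close> to \<open>U\<close>.\<close>

definition covering_sheet ::
    "'e topology \<Rightarrow> 'b topology \<Rightarrow> ('e \<Rightarrow> 'b) \<Rightarrow> 'b set \<Rightarrow> 'e set \<Rightarrow> ('b \<Rightarrow> 'e) \<Rightarrow> bool" where
  "covering_sheet E B p U V \<sigma> \<longleftrightarrow> openin E V \<and> continuous_map (subtopology B U) E \<sigma> \<and>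
     (\<forall>u\<in>U. \<sigma> u \<in> V \<and> p (\<sigma> u) = u) \<and> (\<forall>v\<in>V. p v \<in> U \<and> \<sigma> (p v) = v)"

lemma covering_sheetD:
  assumes "covering_sheet E B p U V \<sigma>"
  shows "openin E V" "continuous_map (subtopology B U) E \<sigma>"
    and "\<And>u. u \<in> U \<Longrightarrow> \<sigma> u \<in> V" "\<And>u. u \<in> U \<Longrightarrow> p (\<sigma> u) = u"
    and "\<And>v. v \<in> V \<Longrightarrow> p v \<in> U" "\<And>v. v \<in> V \<Longrightarrow> \<sigma> (p v) = v"
  using assms by (simp_all add: covering_sheet_def)

text \<open>Distinct sheets over \<open>U\<close> are disjoint open sets. This separation of points in one fibre is what makes
  the set where two lifts differ open.\<close>

lemma covering_separated_sheets:
  assumes cov: "covering_map E B p" and b: "b \<in> topspace B"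
  obtains U where "openin B U" "b \<in> U"
    "\<And>e. e \<in> topspace E \<Longrightarrow> p e \<in> U \<Longrightarrow> \<exists>V \<sigma>. e \<in> V \<and> covering_sheet E B p U V \<sigma> \<and>
        (\<forall>e'\<in>topspace E. p e' \<in> U \<longrightarrow> e' \<notin> V \<longrightarrow> (\<exists>V'. openin E V' \<and> e' \<in> V' \<and> disjnt V V'))"
proof -
  obtain U \<V> where U: "openin B U" "b \<in> U" and \<V>: "\<Union>\<V> = {e \<in> topspace E. p e \<in> U}"
      "\<forall>V\<in>\<V>. openin E V" "pairwise disjnt \<V>"
      "\<forall>V\<in>\<V>. homeomorphic_map (subtopology E V) (subtopology B U) p"
    using cov b unfolding covering_map_def by meson
  have Utop: "topspace (subtopology B U) = U"
    using openin_subset[OF U(1)] by (rule topspace_subtopology_subset)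
  show ?thesis
  proof (rule that[OF U])
    fix e assume e: "e \<in> topspace E" "p e \<in> U"
    then obtain V where V: "V \<in> \<V>" "e \<in> V" using \<V>(1) by blast
    have "openin E V" using \<V>(2) V(1) by blast
    then have Vtop: "topspace (subtopology E V) = V"
      by (intro topspace_subtopology_subset openin_subset)
    obtain \<sigma> where \<sigma>: "homeomorphic_maps (subtopology E V) (subtopology B U) p \<sigma>"
      using \<V>(4) V(1) homeomorphic_map_maps by blast
    then have c: "continuous_map (subtopology B U) (subtopology E V) \<sigma>"
      and inv: "\<forall>v\<in>V. \<sigma> (p v) = v" "\<forall>u\<in>U. p (\<sigma> u) = u"
      using Utop Vtop by (auto simp: homeomorphic_maps_def)
    have "\<forall>u\<in>U. \<sigma> u \<in> V"
      using continuous_map_image_subset_topspace[OF c] Utop Vtop by blast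
    moreover have "continuous_map (subtopology B U) E \<sigma>"
      using c continuous_map_in_subtopology by blast
    moreover have "\<exists>V'. openin E V' \<and> e' \<in> V' \<and> disjnt V V'" if "e' \<in> topspace E" "p e' \<in> U" "e' \<notin> V" for e'
    proof -
      have "e' \<in> \<Union>\<V>" using that(1,2) \<V>(1) by simp
      then obtain V' where V': "V' \<in> \<V>" "e' \<in> V'" by blast
      then have "disjnt V V'" using pairwiseD[OF \<V>(3) V(1) V'(1)] that(3) by blast
      then show ?thesis using V' \<V>(2) by blast
    qed
    moreover have "\<forall>v\<in>V. p v \<in> U" using \<V>(1) V(1) by blast
    ultimately show "\<exists>V \<sigma>. e \<in> V \<and> covering_sheet E B p U V \<sigma> \<and>
        (\<forall>e'\<in>topspace E. p e' \<in> U \<longrightarrow> e' \<notin> V \<longrightarrow> (\<exists>V'. openin E V' \<and> e' \<in> V' \<and> disjnt V V'))"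
      using V \<V>(2) inv unfolding covering_sheet_def by (intro exI[of _ V] exI[of _ \<sigma>]) auto
  qed
qed

lemma covering_sheets:
  assumes "covering_map E B p" "b \<in> topspace B"
  obtains U where "openin B U" "b \<in> U"
    "\<And>e. e \<in> topspace E \<Longrightarrow> p e \<in> U \<Longrightarrow> \<exists>V \<sigma>. e \<in> V \<and> covering_sheet E B p U V \<sigma>"
proof -
  from covering_separated_sheets[OF assms] obtain U where U: "openin B U" "b \<in> U" and
    sheet: "\<And>e. e \<in> topspace E \<Longrightarrow> p e \<in> U \<Longrightarrow> \<exists>V \<sigma>. e \<in> V \<and> covering_sheet E B p U V \<sigma> \<and>
        (\<forall>e'\<in>topspace E. p e' \<in> U \<longrightarrow> e' \<notin> V \<longrightarrow> (\<exists>V'. openin E V' \<and> e' \<in> V' \<and> disjnt V V'))"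
    by blast
  have "\<exists>V \<sigma>. e \<in> V \<and> covering_sheet E B p U V \<sigma>" if "e \<in> topspace E" "p e \<in> U" for e
    using sheet[OF that] by blast
  then show ?thesis by (rule that[OF U])
qed

lemma covering_continuous: "covering_map E B p \<Longrightarrow> continuous_map E B p"
  by (simp add: covering_map_def)

text \<open>Agreement of two lifts is locally constant: near a point they lie in the same sheet, where \<open>p\<close> is
  injective, or in disjoint ones.\<close>

lemma covering_unique_lift:
  assumes cov: "covering_map E B p" and Z: "connected_space Z"
    and g: "continuous_map Z E g" "continuous_map Z E g'"
    and eq: "\<And>z. z \<in> topspace Z \<Longrightarrow> p (g z) = p (g' z)"
    and z0: "z0 \<in> topspace Z" "g z0 = g' z0" and z: "z \<in> topspace Z"
  shows "g z = g' z"
proof -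
  let ?A = "{z \<in> topspace Z. g z = g' z}"
  have gE: "g z \<in> topspace E" "g' z \<in> topspace E" if "z \<in> topspace Z" for z
    using continuous_map_image_subset_topspace[OF g(1)] continuous_map_image_subset_topspace[OF g(2)] that by auto
  have loc: "\<exists>N. openin Z N \<and> w \<in> N \<and> (\<forall>x\<in>N. g x = g' x \<longleftrightarrow> g w = g' w)" if w: "w \<in> topspace Z" for w
  proof -
    have "p (g w) \<in> topspace B"
      using continuous_map_image_subset_topspace[OF covering_continuous[OF cov]] gE[OF w] by blast
    from covering_separated_sheets[OF cov this] obtain U where U: "openin B U" "p (g w) \<in> U" and
      sheet: "\<And>e. e \<in> topspace E \<Longrightarrow> p e \<in> U \<Longrightarrow> \<exists>V \<sigma>. e \<in> V \<and> covering_sheet E B p U V \<sigma> \<and>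
        (\<forall>e'\<in>topspace E. p e' \<in> U \<longrightarrow> e' \<notin> V \<longrightarrow> (\<exists>V'. openin E V' \<and> e' \<in> V' \<and> disjnt V V'))"
      by blast
    obtain V \<sigma> where gV: "g w \<in> V" and sh: "covering_sheet E B p U V \<sigma>"
      and V': "\<forall>e'\<in>topspace E. p e' \<in> U \<longrightarrow> e' \<notin> V \<longrightarrow> (\<exists>V'. openin E V' \<and> e' \<in> V' \<and> disjnt V V')"
      using sheet[OF gE(1)[OF w] U(2)] by blast
    note V = covering_sheetD(1)[OF sh] gV covering_sheetD(6)[OF sh]
    have pre: "openin Z {x \<in> topspace Z. g x \<in> V}"
      by (rule openin_continuous_map_preimage[OF g(1) V(1)])
    show ?thesis
    proof (cases "g' w \<in> V")
      case True
      have "g w = g' w" using V True eq[OF w] by metis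
      moreover have "openin Z {x \<in> topspace Z. g' x \<in> V}"
        by (rule openin_continuous_map_preimage[OF g(2) V(1)])
      moreover have "g x = g' x" if "x \<in> topspace Z" "g x \<in> V" "g' x \<in> V" for x
        using V(3) that eq by metis
      ultimately show ?thesis
        using w V True pre by (intro exI[of _ "{x \<in> topspace Z. g x \<in> V} \<inter> {x \<in> topspace Z. g' x \<in> V}"]) auto
    next
      case False
      obtain V2 where V2: "openin E V2" "g' w \<in> V2" "disjnt V V2"
        using V'[rule_format, OF gE(2)[OF w] _ False] U eq[OF w] by auto
      have "openin Z {x \<in> topspace Z. g' x \<in> V2}"
        by (rule openin_continuous_map_preimage[OF g(2) V2(1)])
      then show ?thesis
        using w V V2 False pre
        by (intro exI[of _ "{x \<in> topspace Z. g x \<in> V} \<inter> {x \<in> topspace Z. g' x \<in> V2}"]) (auto simp: disjnt_iff)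
    qed
  qed
  have "\<exists>N. openin Z N \<and> w \<in> N \<and> N \<subseteq> ?A" if w: "w \<in> ?A" for w
  proof -
    obtain N where "openin Z N" "w \<in> N" "\<forall>x\<in>N. g x = g' x \<longleftrightarrow> g w = g' w"
      using loc[of w] w by blast
    with w show ?thesis using openin_subset by (intro exI[of _ N]) blast
  qed
  then have "openin Z ?A" by (subst openin_subopen) blast
  moreover have "\<exists>N. openin Z N \<and> w \<in> N \<and> N \<subseteq> topspace Z - ?A" if w: "w \<in> topspace Z - ?A" for w
  proof -
    obtain N where "openin Z N" "w \<in> N" "\<forall>x\<in>N. g x = g' x \<longleftrightarrow> g w = g' w"
      using loc[of w] w by blast
    with w show ?thesis using openin_subset by (intro exI[of _ N]) blast
  qed
  then have "openin Z (topspace Z - ?A)" by (subst openin_subopen) blast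
  ultimately have "closedin Z ?A" "openin Z ?A" by (auto simp: closedin_def)
  then have "?A = topspace Z"
    using Z z0 unfolding connected_space_clopen_in by blast
  then show ?thesis using z by blast
qed

lemma covering_unique_path_lift:
  assumes "covering_map E B p" "pathin E \<xi>" "pathin E \<eta>" "\<xi> 0 = \<eta> 0"
    and "\<And>s. s \<in> {0..1} \<Longrightarrow> p (\<xi> s) = p (\<eta> s)" and "s \<in> {0..1}"
  shows "\<xi> s = \<eta> s"
  using covering_unique_lift[OF assms(1) connected_unit_interval, of \<xi> \<eta> 0 s] assms
  by (simp add: pathin_def)

text \<open>The lift is constructed on \<open>N \<times> [0, t]\<close> for a neighbourhood \<open>N\<close> of \<open>z\<close> that may shrink as \<open>t\<close> grows. Every
  time \<open>a\<close> has a neighbourhood \<open>J\<close> such that \<open>H\<close> maps \<open>{z} \<times> J\<close> and its surroundings into one evenly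
  covered set; a lift up to one time in \<open>J\<close> then continues inside a sheet to every later time in \<open>J\<close>.
  Connectedness of the interval replaces the choice of a subdivision.\<close>

lemma covering_lift_homotopy_local:
  assumes cov: "covering_map E B p"
    and H: "continuous_map (prod_topology Z unit_interval) B H"
    and g: "continuous_map Z E g" "\<And>z. z \<in> topspace Z \<Longrightarrow> p (g z) = H (z, 0)"
    and z: "z \<in> topspace Z"
  shows "\<exists>N K. openin Z N \<and> z \<in> N \<and> continuous_map (prod_topology (subtopology Z N) unit_interval) E K \<and>
      (\<forall>x\<in>N. K (x, 0) = g x) \<and> (\<forall>x\<in>N. \<forall>s\<in>{0..1}. p (K (x, s)) = H (x, s))"
proof -
  define P where "P = (\<lambda>t::real. \<exists>N K. openin Z N \<and> z \<in> N \<and>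
      continuous_map (prod_topology (subtopology Z N) (top_of_set {0..t})) E K \<and>
      (\<forall>x\<in>N. K (x, 0) = g x) \<and> (\<forall>x\<in>N. \<forall>s\<in>{0..t}. p (K (x, s)) = H (x, s)))"
  \<comment> \<open>\<open>P\<close> is locally constant on \<open>[0, 1]\<close> and holds at \<open>0\<close>.\<close>
  have "P 1"
  proof (rule connected_induction_simple[where S = "{0..1::real}" and a = 0 and P = P])
    show "P 0"
      unfolding P_def
    proof (intro exI[of _ "topspace Z"] exI[of _ "\<lambda>(x, s). g x"] conjI)
      show "continuous_map (prod_topology (subtopology Z (topspace Z)) (top_of_set {0..0})) E (\<lambda>(x, s). g x)"
        using continuous_map_compose[OF continuous_map_fst g(1)] by (simp add: case_prod_unfold o_def)
    qed (use g z in auto)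
    fix a :: real assume a: "a \<in> {0..1}"
    have "H (z, a) \<in> topspace B"
      using continuous_map_image_subset_topspace[OF H] z a by auto
    from covering_sheets[OF cov this] obtain U where U: "openin B U" "H (z, a) \<in> U" and
      sheet: "\<And>e. e \<in> topspace E \<Longrightarrow> p e \<in> U \<Longrightarrow> \<exists>V \<sigma>. e \<in> V \<and> covering_sheet E B p U V \<sigma>"
      by blast
    define W where "W = {w \<in> topspace (prod_topology Z unit_interval). H w \<in> U}"
    have "openin (prod_topology Z unit_interval) W"
      unfolding W_def by (rule openin_continuous_map_preimage[OF H U(1)])
    moreover have "(z, a) \<in> W" using z a U(2) by (simp add: W_def)
    ultimately obtain N0 J0 where N0: "openin Z N0" "openin unit_interval J0" "z \<in> N0" "a \<in> J0"
        "N0 \<times> J0 \<subseteq> W"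
      using openin_prod_topology_alt[THEN iffD1, rule_format, of Z unit_interval W z a] by blast
    obtain O' where O': "open O'" "J0 = {0..1} \<inter> O'" using N0(2) by (auto simp: openin_open)
    then obtain \<epsilon> where \<epsilon>: "\<epsilon> > 0" "ball a \<epsilon> \<subseteq> O'"
      using N0(4) by (meson IntD2 open_contains_ball)
    define J where "J = {0..1} \<inter> ball a \<epsilon>"
    have JJ0: "J \<subseteq> J0" using \<epsilon> O' by (auto simp: J_def)
    have HJ: "H (x, s) \<in> U" if "x \<in> N0" "s \<in> J" for x s
    proof -
      have "(x, s) \<in> W" using that N0(5) JJ0 by blast
      then show ?thesis by (simp add: W_def)
    qed
    have convJ: "{t..t'} \<subseteq> J" if "t \<in> J" "t' \<in> J" for t t'
      using that by (auto simp: J_def dist_real_def)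
    have "P t'" if t: "t \<in> J" "t' \<in> J" "P t" for t t'
    proof (cases "t' \<le> t")
      case True
      obtain N K where N: "openin Z N" "z \<in> N"
        and K: "continuous_map (prod_topology (subtopology Z N) (top_of_set {0..t})) E K"
        "\<forall>x\<in>N. K (x, 0) = g x" "\<forall>x\<in>N. \<forall>s\<in>{0..t}. p (K (x, s)) = H (x, s)"
        using \<open>P t\<close> unfolding P_def by blast
      have "top_of_set {0..t'} = subtopology (top_of_set {0..t}) {0..t'}"
        using True by (simp add: subtopology_subtopology inf.absorb2)
      then have "prod_topology (subtopology Z N) (top_of_set {0..t'})
          = subtopology (prod_topology (subtopology Z N) (top_of_set {0..t})) (topspace (subtopology Z N) \<times> {0..t'})"
        by (metis prod_topology_subtopology(2))
      then have "continuous_map (prod_topology (subtopology Z N) (top_of_set {0..t'})) E K"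
        using continuous_map_from_subtopology[OF K(1)] by metis
      with N K(2,3) True show ?thesis
        unfolding P_def by (intro exI[of _ N] exI[of _ K]) auto
    next
      case False
      then have tt': "t \<le> t'" by simp
      have t01: "0 \<le> t" "t' \<le> 1" using t by (auto simp: J_def)
      obtain N K where N: "openin Z N" "z \<in> N"
        and K: "continuous_map (prod_topology (subtopology Z N) (top_of_set {0..t})) E K"
        "\<forall>x\<in>N. K (x, 0) = g x" "\<forall>x\<in>N. \<forall>s\<in>{0..t}. p (K (x, s)) = H (x, s)"
        using \<open>P t\<close> unfolding P_def by blast
      have NZ: "topspace (subtopology Z N) = N"
        using openin_subset[OF N(1)] by (rule topspace_subtopology_subset)
      have K_in: "K (x, s) \<in> topspace E" if "x \<in> N" "s \<in> {0..t}" for x s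
        using continuous_map_image_subset_topspace[OF K(1)] that NZ by auto
      have pK: "p (K (z, t)) \<in> U"
        using K(3) N(2) t01 HJ[OF N0(3) t(1)] by simp
      obtain V \<sigma> where KV: "K (z, t) \<in> V" and sh: "covering_sheet E B p U V \<sigma>"
        using sheet[OF K_in[OF N(2)] pK] t01 by auto
      note V = covering_sheetD[OF sh]
      have "continuous_map (subtopology Z N) E (K \<circ> (\<lambda>x. (x, t)))"
        by (rule continuous_map_compose[OF _ K(1)]) (use t01 in \<open>simp add: continuous_map_pairwise o_def\<close>)
      from openin_continuous_map_preimage[OF this V(1)]
      have "openin Z {x \<in> N. K (x, t) \<in> V}"
        unfolding NZ openin_open_subtopology[OF N(1)] by simp
      \<comment> \<open>The lift at time \<open>t\<close> must start in the sheet in which it is continued.\<close>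
      define N' where "N' = {x \<in> N. K (x, t) \<in> V} \<inter> N0"
      have N': "openin Z N'" "z \<in> N'" "N' \<subseteq> N" "N' \<subseteq> N0" and KV': "\<And>x. x \<in> N' \<Longrightarrow> K (x, t) \<in> V"
        using \<open>openin Z {x \<in> N. K (x, t) \<in> V}\<close> N0 N KV by (auto simp: N'_def)
      have N'Z: "topspace (subtopology Z N') = N'"
        using openin_subset[OF N'(1)] by (rule topspace_subtopology_subset)
      let ?Y = "prod_topology (subtopology Z N') (top_of_set {0..t'})"
      let ?K = "\<lambda>w. if snd w \<le> t then K w else \<sigma> (H w)"
      have HU: "H (x, s) \<in> U" if "x \<in> N'" "s \<in> {t..t'}" for x s
        using convJ[OF t(1,2)] N'(4) that by (intro HJ) blast+
      have YE: "?Y = subtopology (prod_topology Z euclideanreal) (N' \<times> {0..t'})"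
        by (simp only: subtopology_Times)
      have "continuous_map ?Y E ?K"
      proof (rule continuous_map_cases_le)
        show "continuous_map ?Y euclideanreal snd"
          using continuous_map_snd continuous_map_in_subtopology by blast
        have "subtopology ?Y {x \<in> topspace ?Y. snd x \<le> t}
            = subtopology (prod_topology (subtopology Z N) (top_of_set {0..t})) (N' \<times> {0..t})"
          unfolding YE subtopology_Times[symmetric] subtopology_subtopology
          using N' openin_subset[OF N'(1)] tt' by (intro arg_cong[where f = "subtopology _"]) auto
        then show "continuous_map (subtopology ?Y {x \<in> topspace ?Y. snd x \<le> t}) E K"
          using continuous_map_from_subtopology[OF K(1)] by metis
        let ?Y2 = "subtopology ?Y {x \<in> topspace ?Y. t \<le> snd x}"
        have ZI: "prod_topology Z unit_interval = subtopology (prod_topology Z euclideanreal) (topspace Z \<times> {0..1})"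
          unfolding subtopology_Times by simp
        have Y2: "?Y2 = subtopology (prod_topology Z unit_interval) (N' \<times> {t..t'})"
          unfolding YE subtopology_subtopology using openin_subset[OF N'(1)] tt' t01
          unfolding ZI subtopology_subtopology by (intro arg_cong[where f = "subtopology _"]) auto
        have "continuous_map ?Y2 (subtopology B U) H"
          unfolding continuous_map_in_subtopology Y2
          using continuous_map_from_subtopology[OF H] HU by auto
        from continuous_map_compose[OF this V(2)]
        show "continuous_map ?Y2 E (\<lambda>w. \<sigma> (H w))" by (simp add: o_def)
        fix w assume "w \<in> topspace ?Y" "snd w = t"
        then obtain x where w: "w = (x, t)" "x \<in> N'" using N'Z by (cases w) auto
        have "p (K (x, t)) = H (x, t)" using K(3) w N'(3) t01 by auto
        then show "K w = \<sigma> (H w)" using V(6)[OF KV'[OF w(2)]] w by simp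
      qed simp
      moreover have "\<forall>x\<in>N'. ?K (x, 0) = g x" using K(2) N'(3) t01 by auto
      moreover have "p (?K (x, s)) = H (x, s)" if "x \<in> N'" "s \<in> {0..t'}" for x s
        using K(3) N'(3) that V(4)[OF HU[OF that(1), of s]] by auto
      ultimately show ?thesis
        unfolding P_def using N'(1,2) by (intro exI[of _ N'] exI[of _ ?K]) simp
    qed
    moreover have "openin unit_interval J" "a \<in> J"
      using a \<epsilon> by (auto simp: J_def openin_open)
    ultimately show "\<exists>T. openin unit_interval T \<and> a \<in> T \<and> (\<forall>x\<in>T. \<forall>y\<in>T. P x \<longrightarrow> P y)"
      by (intro exI[of _ J]) blast
  qed auto
  then show ?thesis unfolding P_def .
qed

text \<open>Local lifts agree on \<open>{x} \<times> [0, 1]\<close> by uniqueness of path lifting, hence they can be glued.\<close>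

theorem covering_lift_homotopy:
  assumes cov: "covering_map E B p"
    and H: "continuous_map (prod_topology Z unit_interval) B H"
    and g: "continuous_map Z E g" "\<And>z. z \<in> topspace Z \<Longrightarrow> p (g z) = H (z, 0)"
  obtains K where "continuous_map (prod_topology Z unit_interval) E K"
    "\<And>z. z \<in> topspace Z \<Longrightarrow> K (z, 0) = g z"
    "\<And>z s. z \<in> topspace Z \<Longrightarrow> s \<in> {0..1} \<Longrightarrow> p (K (z, s)) = H (z, s)"
proof -
  have "\<forall>z\<in>topspace Z. \<exists>N K. openin Z N \<and> z \<in> N \<and>
      continuous_map (prod_topology (subtopology Z N) unit_interval) E K \<and>
      (\<forall>x\<in>N. K (x, 0) = g x) \<and> (\<forall>x\<in>N. \<forall>s\<in>{0..1}. p (K (x, s)) = H (x, s))"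
    using covering_lift_homotopy_local[OF cov H g] by blast
  then obtain N K where NK: "\<forall>z\<in>topspace Z. openin Z (N z) \<and> z \<in> N z \<and>
      continuous_map (prod_topology (subtopology Z (N z)) unit_interval) E (K z) \<and>
      (\<forall>x\<in>N z. K z (x, 0) = g x) \<and> (\<forall>x\<in>N z. \<forall>s\<in>{0..1}. p (K z (x, s)) = H (x, s))"
    unfolding bchoice_iff by blast
  then have N: "\<And>z. z \<in> topspace Z \<Longrightarrow> openin Z (N z)" "\<And>z. z \<in> topspace Z \<Longrightarrow> z \<in> N z"
    and K: "\<And>z. z \<in> topspace Z \<Longrightarrow> continuous_map (prod_topology (subtopology Z (N z)) unit_interval) E (K z)"
      "\<And>z x. z \<in> topspace Z \<Longrightarrow> x \<in> N z \<Longrightarrow> K z (x, 0) = g x"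
      "\<And>z x s. z \<in> topspace Z \<Longrightarrow> x \<in> N z \<Longrightarrow> s \<in> {0..1} \<Longrightarrow> p (K z (x, s)) = H (x, s)"
    by simp_all
  have NZ: "N z \<subseteq> topspace Z" if "z \<in> topspace Z" for z using openin_subset[OF N(1)[OF that]] .
  have agree: "K z (x, s) = K z' (x, s)"
    if "z \<in> topspace Z" "z' \<in> topspace Z" "x \<in> N z" "x \<in> N z'" "s \<in> {0..1}" for z z' x s
  proof -
    have path: "pathin E (\<lambda>s. K w (x, s))" if "w \<in> topspace Z" "x \<in> N w" for w
    proof -
      have "continuous_map unit_interval E (K w \<circ> (\<lambda>s. (x, s)))"
        by (rule continuous_map_compose[OF _ K(1)])
           (use that NZ[OF that(1)] in \<open>auto simp: continuous_map_pairwise o_def\<close>)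
      then show ?thesis by (simp add: pathin_def o_def)
    qed
    show ?thesis
      by (rule covering_unique_path_lift[OF cov path path]) (use that K(2,3) in auto)
  qed
  let ?L = "\<lambda>(x, s). K x (x, s)"
  have "continuous_map (prod_topology Z unit_interval) E ?L"
  proof (rule pasting_lemma[where I = "topspace Z" and T = "\<lambda>z. N z \<times> {0..1}" and f = K])
    fix z assume z: "z \<in> topspace Z"
    show "openin (prod_topology Z unit_interval) (N z \<times> {0..1})"
      using N(1)[OF z] openin_topspace[of unit_interval] by (simp add: openin_prod_Times_iff)
    have "subtopology (prod_topology Z unit_interval) (N z \<times> {0..1}) = prod_topology (subtopology Z (N z)) unit_interval"
      using prod_topology_subtopology(1)[of Z "N z" unit_interval] by simp
    then show "continuous_map (subtopology (prod_topology Z unit_interval) (N z \<times> {0..1})) E (K z)"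
      using K(1)[OF z] by simp
  next
    fix i j x assume "i \<in> topspace Z" "j \<in> topspace Z" "x \<in> topspace (prod_topology Z unit_interval) \<inter> N i \<times> {0..1} \<inter> N j \<times> {0..1}"
    then show "K i x = K j x" using agree[of i j "fst x" "snd x"] by (cases x) auto
  next
    fix x assume "x \<in> topspace (prod_topology Z unit_interval)"
    then show "\<exists>j. j \<in> topspace Z \<and> x \<in> N j \<times> {0..1} \<and> ?L x = K j x"
      using N(2) by (cases x) auto
  qed
  moreover have "?L (z, 0) = g z" if "z \<in> topspace Z" for z using K(2) N(2) that by simp
  moreover have "p (?L (z, s)) = H (z, s)" if "z \<in> topspace Z" "s \<in> {0..1}" for z s
    using K(3) N(2) that by simp
  ultimately show ?thesis by (rule that)
qed

text \<open>A path is a homotopy of maps from a point.\<close>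

lemma covering_lift_path:
  assumes cov: "covering_map E B p" and \<alpha>: "pathin B \<alpha>" and e: "e \<in> topspace E" "p e = \<alpha> 0"
  obtains l where "pathin E l" "l 0 = e" "\<And>s. s \<in> {0..1} \<Longrightarrow> p (l s) = \<alpha> s"
proof -
  let ?Z = "discrete_topology {()}"
  have "continuous_map (prod_topology ?Z unit_interval) B (\<alpha> \<circ> snd)"
    by (rule continuous_map_compose[OF continuous_map_snd \<alpha>[unfolded pathin_def]])
  moreover have "continuous_map ?Z E (\<lambda>_. e)" using e by simp
  ultimately obtain K where K: "continuous_map (prod_topology ?Z unit_interval) E K" "K ((), 0) = e"
      "\<And>s. s \<in> {0..1} \<Longrightarrow> p (K ((), s)) = \<alpha> s"
    using covering_lift_homotopy[OF cov, of ?Z "\<alpha> \<circ> snd" "\<lambda>_. e"] e by auto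
  have "continuous_map unit_interval E (K \<circ> (\<lambda>s. ((), s)))"
    by (rule continuous_map_compose[OF _ K(1)]) (simp add: continuous_map_pairwise o_def)
  then show ?thesis
    using K by (intro that[of "\<lambda>s. K ((), s)"]) (simp_all add: pathin_def o_def)
qed

text \<open>The homotopy lifts with constant start, and its end points form a lift of a constant path.\<close>

lemma covering_homotopic_lifts_end:
  assumes cov: "covering_map E B p" and hom: "path_homotopic B \<alpha> \<beta>"
    and \<xi>: "pathin E \<xi>" "\<And>s. s \<in> {0..1} \<Longrightarrow> p (\<xi> s) = \<alpha> s"
    and \<eta>: "pathin E \<eta>" "\<And>s. s \<in> {0..1} \<Longrightarrow> p (\<eta> s) = \<beta> s" and start: "\<xi> 0 = \<eta> 0"
  shows "\<xi> 1 = \<eta> 1"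
proof -
  obtain H where H: "continuous_map (prod_topology unit_interval unit_interval) B H"
    "\<forall>t\<in>{0..1}. H (0, t) = \<alpha> t" "\<forall>t\<in>{0..1}. H (1, t) = \<beta> t"
    "\<forall>s\<in>{0..1}. H (s, 0) = \<alpha> 0 \<and> H (s, 1) = \<alpha> 1"
    using hom unfolding path_homotopic_iff by blast
  have e: "\<xi> 0 \<in> topspace E" by (rule path_start_in_topspace[OF \<xi>(1)])
  obtain K where K: "continuous_map (prod_topology unit_interval unit_interval) E K"
      "\<And>s. s \<in> {0..1} \<Longrightarrow> K (s, 0) = \<xi> 0"
      "\<And>s t. s \<in> {0..1} \<Longrightarrow> t \<in> {0..1} \<Longrightarrow> p (K (s, t)) = H (s, t)"
    using covering_lift_homotopy[OF cov H(1), of "\<lambda>_. \<xi> 0"] e \<xi>(2)[of 0] H(4) by auto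
  have row: "pathin E (\<lambda>t. K (s, t))" and col: "pathin E (\<lambda>t. K (t, s))" if "s \<in> {0..1}" for s
  proof -
    have "continuous_map unit_interval (prod_topology unit_interval unit_interval) (\<lambda>t. (s, t))"
      and "continuous_map unit_interval (prod_topology unit_interval unit_interval) (\<lambda>t. (t, s))"
      using that by (auto simp: continuous_map_pairwise o_def simp del: prod_topology_subtopology_eu)
    then show "pathin E (\<lambda>t. K (s, t))" "pathin E (\<lambda>t. K (t, s))"
      using continuous_map_compose[OF _ K(1)] by (auto simp: pathin_def o_def simp del: prod_topology_subtopology_eu)
  qed
  have "K (0, 1) = \<xi> 1"
    by (rule covering_unique_path_lift[OF cov row \<xi>(1)]) (use K H \<xi> in auto)
  moreover have "K (1, 1) = \<eta> 1"
    by (rule covering_unique_path_lift[OF cov row \<eta>(1)]) (use K H \<eta> start in auto)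
  moreover have "K (1, 1) = K (0, 1)"
    by (rule covering_unique_path_lift[OF cov col, of 1 "\<lambda>_. K (0, 1)" 1])
       (use K H path_finish_in_topspace[OF row] in auto)
  ultimately show ?thesis by simp
qed

text \<open>The value of the lift at \<open>z\<close> is the end point of the lift of \<open>f \<circ> \<alpha>\<close> for any path \<open>\<alpha>\<close> from \<open>z\<^sub>0\<close> to \<open>z\<close>;
  the hypothesis on loops makes this independent of \<open>\<alpha>\<close>. On a path-connected neighbourhood that \<open>f\<close> maps
  into an evenly covered set, extending \<open>\<alpha>\<close> inside the neighbourhood keeps the end point in one sheet, so
  the lift is the inverse of that sheet composed with \<open>f\<close>. The condition on loops speaks of lifts instead
  of fundamental groups so that it can be checked by exhibiting a homotopy.\<close>

theorem covering_lifting_criterion: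
  assumes cov: "covering_map E B p" and Z: "path_connected_space Z" "locally_path_connected_space Z"
    and f: "continuous_map Z B f" and z0: "z0 \<in> topspace Z" and e0: "e0 \<in> topspace E" "p e0 = f z0"
    and loops: "\<And>\<omega> l. pathin Z \<omega> \<Longrightarrow> \<omega> 0 = z0 \<Longrightarrow> \<omega> 1 = z0 \<Longrightarrow> pathin E l \<Longrightarrow> l 0 = e0 \<Longrightarrow>
        (\<forall>s\<in>{0..1}. p (l s) = f (\<omega> s)) \<Longrightarrow> l 1 = e0"
  obtains g where "continuous_map Z E g" "\<And>z. z \<in> topspace Z \<Longrightarrow> p (g z) = f z"
proof -
  define R where "R = (\<lambda>z e. \<exists>\<alpha> l. pathin Z \<alpha> \<and> \<alpha> 0 = z0 \<and> \<alpha> 1 = z \<and> pathin E l \<and> l 0 = e0 \<and> l 1 = e \<and>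
      (\<forall>s\<in>{0..1}. p (l s) = f (\<alpha> s)))"
  have fpath: "pathin B (\<lambda>s. f (\<alpha> s))" if "pathin Z \<alpha>" for \<alpha>
    using pathin_compose[OF that f] by (simp add: o_def)
  have ex: "\<exists>e. R z e" if z: "z \<in> topspace Z" for z
  proof -
    obtain \<alpha> where \<alpha>: "pathin Z \<alpha>" "\<alpha> 0 = z0" "\<alpha> 1 = z"
      using Z(1)[unfolded path_connected_space_def, rule_format, OF z0 z] by blast
    obtain l where "pathin E l" "l 0 = e0" "\<And>s. s \<in> {0..1} \<Longrightarrow> p (l s) = f (\<alpha> s)"
      using covering_lift_path[OF cov fpath[OF \<alpha>(1)] e0(1)] e0(2) \<alpha>(2) by auto
    with \<alpha> show ?thesis unfolding R_def by (intro exI[of _ "l 1"] exI[of _ \<alpha>] exI[of _ l]) simp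
  qed
  have uniq: "e = e'" if "R z e" "R z e'" for z e e'
  proof -
    obtain \<alpha> l where \<alpha>: "pathin Z \<alpha>" "\<alpha> 0 = z0" "\<alpha> 1 = z" "pathin E l" "l 0 = e0" "l 1 = e"
        "\<forall>s\<in>{0..1}. p (l s) = f (\<alpha> s)"
      using \<open>R z e\<close> unfolding R_def by blast
    obtain \<beta> l' where \<beta>: "pathin Z \<beta>" "\<beta> 0 = z0" "\<beta> 1 = z" "pathin E l'" "l' 0 = e0" "l' 1 = e'"
        "\<forall>s\<in>{0..1}. p (l' s) = f (\<beta> s)"
      using \<open>R z e'\<close> unfolding R_def by blast
    have eE: "e \<in> topspace E" using path_finish_in_topspace[OF \<alpha>(4)] \<alpha>(6) by simp
    have pe: "p e = f z" using \<alpha>(3,6,7) by force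
    obtain k where k: "pathin E k" "k 0 = e" "\<And>s. s \<in> {0..1} \<Longrightarrow> p (k s) = f (reverse_path \<beta> s)"
      using covering_lift_path[OF cov fpath[OF pathin_reverse[OF \<beta>(1)]] eE] pe \<beta>(3) by auto
    have "join_paths l k 1 = e0"
    proof (rule loops)
      show "pathin Z (join_paths \<alpha> (reverse_path \<beta>))"
        by (rule pathin_join) (use \<alpha> \<beta> pathin_reverse in auto)
      show "pathin E (join_paths l k)"
        by (rule pathin_join) (use \<alpha> k in auto)
      show "\<forall>s\<in>{0..1}. p (join_paths l k s) = f (join_paths \<alpha> (reverse_path \<beta>) s)"
        using \<alpha>(7) k(3) by (auto simp: join_paths_def)
    qed (use \<alpha> \<beta> in auto)
    then have k1: "k 1 = e0" by simp
    have "reverse_path k 1 = l' 1"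
    proof (rule covering_unique_path_lift[OF cov pathin_reverse[OF k(1)] \<beta>(4)])
      fix s :: real assume "s \<in> {0..1}"
      then show "p (reverse_path k s) = p (l' s)"
        using k(3)[of "1 - s"] \<beta>(7) by (simp add: reverse_path_def)
    qed (use k1 \<beta> in auto)
    then show ?thesis using k(2) \<beta>(6) by simp
  qed
  define g where "g = (\<lambda>z. THE e. R z e)"
  have g_eq: "g z = e" if "R z e" for z e
    unfolding g_def using that by (rule the_equality) (rule uniq[OF _ that])
  have Rg: "R z (g z)" if "z \<in> topspace Z" for z
    using ex[OF that] g_eq by blast
  have gE: "g z \<in> topspace E" and pg: "p (g z) = f z" if z: "z \<in> topspace Z" for z
  proof -
    obtain \<alpha> l where "\<alpha> 1 = z" "pathin E l" "l 1 = g z" "\<forall>s\<in>{0..1}. p (l s) = f (\<alpha> s)"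
      using Rg[OF z] unfolding R_def by blast
    note lift = this
    show "g z \<in> topspace E" using path_finish_in_topspace[OF lift(2)] lift(3) by simp
    show "p (g z) = f z" using lift(4)[rule_format, of 1] lift(1,3) by simp
  qed
  have "continuous_map Z E g"
  proof (rule continuous_map_locally)
    fix z assume z: "z \<in> topspace Z"
    have "f z \<in> topspace B" using continuous_map_image_subset_topspace[OF f] z by auto
    from covering_sheets[OF cov this] obtain U where U: "openin B U" "f z \<in> U" and
      sheet: "\<And>e. e \<in> topspace E \<Longrightarrow> p e \<in> U \<Longrightarrow> \<exists>V \<sigma>. e \<in> V \<and> covering_sheet E B p U V \<sigma>"
      by blast
    obtain V \<sigma> where gV: "g z \<in> V" and sh: "covering_sheet E B p U V \<sigma>"
      using sheet[OF gE[OF z]] pg[OF z] U(2) by auto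
    note V = covering_sheetD[OF sh]
    have "openin Z {x \<in> topspace Z. f x \<in> U}"
      by (rule openin_continuous_map_preimage[OF f U(1)])
    then obtain N where N: "openin Z N" "path_connectedin Z N" "z \<in> N" "N \<subseteq> {x \<in> topspace Z. f x \<in> U}"
      using Z(2) z U(2) unfolding locally_path_connected_space by blast
    have NZ: "topspace (subtopology Z N) = N"
      using openin_subset[OF N(1)] by (rule topspace_subtopology_subset)
    have fN: "continuous_map (subtopology Z N) (subtopology B U) f"
      using N(4) continuous_map_from_subtopology[OF f] by (auto simp: continuous_map_in_subtopology NZ)
    have \<sigma>f: "continuous_map (subtopology Z N) E (\<lambda>x. \<sigma> (f x))"
      using continuous_map_compose[OF fN V(2)] by (simp add: o_def)
    have "g x = \<sigma> (f x)" if x: "x \<in> N" for x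
    proof (rule g_eq)
      obtain \<alpha> l where \<alpha>: "pathin Z \<alpha>" "\<alpha> 0 = z0" "\<alpha> 1 = z" "pathin E l" "l 0 = e0" "l 1 = g z"
          "\<forall>s\<in>{0..1}. p (l s) = f (\<alpha> s)"
        using Rg[OF z] unfolding R_def by blast
      obtain \<delta> where \<delta>: "pathin (subtopology Z N) \<delta>" "\<delta> 0 = z" "\<delta> 1 = x"
        using N(2)[unfolded path_connectedin_def, THEN conjunct2, unfolded path_connected_space_def NZ,
            rule_format, OF N(3) x] by blast
      have \<delta>N: "\<delta> s \<in> N" if "s \<in> {0..1}" for s
        using \<delta>(1) that by (simp add: pathin_subtopology)
      have \<sigma>\<delta>: "pathin E (\<lambda>s. \<sigma> (f (\<delta> s)))"
        using pathin_compose[OF \<delta>(1) \<sigma>f] by (simp add: o_def)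
      have start: "\<sigma> (f z) = g z" using V(6)[OF gV] pg[OF z] by simp
      show "R x (\<sigma> (f x))"
        unfolding R_def
      proof (intro exI[of _ "join_paths \<alpha> \<delta>"] exI[of _ "join_paths l (\<lambda>s. \<sigma> (f (\<delta> s)))"] conjI)
        show "pathin Z (join_paths \<alpha> \<delta>)"
          by (rule pathin_join) (use \<alpha> \<delta> in \<open>auto simp: pathin_subtopology\<close>)
        show "pathin E (join_paths l (\<lambda>s. \<sigma> (f (\<delta> s))))"
          by (rule pathin_join) (use \<alpha> \<delta>(2) start \<sigma>\<delta> in auto)
        have "p (\<sigma> (f (\<delta> s))) = f (\<delta> s)" if "s \<in> {0..1}" for s
          using \<delta>N[OF that] N(4) V(4) by blast
        then show "\<forall>s\<in>{0..1}. p (join_paths l (\<lambda>s. \<sigma> (f (\<delta> s))) s) = f (join_paths \<alpha> \<delta> s)"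
          using \<alpha>(7) by (simp add: join_paths_def)
      qed (use \<alpha> \<delta> in simp_all)
    qed
    then have "continuous_map (subtopology Z N) E g"
      by (intro continuous_map_eq[OF \<sigma>f]) (simp add: NZ)
    with N show "\<exists>N. openin Z N \<and> z \<in> N \<and> continuous_map (subtopology Z N) E g"
      by blast
  qed
  then show ?thesis using pg by (rule that)
qed

text \<open>For spaces that are not connected the lift is built on each path component, all of which are open.\<close>

corollary covering_lift_if_loops_lift_closed:
  assumes cov: "covering_map E B p" and Z: "locally_path_connected_space Z" and f: "continuous_map Z B f"
    and loops: "\<And>\<omega> l. pathin Z \<omega> \<Longrightarrow> \<omega> 0 = \<omega> 1 \<Longrightarrow> pathin E l \<Longrightarrow>
        (\<forall>s\<in>{0..1}. p (l s) = f (\<omega> s)) \<Longrightarrow> l 0 = l 1"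
  obtains g where "continuous_map Z E g" "\<And>z. z \<in> topspace Z \<Longrightarrow> p (g z) = f z"
proof -
  have "\<exists>g. continuous_map (subtopology Z C) E g \<and> (\<forall>z\<in>C. p (g z) = f z)" if C: "C \<in> path_components_of Z" for C
  proof -
    have pC: "path_connected_space (subtopology Z C)" and oC: "openin Z C"
      using path_connectedin_path_components_of[OF C] openin_path_components_of_locally_path_connected_space[OF Z C]
      by (simp_all add: path_connectedin_def)
    have CZ: "topspace (subtopology Z C) = C"
      using openin_subset[OF oC] by (rule topspace_subtopology_subset)
    have lC: "locally_path_connected_space (subtopology Z C)"
      using Z oC by (rule locally_path_connected_space_open_subset)
    have fC: "continuous_map (subtopology Z C) B f" using f by (rule continuous_map_from_subtopology)
    obtain z0 where z0: "z0 \<in> C" using nonempty_path_components_of[OF C] by blast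
    have "f z0 \<in> p ` topspace E"
      using cov continuous_map_image_subset_topspace[OF fC] z0 CZ unfolding covering_map_def by auto
    then obtain e0 where e0: "e0 \<in> topspace E" "p e0 = f z0" by auto
    show ?thesis
    proof (rule covering_lifting_criterion[OF cov pC lC fC _ e0])
      show "z0 \<in> topspace (subtopology Z C)" using z0 CZ by simp
      fix \<omega> l assume "pathin (subtopology Z C) \<omega>" "\<omega> 0 = z0" "\<omega> 1 = z0" "pathin E l" "l 0 = e0"
        "\<forall>s\<in>{0..1}. p (l s) = f (\<omega> s)"
      then show "l 1 = e0" using loops[of \<omega> l] by (simp add: pathin_subtopology)
    qed (use CZ in blast)
  qed
  then obtain g where g: "\<And>C. C \<in> path_components_of Z \<Longrightarrow> continuous_map (subtopology Z C) E (g C)"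
      "\<And>C z. C \<in> path_components_of Z \<Longrightarrow> z \<in> C \<Longrightarrow> p (g C z) = f z"
    by metis
  let ?C = "\<lambda>z. Collect (path_component_of Z z)"
  have C: "?C z \<in> path_components_of Z" "z \<in> ?C z" if "z \<in> topspace Z" for z
    using that by (auto simp: path_components_of_def path_component_of_refl)
  have "continuous_map Z E (\<lambda>z. g (?C z) z)"
  proof (rule continuous_map_locally)
    fix z assume z: "z \<in> topspace Z"
    have "g (?C z) x = g (?C x) x" if "x \<in> ?C z" for x
      using that path_component_of_equiv[of Z z x] by auto
    then have "continuous_map (subtopology Z (?C z)) E (\<lambda>z. g (?C z) z)"
      by (intro continuous_map_eq[OF g(1)[OF C(1)[OF z]]]) auto
    then show "\<exists>N. openin Z N \<and> z \<in> N \<and> continuous_map (subtopology Z N) E (\<lambda>z. g (?C z) z)"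
      using C[OF z] openin_path_components_of_locally_path_connected_space[OF Z] by blast
  qed
  moreover have "p (g (?C z) z) = f z" if "z \<in> topspace Z" for z
    using g(2)[OF C[OF that]] .
  ultimately show ?thesis by (rule that)
qed

lemma covering_locally_path_connected:
  assumes cov: "covering_map E B p" and B: "locally_path_connected_space B"
  shows "locally_path_connected_space E"
  unfolding locally_path_connected_space
proof (intro allI impI)
  fix W e assume We: "openin E W \<and> e \<in> W"
  then have e: "e \<in> topspace E" using openin_subset by blast
  have "p e \<in> topspace B" using continuous_map_image_subset_topspace[OF covering_continuous[OF cov]] e by auto
  from covering_sheets[OF cov this] obtain U where U: "openin B U" "p e \<in> U" and
    sheet: "\<And>e. e \<in> topspace E \<Longrightarrow> p e \<in> U \<Longrightarrow> \<exists>V \<sigma>. e \<in> V \<and> covering_sheet E B p U V \<sigma>"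
    by blast
  obtain V \<sigma> where eV: "e \<in> V" and sh: "covering_sheet E B p U V \<sigma>"
    using sheet[OF e U(2)] by blast
  note V = covering_sheetD[OF sh]
  have UB: "topspace (subtopology B U) = U"
    using openin_subset[OF U(1)] by (rule topspace_subtopology_subset)
  have "openin (subtopology B U) {u \<in> topspace (subtopology B U). \<sigma> u \<in> W}"
    using We by (intro openin_continuous_map_preimage[OF V(2)]) blast
  then have "openin B {u \<in> U. \<sigma> u \<in> W}"
    unfolding UB openin_open_subtopology[OF U(1)] by simp
  moreover have "p e \<in> {u \<in> U. \<sigma> u \<in> W}" using U(2) V(6)[OF eV] We by simp
  ultimately obtain N where N: "openin B N" "path_connectedin B N" "p e \<in> N" "N \<subseteq> {u \<in> U. \<sigma> u \<in> W}"
    using B unfolding locally_path_connected_space by blast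
  have image: "\<sigma> ` N = V \<inter> {v \<in> topspace E. p v \<in> N}"
  proof
    show "\<sigma> ` N \<subseteq> V \<inter> {v \<in> topspace E. p v \<in> N}"
      using V(3,4) N(4) openin_subset[OF V(1)] by (force simp: subset_iff)
    show "V \<inter> {v \<in> topspace E. p v \<in> N} \<subseteq> \<sigma> ` N"
      using V(6) by (auto simp: image_iff) metis
  qed
  have "openin E (\<sigma> ` N)"
    unfolding image using V(1) openin_continuous_map_preimage[OF covering_continuous[OF cov] N(1)] by (rule openin_Int)
  moreover have "path_connectedin E (\<sigma> ` N)"
    using N(2,4) by (intro path_connectedin_continuous_map_image[OF V(2)]) (auto simp: path_connectedin_subtopology)
  moreover have "e \<in> \<sigma> ` N" using N(3) V(6)[OF eV] by (metis image_eqI)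
  moreover have "\<sigma> ` N \<subseteq> W" using N(4) by blast
  ultimately show "\<exists>U. openin E U \<and> path_connectedin E U \<and> e \<in> U \<and> U \<subseteq> W" by blast
qed

lemma simply_connected_loop:
  assumes C: "simply_connected_space C" and \<omega>: "pathin C \<omega>" "\<omega> 0 = \<omega> 1"
  shows "path_homotopic C \<omega> (\<lambda>_. \<omega> 0)"
proof -
  have "\<omega> 0 \<in> topspace C" using \<omega>(1) by (rule path_start_in_topspace)
  then have "pi1 C (\<omega> 0) = {path_class C (\<lambda>_. \<omega> 0)}"
    using C by (simp add: simply_connected_space_def)
  moreover have "path_class C \<omega> \<in> pi1 C (\<omega> 0)"
    using \<omega> by (auto simp: pi1_def)
  ultimately have "path_class C \<omega> = path_class C (\<lambda>_. \<omega> 0)" by simp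
  then show ?thesis using path_class_eq_iff[OF \<omega>(1)] by simp
qed

section \<open>Topological groups and the shear map\<close>

locale topgroup =
  fixes G :: "('g, 'z) monoid_scheme" (structure) and T :: "'g topology"
  assumes topological_group: "topological_group G T"
begin

sublocale group G
  using topological_group by (simp add: topological_group_def)

lemma carrier_eq: "carrier G = topspace T"
  using topological_group by (simp add: topological_group_def)

lemma topspace_closed [simp]:
  "x \<in> topspace T \<Longrightarrow> y \<in> topspace T \<Longrightarrow> x \<otimes> y \<in> topspace T"
  "x \<in> topspace T \<Longrightarrow> inv x \<in> topspace T"
  "\<one> \<in> topspace T"
  using m_closed inv_closed one_closed by (simp_all flip: carrier_eq)

lemma topspace_group_simps [simp]:
  "x \<in> topspace T \<Longrightarrow> x \<otimes> \<one> = x"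
  "x \<in> topspace T \<Longrightarrow> \<one> \<otimes> x = x"
  "x \<in> topspace T \<Longrightarrow> x \<otimes> inv x = \<one>"
  "x \<in> topspace T \<Longrightarrow> inv x \<otimes> x = \<one>"
  "x \<in> topspace T \<Longrightarrow> y \<in> topspace T \<Longrightarrow> (x \<otimes> inv y) \<otimes> y = x"
  "x \<in> topspace T \<Longrightarrow> y \<in> topspace T \<Longrightarrow> (x \<otimes> y) \<otimes> inv y = x"
  by (simp_all add: carrier_eq[symmetric] m_assoc)

lemma continuous_map_mult [continuous_intros]:
  assumes "continuous_map Z T a" "continuous_map Z T b"
  shows "continuous_map Z T (\<lambda>z. a z \<otimes> b z)"
proof -
  have "continuous_map Z (prod_topology T T) (\<lambda>z. (a z, b z))"
    using assms by (simp add: continuous_map_pairwise o_def)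
  moreover have "continuous_map (prod_topology T T) T (\<lambda>(x, y). x \<otimes> y)"
    using topological_group by (simp add: topological_group_def)
  ultimately have "continuous_map Z T ((\<lambda>(x, y). x \<otimes> y) \<circ> (\<lambda>z. (a z, b z)))"
    by (rule continuous_map_compose)
  then show ?thesis by (simp add: o_def)
qed

lemma continuous_map_inv [continuous_intros]:
  assumes "continuous_map Z T a"
  shows "continuous_map Z T (\<lambda>z. inv (a z))"
proof -
  have "continuous_map T T (\<lambda>x. inv x)"
    using topological_group by (simp add: topological_group_def)
  from continuous_map_compose[OF assms this] show ?thesis by (simp add: o_def)
qed

text \<open>The product \<open>z\<^sub>i z\<^sub>i\<^sub>+\<^sub>1 \<dots> z\<^sub>m\<^sub>-\<^sub>1 g\<close>.\<close>

definition shear_coord :: "nat \<Rightarrow> nat \<Rightarrow> 'g \<Rightarrow> (nat \<Rightarrow> 'g) \<Rightarrow> 'g" where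
  "shear_coord m i g z = foldr (\<lambda>j x. z j \<otimes> x) [i..<m] g"

lemma shear_coord_last [simp]: "shear_coord m m g z = g"
  by (simp add: shear_coord_def)

lemma shear_coord_Suc:
  "i < m \<Longrightarrow> shear_coord m i g z = z i \<otimes> shear_coord m (Suc i) g z"
  by (simp add: shear_coord_def upt_conv_Cons)

lemma shear_coord_closed:
  assumes "i \<le> m" "g \<in> topspace T" "\<And>j. i \<le> j \<Longrightarrow> j < m \<Longrightarrow> z j \<in> topspace T"
  shows "shear_coord m i g z \<in> topspace T"
  using assms by (induction i rule: inc_induct) (simp_all add: shear_coord_Suc)

lemma continuous_map_shear_coord:
  assumes "i \<le> m" "continuous_map Z T a" "\<And>j. i \<le> j \<Longrightarrow> j < m \<Longrightarrow> continuous_map Z T (\<lambda>z. b z j)"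
  shows "continuous_map Z T (\<lambda>z. shear_coord m i (a z) (b z))"
  using assms
proof (induction i rule: inc_induct)
  case (step n)
  then show ?case by (simp add: shear_coord_Suc continuous_map_mult)
qed simp

text \<open>The product of the quotients \<open>y\<^sub>j y\<^sub>j\<^sub>+\<^sub>1\<^sup>-\<^sup>1\<close> telescopes.\<close>

lemma shear_coord_quotients:
  assumes "i \<le> m" "\<And>j. i \<le> j \<Longrightarrow> j \<le> m \<Longrightarrow> y j \<in> topspace T"
    and "\<And>j. i \<le> j \<Longrightarrow> j < m \<Longrightarrow> z j = y j \<otimes> inv (y (Suc j))"
  shows "shear_coord m i (y m) z = y i"
  using assms by (induction i rule: inc_induct) (simp_all add: shear_coord_Suc)

lemma shear_coord_skip_ones:
  assumes "k \<le> i" "i \<le> m" "g \<in> topspace T" "\<And>j. k \<le> j \<Longrightarrow> j < m \<Longrightarrow> z j \<in> topspace T"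
    and "\<And>j. k \<le> j \<Longrightarrow> j < i \<Longrightarrow> z j = \<one>"
  shows "shear_coord m k g z = shear_coord m i g z"
  using assms
proof (induction k rule: inc_induct)
  case (step n)
  then show ?case by (simp add: shear_coord_Suc shear_coord_closed)
qed simp

definition shear :: "nat \<Rightarrow> 'g \<Rightarrow> (nat \<Rightarrow> 'g) \<Rightarrow> nat \<Rightarrow> 'g" where
  "shear m g z = (\<lambda>i\<in>{1..m}. shear_coord m i g z)"

lemma continuous_map_shear:
  assumes "continuous_map Z T a" "continuous_map Z (power_space T (m - 1)) b"
  shows "continuous_map Z (power_space T m) (\<lambda>z. shear m (a z) (b z))"
proof -
  have "continuous_map Z T (\<lambda>z. b z j)" if "j \<in> {1..m - 1}" for j
    using continuous_map_compose[OF assms(2) continuous_map_product_projection[OF that]] by (simp add: o_def)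
  then have "continuous_map Z T (\<lambda>z. shear_coord m i (a z) (b z))" if "i \<in> {1..m}" for i
    using that assms(1) by (intro continuous_map_shear_coord) auto
  then show ?thesis
    unfolding shear_def continuous_map_into_power_space by blast
qed

lemma continuous_map_quotients_map:
  "continuous_map (power_space T m) (power_space T (m - 1)) (quotients_map G m)"
proof -
  have "continuous_map (power_space T m) T (\<lambda>x. x i)" if "i \<in> {1..m}" for i
    using that by (rule continuous_map_product_projection)
  then have "\<forall>i\<in>{1..m - 1}. continuous_map (power_space T m) T (\<lambda>x. x i \<otimes> inv (x (i + 1)))"
    by (intro ballI continuous_map_mult continuous_map_inv) auto
  then show ?thesis
    unfolding quotients_map_def[abs_def] continuous_map_into_power_space by blast
qed

text \<open>This identity expresses that \<open>x \<mapsto> (x\<^sub>m, F\<^sub>m x)\<close> identifies \<open>G\<^sup>m\<close> with \<open>G \<times> G\<^sup>m\<^sup>-\<^sup>1\<close>.\<close>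

lemma shear_quotients_map:
  assumes "1 \<le> m" and y: "y \<in> topspace (power_space T m)"
  shows "shear m (y m) (quotients_map G m y) = y"
proof
  fix i show "shear m (y m) (quotients_map G m y) i = y i"
  proof (cases "i \<in> {1..m}")
    case True
    have "y j \<in> topspace T" if "1 \<le> j" "j \<le> m" for j using y that by auto
    then have "shear_coord m i (y m) (quotients_map G m y) = y i"
      using True by (intro shear_coord_quotients) (auto simp: quotients_map_def)
    then show ?thesis using True by (simp add: shear_def)
  next
    case False
    then show ?thesis using y by (auto simp: shear_def PiE_def extensional_def)
  qed
qed

lemma shear_coord_ones:
  assumes "i \<le> m" "g \<in> topspace T" "\<And>j. i \<le> j \<Longrightarrow> j < m \<Longrightarrow> z j = \<one>"
  shows "shear_coord m i g z = g"
  using assms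
proof (induction i rule: inc_induct)
  case (step n)
  have "z n = \<one>" using step.hyps by (intro step.prems) auto
  moreover have "shear_coord m (Suc n) g z = g"
    by (rule step.IH) (use step.prems in \<open>auto dest: Suc_leD\<close>)
  ultimately show ?case
    using shear_coord_Suc[OF \<open>n < m\<close>, of g z] topspace_group_simps(2)[OF assms(2)] by (simp only:)
qed (rule shear_coord_last)

lemma shear_diagonal:
  assumes "g \<in> topspace T"
  shows "shear m g (\<lambda>i\<in>{1..m - 1}. \<one>) = diagonal_point m g"
  unfolding shear_def diagonal_point_def
proof (rule restrict_ext)
  fix i assume i: "i \<in> {1..m}"
  show "shear_coord m i g (\<lambda>i\<in>{1..m - 1}. \<one>) = g"
  proof (rule shear_coord_ones)
    fix j assume "i \<le> j" "j < m"
    with i have "j \<in> {1..m - 1}" by auto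
    then show "(\<lambda>i\<in>{1..m - 1}. \<one>) j = \<one>" by (rule restrict_apply')
  next
    show "i \<le> m" using i by simp
    show "g \<in> topspace T" by (rule assms)
  qed
qed

lemma quotients_map_diagonal:
  assumes "g \<in> topspace T"
  shows "quotients_map G m (diagonal_point m g) = (\<lambda>i\<in>{1..m - 1}. \<one>)"
  unfolding quotients_map_def by (rule restrict_ext) (use assms in \<open>auto simp: diagonal_point_def\<close>)

lemma ones_in_topspace: "(\<lambda>i\<in>{1..n}. \<one>) \<in> topspace (power_space T n)"
  by auto

end

section \<open>Path fibrations\<close>

locale maps_into_group = topgroup G T
  for G :: "('g, 'z) monoid_scheme" (structure) and T :: "'g topology" +
  fixes m :: nat and X :: "'x topology" and f :: "nat \<Rightarrow> 'x \<Rightarrow> 'g"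
  assumes m: "m \<ge> 2" and path_connected: "path_connected_space T"
    and f: "\<And>i. i \<in> {1..m} \<Longrightarrow> continuous_map X T (f i)"
begin

abbreviation F where "F \<equiv> quotients_map G m"
abbreviation h where "h \<equiv> F \<circ> tuple m f"
abbreviation Gm where "Gm \<equiv> power_space T m"
abbreviation Gq where "Gq \<equiv> power_space T (m - 1)"

lemma Suc_index: "i \<in> {1..m - 1} \<Longrightarrow> Suc i \<in> {1..m}"
  using m by auto

lemma f_in: "i \<in> {1..m} \<Longrightarrow> x \<in> topspace X \<Longrightarrow> f i x \<in> topspace T"
  using continuous_map_image_subset_topspace[OF f, of i] by auto

lemma continuous_map_tuple: "continuous_map X Gm (tuple m f)"
  unfolding tuple_def[abs_def] continuous_map_into_power_space by (intro ballI f)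

lemma continuous_map_h: "continuous_map X Gq h"
  using continuous_map_compose[OF continuous_map_tuple continuous_map_quotients_map] .

lemma h_apply: "i \<in> {1..m - 1} \<Longrightarrow> h x i = f i x \<otimes> inv (f (Suc i) x)"
  by (auto simp: quotients_map_def tuple_def)

lemma shear_h: "x \<in> topspace X \<Longrightarrow> shear m (f m x) (h x) = tuple m f x"
proof -
  assume "x \<in> topspace X"
  then have "tuple m f x \<in> topspace Gm"
    using continuous_map_image_subset_topspace[OF continuous_map_tuple] by blast
  moreover have "f m x = tuple m f x m" using m by (simp add: tuple_def)
  ultimately show ?thesis using shear_quotients_map[of m "tuple m f x"] m by simp
qed

lemma path_connected_power: "path_connected_space (power_space T n)"
  by (simp add: path_connected_space_product_topology path_connected)

lemma obtain_path:
  assumes "a \<in> topspace (power_space T n)" "b \<in> topspace (power_space T n)"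
  obtains c where "pathin (power_space T n) c" "c 0 = a" "c 1 = b"
  using path_connected_power[of n, unfolded path_connected_space_def, rule_format, OF assms] that by auto

context
  fixes t :: "nat \<Rightarrow> real" and z0 :: "nat \<Rightarrow> 'g" and c :: "real \<Rightarrow> nat \<Rightarrow> 'g"
  assumes t: "strict_mono_on {1..m} t" and t1: "t 1 = 0" and tm: "t m = 1"
    and z0: "z0 \<in> topspace Gq"
    and c: "pathin Gq c" "c 0 = (\<lambda>i\<in>{1..m - 1}. \<one>)" "c 1 = z0"
begin

abbreviation "P \<equiv> path_pullback X T m t f"
abbreviation "Q \<equiv> based_path_pullback X Gq z0 h"

lemma t_bounds: "i \<in> {1..m} \<Longrightarrow> 0 \<le> t i \<and> t i \<le> 1"
  using strict_mono_on_leD[OF t, of 1 i] strict_mono_on_leD[OF t, of i m] m t1 tm by auto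

text \<open>\<open>t_segment i\<close> maps \<open>[0, 1]\<close> affinely onto \<open>[t\<^sub>i, t\<^sub>i\<^sub>+\<^sub>1]\<close>.\<close>

definition t_segment :: "nat \<Rightarrow> real \<Rightarrow> real" where
  "t_segment i s = (1 - s) * t i + s * t (Suc i)"

lemma t_segment_01:
  assumes "i \<in> {1..m - 1}" "s \<in> {0..1}" shows "t_segment i s \<in> {0..1}"
proof -
  have "convex {0..1::real}" by simp
  then have "(1 - s) *\<^sub>R t i + s *\<^sub>R t (Suc i) \<in> {0..1}"
    using assms t_bounds[of i] t_bounds[of "Suc i"] unfolding convex_alt by auto
  then show ?thesis by (simp add: t_segment_def)
qed

definition to_based :: "'x \<times> (real \<Rightarrow> 'g) \<Rightarrow> 'x \<times> (real \<Rightarrow> nat \<Rightarrow> 'g)" where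
  "to_based = (\<lambda>(x, \<gamma>). (x, \<lambda>s\<in>{0..1}. \<lambda>i\<in>{1..m - 1}.
     (\<gamma> (t_segment i s) \<otimes> inv (\<gamma> (t (Suc i)))) \<otimes> c s i))"

lemma c_cont: "continuous_map unit_interval Gq c"
  using c by (simp add: pathin_def)

text \<open>Coordinate \<open>i\<close> of the new path goes from \<open>f\<^sub>i x (f\<^sub>i\<^sub>+\<^sub>1 x)\<^sup>-\<^sup>1\<close> to \<open>1\<close> by right translation of a segment of
  \<open>\<gamma>\<close>; the factor \<open>c\<close>, a path from \<open>1\<close> to \<open>z\<^sub>0\<close>, moves its end to the base point without changing its
  start.\<close>

lemma fibre_map_to_based: "fibre_map P fst Q fst to_based"
  unfolding fibre_map_def
proof
  let ?I = "unit_interval"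
  let ?Z = "prod_topology P ?I"
  have "continuous_map P (path_space T) snd"
    unfolding path_pullback_def by (rule continuous_map_pullback_snd)
  from continuous_map_compose[OF continuous_map_fst this]
  have P\<gamma>: "continuous_map ?Z (path_space T) (\<lambda>z. snd (fst z))"
    by (simp add: o_def)
  have s: "continuous_map ?Z ?I (\<lambda>z. snd z)"
    using continuous_map_snd by blast
  have seg: "continuous_map ?Z ?I (\<lambda>z. t_segment i (snd z))" if "i \<in> {1..m - 1}" for i
  proof -
    have "continuous_map ?I ?I (t_segment i)"
      using t_segment_01[OF that] by (auto simp: t_segment_def intro!: continuous_intros)
    from continuous_map_compose[OF s this] show ?thesis by (simp add: o_def)
  qed
  have cc: "continuous_map ?Z T (\<lambda>z. c (snd z) i)" if "i \<in> {1..m - 1}" for i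
    using continuous_map_power_coord[OF continuous_map_compose[OF s c_cont] that] by (simp add: o_def)
  have "continuous_map ?Z Gq (\<lambda>z. \<lambda>i\<in>{1..m - 1}.
       (snd (fst z) (t_segment i (snd z)) \<otimes> inv (snd (fst z) (t (Suc i)))) \<otimes> c (snd z) i)"
    unfolding continuous_map_into_power_space
    using t_bounds by (intro ballI continuous_map_mult continuous_map_inv continuous_map_path_apply[OF P\<gamma>] seg cc)
       auto
  then have paths: "continuous_map P (path_space Gq) (\<lambda>w. \<lambda>s\<in>{0..1}. \<lambda>i\<in>{1..m - 1}.
       (snd w (t_segment i s) \<otimes> inv (snd w (t (Suc i)))) \<otimes> c s i)"
    by (intro continuous_map_path_curry) (simp add: case_prod_unfold)
  have in_Q: "(\<lambda>i\<in>{1..m - 1}. (\<gamma> (t_segment i 1) \<otimes> inv (\<gamma> (t (Suc i)))) \<otimes> c 1 i) = z0"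
    "(\<lambda>i\<in>{1..m - 1}. (\<gamma> (t_segment i 0) \<otimes> inv (\<gamma> (t (Suc i)))) \<otimes> c 0 i) = h x"
    if "(x, \<gamma>) \<in> topspace P" for x \<gamma>
  proof -
    have x: "x \<in> topspace X" and \<gamma>: "pathin T \<gamma>" and eq: "tuple m f x = eval_times m t \<gamma>"
      using that by (auto simp: path_pullback_def topspace_pullback topspace_path_space)
    have \<gamma>t: "\<gamma> (t i) = f i x" if "i \<in> {1..m}" for i
      using fun_cong[OF eq, of i] that by (simp add: tuple_def eval_times_def)
    have z0i: "z0 i \<in> topspace T" if "i \<in> {1..m - 1}" for i using z0 that by auto
    show "(\<lambda>i\<in>{1..m - 1}. (\<gamma> (t_segment i 1) \<otimes> inv (\<gamma> (t (Suc i)))) \<otimes> c 1 i) = z0"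
      using z0 z0i \<gamma>t f_in[OF _ x] c
      by (intro extensionalityI[of _ "{1..m - 1}"]) (auto simp: t_segment_def PiE_def)
    show "(\<lambda>i\<in>{1..m - 1}. (\<gamma> (t_segment i 0) \<otimes> inv (\<gamma> (t (Suc i)))) \<otimes> c 0 i) = h x"
      using \<gamma>t f_in[OF _ x] c
      by (intro extensionalityI[of _ "{1..m - 1}"]) (auto simp: t_segment_def h_apply quotients_map_def tuple_def)
  qed
  show "continuous_map P Q to_based"
    unfolding based_path_pullback_def continuous_map_into_pullback based_path_space_def
      continuous_map_in_subtopology
    using paths in_Q
    by (auto simp: to_based_def case_prod_unfold path_pullback_def continuous_map_pullback_fst Pi_iff)
  show "\<forall>e\<in>topspace P. fst (to_based e) = fst e"
    by (simp add: to_based_def case_prod_unfold)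
qed

text \<open>\<open>t_clamp i\<close> maps \<open>[t\<^sub>i, t\<^sub>i\<^sub>+\<^sub>1]\<close> affinely onto \<open>[0, 1]\<close> and is constant before and after.\<close>

definition t_clamp :: "nat \<Rightarrow> real \<Rightarrow> real" where
  "t_clamp i s = max 0 (min 1 ((s - t i) / (t (Suc i) - t i)))"

definition of_based :: "'x \<times> (real \<Rightarrow> nat \<Rightarrow> 'g) \<Rightarrow> 'x \<times> (real \<Rightarrow> 'g)" where
  "of_based = (\<lambda>(x, \<beta>). (x, \<lambda>s\<in>{0..1}.
     shear_coord m 1 (f m x) (\<lambda>j. \<beta> (t_clamp j s) j \<otimes> inv (c (t_clamp j s) j))))"

lemma t_clamp_01: "t_clamp i s \<in> {0..1}"
  by (auto simp: t_clamp_def)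

lemma t_clamp_t:
  assumes "i \<in> {1..m}" "j \<in> {1..m - 1}"
  shows "j < i \<Longrightarrow> t_clamp j (t i) = 1" "i \<le> j \<Longrightarrow> t_clamp j (t i) = 0"
proof -
  have lt: "t j < t (Suc j)" using strict_mono_onD[OF t] assms by auto
  show "t_clamp j (t i) = 1" if "j < i"
  proof -
    have "t (Suc j) \<le> t i" using strict_mono_on_leD[OF t] assms that by auto
    then show ?thesis using lt by (simp add: t_clamp_def)
  qed
  show "t_clamp j (t i) = 0" if "i \<le> j"
  proof -
    have "t i \<le> t j" using strict_mono_on_leD[OF t] assms that by auto
    then have "(t i - t j) / (t (Suc j) - t j) \<le> 0" using lt by (simp add: divide_nonpos_pos)
    then show ?thesis by (simp add: t_clamp_def)
  qed
qed

text \<open>Dividing \<open>\<beta>\<close> by \<open>c\<close> gives a path from \<open>h x\<close> to \<open>1\<close>. At time \<open>t\<^sub>i\<close> its coordinates \<open>j < i\<close> have already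
  arrived at \<open>1\<close> and the coordinates \<open>j \<ge> i\<close> have not yet left \<open>h x\<close>, so the product is the \<open>i\<close>-th
  coordinate of the shear of \<open>(f\<^sub>m x, h x)\<close>, that is \<open>f\<^sub>i x\<close>.\<close>

lemma fibre_map_of_based: "fibre_map Q fst P fst of_based"
  unfolding fibre_map_def
proof
  let ?I = "unit_interval"
  let ?Z = "prod_topology Q ?I"
  have "continuous_map Q (path_space Gq) snd"
    using continuous_map_pullback_snd[of X h "based_path_space Gq z0"]
    by (simp add: based_path_pullback_def based_path_space_def continuous_map_in_subtopology)
  from continuous_map_compose[OF continuous_map_fst this]
  have Q\<beta>: "continuous_map ?Z (path_space Gq) (\<lambda>z. snd (fst z))"
    by (simp add: o_def)
  have "continuous_map Q X fst"
    unfolding based_path_pullback_def by (rule continuous_map_pullback_fst)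
  from continuous_map_compose[OF continuous_map_fst this]
  have Qx: "continuous_map ?Z X (\<lambda>z. fst (fst z))"
    by (simp add: o_def)
  have s: "continuous_map ?Z ?I (\<lambda>z. snd z)"
    using continuous_map_snd by blast
  have clamp: "continuous_map ?Z ?I (\<lambda>z. t_clamp i (snd z))" if "i \<in> {1..m - 1}" for i
  proof -
    have "t i \<noteq> t (Suc i)" using strict_mono_onD[OF t, of i "Suc i"] that Suc_index[OF that] by auto
    then have "continuous_map ?I ?I (t_clamp i)"
      using t_clamp_01 by (auto simp: t_clamp_def intro!: continuous_intros)
    from continuous_map_compose[OF s this] show ?thesis by (simp add: o_def)
  qed
  have cc: "continuous_map ?Z T (\<lambda>z. c (t_clamp i (snd z)) i)" if "i \<in> {1..m - 1}" for i
    using continuous_map_power_coord[OF continuous_map_compose[OF clamp[OF that] c_cont] that] by (simp add: o_def)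
  have \<beta>c: "continuous_map ?Z T (\<lambda>z. snd (fst z) (t_clamp i (snd z)) i)" if "i \<in> {1..m - 1}" for i
    using continuous_map_power_coord[OF continuous_map_path_apply[OF Q\<beta> clamp[OF that]] that] .
  have fm: "continuous_map ?Z T (\<lambda>z. f m (fst (fst z)))"
    using continuous_map_compose[OF Qx f[of m]] m by (simp add: o_def)
  have "continuous_map ?Z T (\<lambda>z. shear_coord m 1 (f m (fst (fst z)))
      (\<lambda>j. snd (fst z) (t_clamp j (snd z)) j \<otimes> inv (c (t_clamp j (snd z)) j)))"
    using m by (intro continuous_map_shear_coord fm continuous_map_mult continuous_map_inv cc \<beta>c) auto
  then have paths: "continuous_map Q (path_space T) (\<lambda>w. \<lambda>s\<in>{0..1}. shear_coord m 1 (f m (fst w))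
      (\<lambda>j. snd w (t_clamp j s) j \<otimes> inv (c (t_clamp j s) j)))"
    by (intro continuous_map_path_curry) (simp add: case_prod_unfold)
  have in_P: "tuple m f x = eval_times m t (\<lambda>s\<in>{0..1}. shear_coord m 1 (f m x)
      (\<lambda>j. \<beta> (t_clamp j s) j \<otimes> inv (c (t_clamp j s) j)))"
    if w: "(x, \<beta>) \<in> topspace Q" for x \<beta>
  proof -
    have x: "x \<in> topspace X" and \<beta>: "pathin Gq \<beta>" "\<beta> 0 = h x" "\<beta> 1 = z0"
      using w by (auto simp: based_path_pullback_def topspace_pullback based_path_space_def topspace_path_space)
    have \<beta>in: "\<beta> s j \<in> topspace T" "c s j \<in> topspace T" if "s \<in> {0..1}" "j \<in> {1..m - 1}" for s j
      using path_image_subset_topspace[OF \<beta>(1)] path_image_subset_topspace[OF c(1)] that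
      by (auto simp: Pi_iff PiE_iff)
    have "shear_coord m 1 (f m x) (\<lambda>j. \<beta> (t_clamp j (t i)) j \<otimes> inv (c (t_clamp j (t i)) j)) = f i x"
      (is "shear_coord m 1 _ ?z = _") if i: "i \<in> {1..m}" for i
    proof -
      have z0j: "z0 j \<in> topspace T" if "1 \<le> j" "j < m" for j using z0 that by auto
      have zin: "?z j \<in> topspace T" if "1 \<le> j" "j < m" for j
        using \<beta>in[OF t_clamp_01, of j] that by auto
      have "?z j = \<one>" if "1 \<le> j" "j < i" for j
        using that i t_clamp_t(1)[of i j] z0j[of j] by (simp add: \<beta> c)
      then have "shear_coord m 1 (f m x) ?z = shear_coord m i (f m x) ?z"
        using i m zin f_in[OF _ x] by (intro shear_coord_skip_ones) auto
      also have "\<dots> = f i x"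
      proof (rule shear_coord_quotients[where y = "\<lambda>j. f j x"])
        fix j assume j: "i \<le> j" "j < m"
        then have "\<beta> 0 j \<in> topspace T" using \<beta>in[of 0 j] i by auto
        with j i show "?z j = f j x \<otimes> inv (f (Suc j) x)"
          using t_clamp_t(2)[of i j] f_in[OF _ x] by (auto simp: \<beta> c h_apply simp del: o_apply)
      qed (use i f_in[OF _ x] in auto)
      finally show ?thesis .
    qed
    then show ?thesis
      using t_bounds by (auto simp: tuple_def eval_times_def)
  qed
  show "continuous_map Q P of_based"
    unfolding path_pullback_def continuous_map_into_pullback
    using paths in_P
    by (auto simp: of_based_def case_prod_unfold based_path_pullback_def continuous_map_pullback_fst)
  show "\<forall>e\<in>topspace Q. fst (of_based e) = fst e"
    by (simp add: of_based_def case_prod_unfold)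
qed

text \<open>Homotopies from \<open>f\<^sub>i\<close> to \<open>f\<^sub>i\<^sub>+\<^sub>1\<close> are turned into paths ending at the base point as in
  \<open>fibre_map_to_based\<close>, with the homotopies in place of the segments of \<open>\<gamma>\<close>.\<close>

lemma section_if_homotopic:
  assumes U: "openin X U"
    and hom: "\<forall>i\<in>{1..m}. \<forall>j\<in>{1..m}. homotopic_with (\<lambda>_. True) (subtopology X U) T (f i) (f j)"
  shows "\<exists>s. continuous_map (subtopology X U) Q s \<and> (\<forall>x\<in>U. fst (s x) = x)"
proof -
  let ?I = "unit_interval" and ?X = "subtopology X U"
  have U': "topspace ?X = U" using openin_subset[OF U] by (rule topspace_subtopology_subset)
  have "\<exists>H. continuous_map (prod_topology ?I ?X) T H \<and>
      (\<forall>x. H (0, x) = f i x) \<and> (\<forall>x. H (1, x) = f (Suc i) x)" if "i \<in> {1..m - 1}" for i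
  proof -
    have "homotopic_with (\<lambda>_. True) ?X T (f i) (f (Suc i))" using hom that by auto
    then show ?thesis by (auto simp: homotopic_with_def)
  qed
  then obtain H where H: "\<And>i. i \<in> {1..m - 1} \<Longrightarrow> continuous_map (prod_topology ?I ?X) T (H i)"
      "\<And>i x. i \<in> {1..m - 1} \<Longrightarrow> H i (0, x) = f i x" "\<And>i x. i \<in> {1..m - 1} \<Longrightarrow> H i (1, x) = f (Suc i) x"
    by metis
  let ?Z = "prod_topology ?X ?I"
  have "continuous_map ?Z (prod_topology ?I ?X) (\<lambda>(x, s). (s, x))"
    by (simp add: continuous_map_pairwise o_def case_prod_unfold continuous_map_fst continuous_map_snd)
  from continuous_map_compose[OF this H(1)]
  have HZ: "continuous_map ?Z T (\<lambda>z. H i (snd z, fst z))" if "i \<in> {1..m - 1}" for i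
    using that by (simp add: o_def case_prod_unfold)
  have fZ: "continuous_map ?Z T (\<lambda>z. f (Suc i) (fst z))" if "i \<in> {1..m - 1}" for i
    using continuous_map_compose[OF continuous_map_fst continuous_map_from_subtopology[OF f[OF Suc_index[OF that]]]]
    by (simp add: o_def)
  have cZ: "continuous_map ?Z T (\<lambda>z. c (snd z) i)" if "i \<in> {1..m - 1}" for i
    using continuous_map_power_coord[OF continuous_map_compose[OF continuous_map_snd c_cont] that] by (simp add: o_def)
  have "continuous_map ?Z Gq (\<lambda>z. \<lambda>i\<in>{1..m - 1}. (H i (snd z, fst z) \<otimes> inv (f (Suc i) (fst z))) \<otimes> c (snd z) i)"
    unfolding continuous_map_into_power_space
    by (intro ballI continuous_map_mult continuous_map_inv HZ fZ cZ)
  then have paths: "continuous_map ?X (path_space Gq) (\<lambda>x. \<lambda>s\<in>{0..1}. \<lambda>i\<in>{1..m - 1}.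
       (H i (s, x) \<otimes> inv (f (Suc i) x)) \<otimes> c s i)"
    by (intro continuous_map_path_curry) (simp add: case_prod_unfold)
  have in_Q: "(\<lambda>i\<in>{1..m - 1}. (H i (1, x) \<otimes> inv (f (Suc i) x)) \<otimes> c 1 i) = z0"
    "(\<lambda>i\<in>{1..m - 1}. (H i (0, x) \<otimes> inv (f (Suc i) x)) \<otimes> c 0 i) = h x" if "x \<in> U" for x
  proof -
    have x: "x \<in> topspace X" using that openin_subset[OF U] by blast
    have z0i: "z0 i \<in> topspace T" if "i \<in> {1..m - 1}" for i using z0 that by auto
    show "(\<lambda>i\<in>{1..m - 1}. (H i (1, x) \<otimes> inv (f (Suc i) x)) \<otimes> c 1 i) = z0"
      using z0 z0i H(3) f_in[OF _ x] c
      by (intro extensionalityI[of _ "{1..m - 1}"]) (auto simp: PiE_def)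
    show "(\<lambda>i\<in>{1..m - 1}. (H i (0, x) \<otimes> inv (f (Suc i) x)) \<otimes> c 0 i) = h x"
      using H(2) f_in[OF _ x] c
      by (intro extensionalityI[of _ "{1..m - 1}"]) (auto simp: h_apply quotients_map_def tuple_def)
  qed
  show ?thesis
    unfolding based_path_pullback_def pullback_section_iff[OF U] based_path_space_def continuous_map_in_subtopology
    using paths in_Q U'
    by (intro exI[of _ "\<lambda>x. \<lambda>s\<in>{0..1}. \<lambda>i\<in>{1..m - 1}. (H i (s, x) \<otimes> inv (f (Suc i) x)) \<otimes> c s i"])
       (auto simp: Pi_iff simp del: o_apply)
qed

text \<open>A section provides a path through the \<open>f\<^sub>i x\<close> depending continuously on \<open>x\<close>; running along it from
  time \<open>t\<^sub>i\<close> to time \<open>t\<^sub>j\<close> is a homotopy.\<close>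

lemma homotopic_if_section:
  assumes U: "openin X U"
    and sec: "\<exists>s. continuous_map (subtopology X U) P s \<and> (\<forall>x\<in>U. fst (s x) = x)"
    and ij: "i \<in> {1..m}" "j \<in> {1..m}"
  shows "homotopic_with (\<lambda>_. True) (subtopology X U) T (f i) (f j)"
proof -
  let ?I = "unit_interval" and ?X = "subtopology X U"
  have U': "topspace ?X = U" using openin_subset[OF U] by (rule topspace_subtopology_subset)
  obtain \<gamma> where \<gamma>: "continuous_map ?X (path_space T) \<gamma>" "\<forall>x\<in>U. tuple m f x = eval_times m t (\<gamma> x)"
    using sec unfolding path_pullback_def pullback_section_iff[OF U] by blast
  have \<gamma>t: "\<gamma> x (t k) = f k x" if "k \<in> {1..m}" "x \<in> U" for k x
    using fun_cong[OF \<gamma>(2)[rule_format, OF that(2)], of k] that by (simp add: tuple_def eval_times_def)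
  let ?s = "\<lambda>s. (1 - s) * t i + s * t j"
  have "?s s \<in> {0..1}" if "s \<in> {0..1}" for s
  proof -
    have "convex {0..1::real}" by simp
    then have "(1 - s) *\<^sub>R t i + s *\<^sub>R t j \<in> {0..1}"
      using that t_bounds[OF ij(1)] t_bounds[OF ij(2)] unfolding convex_alt by auto
    then show ?thesis by simp
  qed
  then have "continuous_map ?I ?I ?s"
    by (auto intro!: continuous_intros)
  from continuous_map_compose[OF continuous_map_fst this]
  have s: "continuous_map (prod_topology ?I ?X) ?I (\<lambda>z. ?s (fst z))"
    by (simp add: o_def)
  have "continuous_map (prod_topology ?I ?X) (path_space T) (\<lambda>z. \<gamma> (snd z))"
    using continuous_map_compose[OF continuous_map_snd \<gamma>(1)] by (simp add: o_def)
  from continuous_map_path_apply[OF this s]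
  have "continuous_map (prod_topology ?I ?X) T (\<lambda>z. \<gamma> (snd z) (?s (fst z)))" .
  then show ?thesis
    using \<gamma>t ij U' by (subst homotopic_with) (auto intro!: exI[of _ "\<lambda>z. \<gamma> (snd z) (?s (fst z))"])
qed

lemma D_maps_eq_cat_map_along: "D_maps X T m f = cat_map X Gq z0 h"
  unfolding D_maps_def cat_map_def secat_def
proof (rule open_cover_number_cong, rule iffI)
  fix U assume U: "openin X U"
  show "\<exists>s. continuous_map (subtopology X U) Q s \<and> (\<forall>x\<in>U. fst (s x) = x)"
    if "\<forall>i\<in>{1..m}. \<forall>j\<in>{1..m}. homotopic_with (\<lambda>_. True) (subtopology X U) T (f i) (f j)"
    using section_if_homotopic[OF U that] .
  show "\<forall>i\<in>{1..m}. \<forall>j\<in>{1..m}. homotopic_with (\<lambda>_. True) (subtopology X U) T (f i) (f j)"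
    if "\<exists>s. continuous_map (subtopology X U) Q s \<and> (\<forall>x\<in>U. fst (s x) = x)"
  proof (intro ballI)
    have sec: "\<exists>s. continuous_map (subtopology X U) P s \<and> (\<forall>x\<in>U. fst (s x) = x)"
      by (rule section_fibre_map[OF fibre_map_of_based U that])
    fix i j assume "i \<in> {1..m}" "j \<in> {1..m}"
    then show "homotopic_with (\<lambda>_. True) (subtopology X U) T (f i) (f j)"
      by (rule homotopic_if_section[OF U sec])
  qed
qed

end

section \<open>The diagonal covering and the universal covering\<close>

lemma continuous_map_diagonal: "continuous_map T Gm (diagonal_point m)"
  unfolding diagonal_point_def[abs_def] continuous_map_into_power_space by simp

lemma continuous_map_shear_pair: "continuous_map (prod_topology T Gq) Gm (\<lambda>(g, z). shear m g z)"
  unfolding case_prod_unfold by (rule continuous_map_shear[OF continuous_map_fst continuous_map_snd])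

lemma pi1_diagonal_eq:
  "pi1_diagonal T g0 m = {path_class Gm (diagonal_point m \<circ> p) | p. pathin T p \<and> p 0 = g0 \<and> p 1 = g0}"
  unfolding pi1_diagonal_def by (rule pi1_map_image_pi1[OF continuous_map_diagonal])

lemma diagonal_loop: "pathin T p \<Longrightarrow> pathin Gm (diagonal_point m \<circ> p)"
  by (rule pathin_compose[OF _ continuous_map_diagonal])

lemma transport_diagonal:
  assumes "pathin Gm \<sigma>" "\<sigma> 0 = diagonal_point m g0"
  shows "pi1_transport Gm \<sigma> ` pi1_diagonal T g0 m =
    {path_class Gm (join_paths (reverse_path \<sigma>) (join_paths (diagonal_point m \<circ> p) \<sigma>)) | p.
       pathin T p \<and> p 0 = g0 \<and> p 1 = g0}"
proof -
  have "pi1_transport Gm \<sigma> (path_class Gm (diagonal_point m \<circ> p)) =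
      path_class Gm (join_paths (reverse_path \<sigma>) (join_paths (diagonal_point m \<circ> p) \<sigma>))"
    if "pathin T p" "p 0 = g0" "p 1 = g0" for p
    using that assms by (intro pi1_transport_path_class diagonal_loop) auto
  then show ?thesis
    unfolding pi1_diagonal_eq by (auto simp: image_iff)
qed

text \<open>\<open>F\<^sub>m\<close> is constant on the diagonal, so the image of a conjugate of a diagonal loop runs back and forth
  along the image of the conjugating path.\<close>

lemma quotients_conjugate_diagonal_null:
  assumes \<sigma>: "pathin Gm \<sigma>" "\<sigma> 0 = diagonal_point m g0" and g0: "g0 \<in> topspace T"
    and p: "pathin T p" "p 0 = g0" "p 1 = g0"
  shows "path_homotopic Gq (F \<circ> join_paths (reverse_path \<sigma>) (join_paths (diagonal_point m \<circ> p) \<sigma>)) (\<lambda>_. F (\<sigma> 1))"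
proof -
  have F\<sigma>: "pathin Gq (F \<circ> \<sigma>)"
    by (rule pathin_compose[OF \<sigma>(1) continuous_map_quotients_map])
  have "pathin Gm (join_paths (reverse_path \<sigma>) (join_paths (diagonal_point m \<circ> p) \<sigma>))"
    using \<sigma> p by (intro pathin_join pathin_reverse diagonal_loop) auto
  then have 1: "pathin Gq (F \<circ> join_paths (reverse_path \<sigma>) (join_paths (diagonal_point m \<circ> p) \<sigma>))"
    by (rule pathin_compose[OF _ continuous_map_quotients_map])
  have pT: "p s \<in> topspace T" if "s \<in> {0..1}" for s
    using path_image_subset_topspace[OF p(1)] that by blast
  have "F (diagonal_point m (p s)) = F (\<sigma> 0)" if "s \<in> {0..1}" for s
    using pT[OF that] g0 by (simp add: \<sigma>(2) quotients_map_diagonal)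
  then have "(F \<circ> join_paths (reverse_path \<sigma>) (join_paths (diagonal_point m \<circ> p) \<sigma>)) s
      = join_paths (reverse_path (F \<circ> \<sigma>)) (join_paths (\<lambda>_. (F \<circ> \<sigma>) 0) (F \<circ> \<sigma>)) s" if "s \<in> {0..1}" for s
    using that by (auto simp: join_paths_def reverse_path_def)
  then have "path_homotopic Gq (F \<circ> join_paths (reverse_path \<sigma>) (join_paths (diagonal_point m \<circ> p) \<sigma>))
      (join_paths (reverse_path (F \<circ> \<sigma>)) (join_paths (\<lambda>_. (F \<circ> \<sigma>) 0) (F \<circ> \<sigma>)))"
    by (rule path_homotopic_eq[OF 1])
  from path_homotopic_trans[OF this join_reverse_const_homotopic[OF F\<sigma>]]
  show ?thesis by (simp add: o_def)
qed

text \<open>Since the shear is continuous on \<open>G \<times> G\<^sup>m\<^sup>-\<^sup>1\<close> and takes \<open>G \<times> {1}\<close> to the diagonal, the conjugate of the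
  diagonal of \<open>\<omega>\<close> by \<open>\<sigma>\<close> is the shear of two paths: \<open>\<omega>\<close> conjugated back by \<open>g\<close>, homotopic to \<open>p\<close>, and \<open>\<zeta>\<close>
  run back and forth, homotopic to a constant and hence to \<open>k\<close>. The path \<open>\<sigma>\<close> does not depend on \<open>p\<close> and
  \<open>k\<close>, so one conjugate of the diagonal subgroup serves all loops at a point.\<close>

lemma null_quotients_conjugate_diagonal:
  assumes g: "pathin T g" "g 0 = g0" "g 1 = y" and \<zeta>: "pathin Gq \<zeta>" "\<zeta> 0 = (\<lambda>i\<in>{1..m - 1}. \<one>)" "\<zeta> 1 = z"
    and p: "pathin T p" "p 0 = y" "p 1 = y" and k: "path_homotopic Gq k (\<lambda>_. z)"
  defines "\<sigma> \<equiv> \<lambda>s. shear m (g s) (\<zeta> s)"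
    and "\<omega> \<equiv> join_paths g (join_paths p (reverse_path g))"
  shows "path_homotopic Gm (join_paths (reverse_path \<sigma>) (join_paths (diagonal_point m \<circ> \<omega>) \<sigma>)) (\<lambda>s. shear m (p s) (k s))"
proof -
  let ?M = "join_paths (reverse_path g) (join_paths \<omega> g)"
  let ?V = "join_paths (reverse_path \<zeta>) (join_paths (\<lambda>_. \<zeta> 0) \<zeta>)"
  have \<omega>: "pathin T \<omega>"
    unfolding \<omega>_def using g p by (intro pathin_join pathin_reverse) auto
  have M: "path_homotopic T ?M p"
    unfolding \<omega>_def using g p by (intro join_conjugate_homotopic) auto
  have V: "path_homotopic Gq ?V k"
    using path_homotopic_trans[OF join_reverse_const_homotopic[OF \<zeta>(1), unfolded \<zeta>(3)] path_homotopic_sym[OF k]] .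
  have MV: "path_homotopic Gm (\<lambda>s. shear m (?M s) (?V s)) (\<lambda>s. shear m (p s) (k s))"
    using path_homotopic_compose[OF path_homotopic_pair[OF M V] continuous_map_shear_pair] by (simp add: o_def)
  have "shear m (?M s) (?V s) = join_paths (reverse_path \<sigma>) (join_paths (diagonal_point m \<circ> \<omega>) \<sigma>) s"
    if s: "s \<in> {0..1}" for s
  proof -
    have "shear m (\<omega> u) (\<zeta> 0) = diagonal_point m (\<omega> u)" if "u \<in> {0..1}" for u
      unfolding \<zeta>(2) using path_image_subset_topspace[OF \<omega>] that by (intro shear_diagonal) blast
    then show ?thesis
      using s by (auto simp: join_paths_def reverse_path_def \<sigma>_def)
  qed
  from path_homotopic_eq[OF path_homotopic_pathin(1)[OF MV] this] MV
  show ?thesis by (blast intro: path_homotopic_trans path_homotopic_sym)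
qed

lemma locally_path_connected_power:
  "locally_path_connected_space T \<Longrightarrow> locally_path_connected_space (power_space T n)"
  unfolding locally_path_connected_space_product_topology by (simp add: path_connected)

lemma covering_null_loop_lifts_closed:
  assumes "covering_map C Gq q" "path_homotopic Gq k (\<lambda>_. k 0)"
    and "pathin C l" "\<And>s. s \<in> {0..1} \<Longrightarrow> q (l s) = k s"
  shows "l 1 = l 0"
  by (rule covering_homotopic_lifts_end[OF assms(1,2,3,4), where \<eta> = "\<lambda>_. l 0"])
     (use assms(4)[of 0] path_start_in_topspace[OF assms(3)] in auto)

context
  fixes g0 :: 'g and C :: "'c topology" and q :: "'c \<Rightarrow> nat \<Rightarrow> 'g"
  assumes g0: "g0 \<in> topspace T" and lpc: "locally_path_connected_space T"
    and univ: "universal_covering C Gq q"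
begin

lemma cov_q: "covering_map C Gq q" and C: "simply_connected_space C"
  using univ by (simp_all add: universal_covering_def)

definition loops_conjugate :: "'x set \<Rightarrow> bool" where
  "loops_conjugate U \<longleftrightarrow> (\<forall>u\<in>U. \<exists>H \<in> conjugate_diagonals T g0 m (tuple m f u).
     pi1_map Gm (tuple m f) ` pi1 (subtopology X U) u \<subseteq> H)"

text \<open>The loops of \<open>U\<close> become null-homotopic under \<open>h\<close>, so the lifting criterion applies to \<open>h\<close>.\<close>

lemma section_if_loops_conjugate:
  assumes X: "locally_path_connected_space X" and U: "openin X U" and conj: "loops_conjugate U"
  shows "\<exists>c. continuous_map (subtopology X U) C c \<and> (\<forall>x\<in>U. h x = q (c x))"
proof -
  let ?X = "subtopology X U"
  have UX: "topspace ?X = U" using openin_subset[OF U] by (rule topspace_subtopology_subset)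
  have tup: "continuous_map ?X Gm (tuple m f)"
    by (rule continuous_map_from_subtopology[OF continuous_map_tuple])
  show ?thesis
  proof (rule covering_lift_if_loops_lift_closed[OF cov_q locally_path_connected_space_open_subset[OF X U]
        continuous_map_from_subtopology[OF continuous_map_h]])
    fix \<omega> l assume \<omega>: "pathin ?X \<omega>" "\<omega> 0 = \<omega> 1" and l: "pathin C l" "\<forall>s\<in>{0..1}. q (l s) = h (\<omega> s)"
    have u: "\<omega> 0 \<in> U" using path_start_in_topspace[OF \<omega>(1)] UX by simp
    obtain H where H: "H \<in> conjugate_diagonals T g0 m (tuple m f (\<omega> 0))"
        "pi1_map Gm (tuple m f) ` pi1 ?X (\<omega> 0) \<subseteq> H"
      using conj u unfolding loops_conjugate_def by blast
    obtain \<sigma> where \<sigma>: "H = pi1_transport Gm \<sigma> ` pi1_diagonal T g0 m" "pathin Gm \<sigma>"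
        "\<sigma> 0 = diagonal_point m g0" "\<sigma> 1 = tuple m f (\<omega> 0)"
      using H(1) unfolding conjugate_diagonals_def by blast
    have "path_class Gm (tuple m f \<circ> \<omega>) \<in> H"
      using H(2) \<omega> unfolding pi1_map_image_pi1[OF tup] by auto
    then obtain p where p: "pathin T p" "p 0 = g0" "p 1 = g0" and
      eq: "path_class Gm (tuple m f \<circ> \<omega>) =
         path_class Gm (join_paths (reverse_path \<sigma>) (join_paths (diagonal_point m \<circ> p) \<sigma>))"
      unfolding \<sigma>(1) transport_diagonal[OF \<sigma>(2,3)] by blast
    have "path_homotopic Gm (tuple m f \<circ> \<omega>) (join_paths (reverse_path \<sigma>) (join_paths (diagonal_point m \<circ> p) \<sigma>))"
      using eq path_class_eq_iff[OF pathin_compose[OF \<omega>(1) tup]] by blast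
    from path_homotopic_trans[OF path_homotopic_compose[OF this continuous_map_quotients_map]
        quotients_conjugate_diagonal_null[OF \<sigma>(2,3) g0 p]]
    have "path_homotopic Gq (\<lambda>s. h (\<omega> s)) (\<lambda>_. h (\<omega> 0))"
      by (simp add: o_def \<sigma>(4))
    from covering_null_loop_lifts_closed[OF cov_q this l(1)] l(2) show "l 0 = l 1" by simp
  next
    fix c assume "continuous_map ?X C c" and lift: "\<And>z. z \<in> topspace ?X \<Longrightarrow> q (c z) = h z"
    moreover have "\<forall>x\<in>U. h x = q (c x)" using lift[unfolded UX] by simp
    ultimately show ?thesis by blast
  qed
qed

text \<open>A lift of \<open>h\<close> to the simply connected space \<open>C\<close> makes the image under \<open>h\<close> of every loop null-homotopic.
  The conjugating path is the shear of a path in \<open>G\<close> from \<open>g\<^sub>0\<close> to \<open>f\<^sub>m u\<close> and a path from \<open>1\<close> to \<open>h u\<close>.\<close>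

lemma loops_conjugate_if_section:
  assumes U: "openin X U" and c: "continuous_map (subtopology X U) C c" "\<forall>x\<in>U. h x = q (c x)"
  shows "loops_conjugate U"
  unfolding loops_conjugate_def
proof
  let ?X = "subtopology X U"
  fix u assume u: "u \<in> U"
  have UX: "topspace ?X = U" using openin_subset[OF U] by (rule topspace_subtopology_subset)
  have uX: "u \<in> topspace X" using u openin_subset[OF U] by blast
  have tup: "continuous_map ?X Gm (tuple m f)"
    by (rule continuous_map_from_subtopology[OF continuous_map_tuple])
  have fm: "continuous_map ?X T (f m)"
    using m by (intro continuous_map_from_subtopology[OF f]) auto
  have hu: "h u \<in> topspace Gq" using continuous_map_image_subset_topspace[OF continuous_map_h] uX by blast
  obtain g where g: "pathin T g" "g 0 = g0" "g 1 = f m u"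
    using path_connected[unfolded path_connected_space_def, rule_format, OF g0 f_in[OF _ uX, of m]] m by auto
  obtain \<zeta> where \<zeta>: "pathin Gq \<zeta>" "\<zeta> 0 = (\<lambda>i\<in>{1..m - 1}. \<one>)" "\<zeta> 1 = h u"
    using obtain_path[OF ones_in_topspace hu] .
  define \<sigma> where "\<sigma> = (\<lambda>s. shear m (g s) (\<zeta> s))"
  have \<sigma>: "pathin Gm \<sigma>" "\<sigma> 0 = diagonal_point m g0" "\<sigma> 1 = tuple m f u"
    unfolding \<sigma>_def pathin_def
    using continuous_map_shear g \<zeta> shear_diagonal[OF g0] shear_h[OF uX] by (auto simp: pathin_def)
  let ?H = "pi1_transport Gm \<sigma> ` pi1_diagonal T g0 m"
  have "pi1_map Gm (tuple m f) ` pi1 ?X u \<subseteq> ?H"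
  proof
    fix \<kappa> assume "\<kappa> \<in> pi1_map Gm (tuple m f) ` pi1 ?X u"
    then obtain p where \<kappa>: "\<kappa> = path_class Gm (tuple m f \<circ> p)" and p: "pathin ?X p" "p 0 = u" "p 1 = u"
      unfolding pi1_map_image_pi1[OF tup] by blast
    have pU: "p s \<in> U" if "s \<in> {0..1}" for s using p(1) that by (simp add: pathin_subtopology)
    have cp: "pathin C (c \<circ> p)" by (rule pathin_compose[OF p(1) c(1)])
    have "path_homotopic C (c \<circ> p) (\<lambda>_. c u)"
      using simply_connected_loop[OF C cp] p by simp
    from path_homotopic_compose[OF this covering_continuous[OF cov_q]]
    have qcp: "path_homotopic Gq (q \<circ> (c \<circ> p)) (\<lambda>_. h u)"
      using c(2) u by (simp add: o_def)
    have "path_homotopic Gq (q \<circ> (c \<circ> p)) (h \<circ> p)"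
      by (rule path_homotopic_eq[OF path_homotopic_pathin(1)[OF qcp]]) (use pU c(2) in auto)
    then have k: "path_homotopic Gq (h \<circ> p) (\<lambda>_. h u)"
      using qcp by (blast intro: path_homotopic_trans path_homotopic_sym)
    have fp: "pathin T (f m \<circ> p)" by (rule pathin_compose[OF p(1) fm])
    define \<omega> where "\<omega> = join_paths g (join_paths (f m \<circ> p) (reverse_path g))"
    have \<omega>: "pathin T \<omega>" "\<omega> 0 = g0" "\<omega> 1 = g0"
      unfolding \<omega>_def using g p fp by (auto intro!: pathin_join pathin_reverse)
    have "path_homotopic Gm (join_paths (reverse_path \<sigma>) (join_paths (diagonal_point m \<circ> \<omega>) \<sigma>))
        (\<lambda>s. shear m ((f m \<circ> p) s) ((h \<circ> p) s))"
      unfolding \<sigma>_def \<omega>_def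
      by (rule null_quotients_conjugate_diagonal[OF g \<zeta> fp _ _ k]) (use p in auto)
    moreover have "path_homotopic Gm (tuple m f \<circ> p) (\<lambda>s. shear m ((f m \<circ> p) s) ((h \<circ> p) s))"
    proof (rule path_homotopic_eq[OF pathin_compose[OF p(1) tup]])
      fix s :: real assume "s \<in> {0..1}"
      then have "p s \<in> topspace X" using pU openin_subset[OF U] by blast
      then show "(tuple m f \<circ> p) s = shear m ((f m \<circ> p) s) ((h \<circ> p) s)"
        unfolding o_apply[of _ p] by (rule shear_h[symmetric])
    qed
    ultimately have "path_homotopic Gm (tuple m f \<circ> p) (join_paths (reverse_path \<sigma>) (join_paths (diagonal_point m \<circ> \<omega>) \<sigma>))"
      by (blast intro: path_homotopic_trans path_homotopic_sym)
    then have "\<kappa> = path_class Gm (join_paths (reverse_path \<sigma>) (join_paths (diagonal_point m \<circ> \<omega>) \<sigma>))"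
      unfolding \<kappa> using path_class_eq_iff path_homotopic_pathin(1) by blast
    then show "\<kappa> \<in> ?H"
      unfolding transport_diagonal[OF \<sigma>(1,2)] using \<omega> by blast
  qed
  then show "\<exists>H \<in> conjugate_diagonals T g0 m (tuple m f u). pi1_map Gm (tuple m f) ` pi1 ?X u \<subseteq> H"
    using \<sigma> unfolding conjugate_diagonals_def by blast
qed

lemma D_diagonal_eq_cat1_map:
  assumes X: "locally_path_connected_space X"
  shows "D_diagonal X T g0 m f = cat1_map X C q h"
  unfolding D_diagonal_def cat1_map_def secat_def
proof (rule open_cover_number_cong)
  fix U assume U: "openin X U"
  show "(\<forall>u\<in>U. \<exists>H \<in> conjugate_diagonals T g0 m (tuple m f u).
        pi1_map Gm (tuple m f) ` pi1 (subtopology X U) u \<subseteq> H) \<longleftrightarrow>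
     (\<exists>s. continuous_map (subtopology X U) (pullback X h C q) s \<and> (\<forall>x\<in>U. fst (s x) = x))"
    unfolding pullback_section_iff[OF U] loops_conjugate_def[symmetric]
    using section_if_loops_conjugate[OF X U] loops_conjugate_if_section[OF U] by blast
qed

context
  fixes E :: "'e topology" and r :: "'e \<Rightarrow> nat \<Rightarrow> 'g"
  assumes diag: "diagonal_covering E T g0 m r"
begin

lemma cov_r: "covering_map E Gm r"
  using diag by (simp add: diagonal_covering_def)

lemma locally_path_connected_E: "locally_path_connected_space E"
  using covering_locally_path_connected[OF cov_r locally_path_connected_power[OF lpc]] .

lemma path_connected_E: "path_connected_space E"
  using diag path_connected_eq_connected_space[OF locally_path_connected_E] by (simp add: diagonal_covering_def)

lemma locally_path_connected_C: "locally_path_connected_space C"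
  using covering_locally_path_connected[OF cov_q locally_path_connected_power[OF lpc]] .

lemma obtain_diagonal_base_point:
  obtains e where "e \<in> topspace E" "r e = diagonal_point m g0"
    "{path_class Gm (r \<circ> k) | k. pathin E k \<and> k 0 = e \<and> k 1 = e} =
     {path_class Gm (diagonal_point m \<circ> p) | p. pathin T p \<and> p 0 = g0 \<and> p 1 = g0}"
proof -
  obtain e where e: "e \<in> topspace E" "r e = diagonal_point m g0" "pi1_map Gm r ` pi1 E e = pi1_diagonal T g0 m"
    using diag unfolding diagonal_covering_def by blast
  from e(3) have "{path_class Gm (r \<circ> k) | k. pathin E k \<and> k 0 = e \<and> k 1 = e} =
     {path_class Gm (diagonal_point m \<circ> p) | p. pathin T p \<and> p 0 = g0 \<and> p 1 = g0}"
    unfolding pi1_diagonal_eq pi1_map_image_pi1[OF covering_continuous[OF cov_r]] .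
  with e(1,2) show ?thesis by (rule that)
qed

lemma obtain_point_over_one:
  obtains c where "c \<in> topspace C" "q c = (\<lambda>i\<in>{1..m - 1}. \<one>)"
  using cov_q ones_in_topspace[of "m - 1"] unfolding covering_map_def by (metis imageE)

text \<open>A loop of \<open>E\<close> at the base point maps to a loop homotopic to a diagonal one, and \<open>F\<^sub>m\<close> makes the latter
  constant.\<close>

lemma diagonal_to_universal:
  obtains \<Phi> where "continuous_map E C \<Phi>" "\<And>e. e \<in> topspace E \<Longrightarrow> q (\<Phi> e) = F (r e)"
proof -
  obtain e where e: "e \<in> topspace E" "r e = diagonal_point m g0"
    "{path_class Gm (r \<circ> k) | k. pathin E k \<and> k 0 = e \<and> k 1 = e} =
     {path_class Gm (diagonal_point m \<circ> p) | p. pathin T p \<and> p 0 = g0 \<and> p 1 = g0}"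
    by (rule obtain_diagonal_base_point)
  obtain c where c: "c \<in> topspace C" "q c = (\<lambda>i\<in>{1..m - 1}. \<one>)" by (rule obtain_point_over_one)
  have Fr: "continuous_map E Gq (F \<circ> r)"
    by (rule continuous_map_compose[OF covering_continuous[OF cov_r] continuous_map_quotients_map])
  show ?thesis
  proof (rule covering_lifting_criterion[OF cov_q path_connected_E locally_path_connected_E Fr e(1) c(1)])
    show "q c = (F \<circ> r) e" using c(2) e(2) quotients_map_diagonal[OF g0] by simp
    fix k l assume k: "pathin E k" "k 0 = e" "k 1 = e" and l: "pathin C l" "l 0 = c" "\<forall>s\<in>{0..1}. q (l s) = (F \<circ> r) (k s)"
    have "path_class Gm (r \<circ> k) \<in> {path_class Gm (r \<circ> k) | k. pathin E k \<and> k 0 = e \<and> k 1 = e}"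
      using k by blast
    then obtain p where p: "pathin T p" "p 0 = g0" "p 1 = g0" "path_class Gm (r \<circ> k) = path_class Gm (diagonal_point m \<circ> p)"
      unfolding e(3) by blast
    have rk: "pathin Gm (r \<circ> k)" by (rule pathin_compose[OF k(1) covering_continuous[OF cov_r]])
    have "path_homotopic Gm (r \<circ> k) (diagonal_point m \<circ> p)"
      using p(4) path_class_eq_iff[OF rk] by blast
    from path_homotopic_compose[OF this continuous_map_quotients_map]
    have 1: "path_homotopic Gq (F \<circ> (r \<circ> k)) (F \<circ> (diagonal_point m \<circ> p))" .
    have "(F \<circ> (diagonal_point m \<circ> p)) s = (\<lambda>i\<in>{1..m - 1}. \<one>)" if "s \<in> {0..1}" for s
      using quotients_map_diagonal[OF pathin_in_topspace[OF p(1) that], of m] by simp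
    then have "path_homotopic Gq (F \<circ> (diagonal_point m \<circ> p)) (\<lambda>_. \<lambda>i\<in>{1..m - 1}. \<one>)"
      by (rule path_homotopic_eq[OF path_homotopic_pathin(2)[OF 1]])
    from path_homotopic_trans[OF 1 this]
    have "path_homotopic Gq (F \<circ> (r \<circ> k)) (\<lambda>_. (F \<circ> (r \<circ> k)) 0)"
      using k(2) e(2) quotients_map_diagonal[OF g0, of m] by simp
    from covering_null_loop_lifts_closed[OF cov_q this l(1)] l(2,3) show "l 1 = c" by simp
  next
    fix \<Phi> assume "continuous_map E C \<Phi>" "\<And>z. z \<in> topspace E \<Longrightarrow> q (\<Phi> z) = (F \<circ> r) z"
    then show ?thesis by (intro that) auto
  qed
qed

text \<open>A loop of \<open>G \<times> C\<close> is homotopic to one with constant second component over \<open>1\<close>, which the shear maps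
  to a diagonal loop; and diagonal loops are homotopic to images of loops of \<open>E\<close>, that is, to loops
  with closed lifts.\<close>

lemma universal_to_diagonal:
  obtains \<Psi> where "continuous_map (prod_topology T C) E \<Psi>"
    "\<And>g c. g \<in> topspace T \<Longrightarrow> c \<in> topspace C \<Longrightarrow> r (\<Psi> (g, c)) = shear m g (q c)"
proof -
  obtain e where e: "e \<in> topspace E" "r e = diagonal_point m g0"
    "{path_class Gm (r \<circ> k) | k. pathin E k \<and> k 0 = e \<and> k 1 = e} =
     {path_class Gm (diagonal_point m \<circ> p) | p. pathin T p \<and> p 0 = g0 \<and> p 1 = g0}"
    by (rule obtain_diagonal_base_point)
  obtain c where c: "c \<in> topspace C" "q c = (\<lambda>i\<in>{1..m - 1}. \<one>)" by (rule obtain_point_over_one)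
  let ?W = "\<lambda>(g, c). shear m g (q c)"
  have W: "continuous_map (prod_topology T C) Gm ?W"
    unfolding case_prod_unfold
    using continuous_map_compose[OF continuous_map_snd covering_continuous[OF cov_q]]
    by (intro continuous_map_shear[OF continuous_map_fst]) (simp add: o_def)
  have pc: "path_connected_space (prod_topology T C)"
    using C path_connected by (simp add: path_connected_space_prod_topology simply_connected_space_def)
  have lpcTC: "locally_path_connected_space (prod_topology T C)"
    using lpc locally_path_connected_C by (simp add: locally_path_connected_space_prod_topology)
  show ?thesis
  proof (rule covering_lifting_criterion[OF cov_r pc lpcTC W _ e(1), of "(g0, c)"])
    show "(g0, c) \<in> topspace (prod_topology T C)" using g0 c by simp
    show "r e = ?W (g0, c)" using e(2) c(2) shear_diagonal[OF g0] by simp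
    fix k l assume k: "pathin (prod_topology T C) k" "k 0 = (g0, c)" "k 1 = (g0, c)"
      and l: "pathin E l" "l 0 = e" "\<forall>s\<in>{0..1}. r (l s) = ?W (k s)"
    have k1: "pathin T (fst \<circ> k)" and k2: "pathin C (snd \<circ> k)"
      using k(1) unfolding pathin_def continuous_map_pairwise by auto
    have "path_homotopic C (snd \<circ> k) (\<lambda>_. c)"
      using simply_connected_loop[OF C k2] k by simp
    from path_homotopic_compose[OF path_homotopic_pair[OF path_homotopic_refl[OF k1] this] W]
    have 1: "path_homotopic Gm (?W \<circ> k) (\<lambda>s. shear m (fst (k s)) (\<lambda>i\<in>{1..m - 1}. \<one>))"
      by (simp add: o_def c(2) case_prod_unfold)
    have "shear m (fst (k s)) (\<lambda>i\<in>{1..m - 1}. \<one>) = (diagonal_point m \<circ> (fst \<circ> k)) s" if "s \<in> {0..1}" for s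
      using shear_diagonal[OF pathin_in_topspace[OF k1 that], of m] by simp
    then have "path_homotopic Gm (\<lambda>s. shear m (fst (k s)) (\<lambda>i\<in>{1..m - 1}. \<one>)) (diagonal_point m \<circ> (fst \<circ> k))"
      by (rule path_homotopic_eq[OF path_homotopic_pathin(2)[OF 1]])
    from path_homotopic_trans[OF 1 this]
    have 2: "path_homotopic Gm (?W \<circ> k) (diagonal_point m \<circ> (fst \<circ> k))" .
    have "path_class Gm (diagonal_point m \<circ> (fst \<circ> k)) \<in>
        {path_class Gm (diagonal_point m \<circ> p) | p. pathin T p \<and> p 0 = g0 \<and> p 1 = g0}"
      using k1 k(2,3) by (intro CollectI exI[of _ "fst \<circ> k"]) simp
    then obtain k' where k': "pathin E k'" "k' 0 = e" "k' 1 = e"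
        "path_class Gm (diagonal_point m \<circ> (fst \<circ> k)) = path_class Gm (r \<circ> k')"
      unfolding e(3)[symmetric] by blast
    have "path_homotopic Gm (diagonal_point m \<circ> (fst \<circ> k)) (r \<circ> k')"
      using k'(4) path_class_eq_iff[OF diagonal_loop[OF k1]] by blast
    from path_homotopic_trans[OF 2 this]
    have "path_homotopic Gm (?W \<circ> k) (r \<circ> k')" .
    from covering_homotopic_lifts_end[OF cov_r this l(1) _ k'(1)] l(2,3) k'(2,3)
    show "l 1 = e" by simp
  next
    fix \<Psi> assume "continuous_map (prod_topology T C) E \<Psi>" "\<And>z. z \<in> topspace (prod_topology T C) \<Longrightarrow> r (\<Psi> z) = ?W z"
    then show ?thesis by (intro that) auto
  qed
qed

lemma fibre_map_diagonal_to_universal: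
  obtains \<phi> where "fibre_map (pullback X (tuple m f) E r) fst (pullback X h C q) fst \<phi>"
proof -
  obtain \<Phi> where \<Phi>: "continuous_map E C \<Phi>" "\<And>e. e \<in> topspace E \<Longrightarrow> q (\<Phi> e) = F (r e)"
    using diagonal_to_universal by blast
  have "fibre_map (pullback X (tuple m f) E r) fst (pullback X h C q) fst (\<lambda>w. (fst w, (\<Phi> \<circ> snd) w))"
    by (rule fibre_map_pullback[OF continuous_map_compose[OF continuous_map_pullback_snd \<Phi>(1)]]) (simp add: \<Phi>(2))
  then show ?thesis by (rule that)
qed

text \<open>A point of the pullback over \<open>x\<close> does not determine a point of \<open>G\<^sup>m\<close>, but \<open>x\<close> supplies the missing
  coordinate \<open>f\<^sub>m x\<close>.\<close>

lemma fibre_map_universal_to_diagonal: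
  obtains \<phi> where "fibre_map (pullback X h C q) fst (pullback X (tuple m f) E r) fst \<phi>"
proof -
  obtain \<Psi> where \<Psi>: "continuous_map (prod_topology T C) E \<Psi>"
    "\<And>g c. g \<in> topspace T \<Longrightarrow> c \<in> topspace C \<Longrightarrow> r (\<Psi> (g, c)) = shear m g (q c)"
    using universal_to_diagonal by blast
  have "continuous_map (pullback X h C q) T (f m \<circ> fst)"
    using m by (intro continuous_map_compose[OF continuous_map_pullback_fst f]) auto
  then have "continuous_map (pullback X h C q) (prod_topology T C) (\<lambda>w. (f m (fst w), snd w))"
    by (simp add: continuous_map_pairwise o_def continuous_map_pullback_snd)
  from continuous_map_compose[OF this \<Psi>(1)]
  have "fibre_map (pullback X h C q) fst (pullback X (tuple m f) E r) fst
      (\<lambda>w. (fst w, (\<Psi> \<circ> (\<lambda>w. (f m (fst w), snd w))) w))"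
  proof (rule fibre_map_pullback)
    fix x c assume x: "x \<in> topspace X" "c \<in> topspace C" "h x = q c"
    have "r (\<Psi> (f m x, c)) = shear m (f m x) (h x)"
      using \<Psi>(2)[of "f m x" c] f_in[of m x] m x by simp
    then show "tuple m f x = r ((\<Psi> \<circ> (\<lambda>w. (f m (fst w), snd w))) (x, c))"
      using shear_h[OF x(1)] by simp
  qed
  then show ?thesis by (rule that)
qed

lemma D_diagonal_secat_eq_cat1_map: "D_diagonal_secat X E m r f = cat1_map X C q h"
proof -
  obtain \<phi> where \<phi>: "fibre_map (pullback X (tuple m f) E r) fst (pullback X h C q) fst \<phi>"
    by (rule fibre_map_diagonal_to_universal)
  obtain \<psi> where \<psi>: "fibre_map (pullback X h C q) fst (pullback X (tuple m f) E r) fst \<psi>"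
    by (rule fibre_map_universal_to_diagonal)
  show ?thesis
    unfolding D_diagonal_secat_def cat1_map_def
    by (rule antisym[OF secat_fibre_map_le[OF \<psi>] secat_fibre_map_le[OF \<phi>]])
qed

lemma dD_diagonal_eq_dcat1_map:
  assumes "functorial_on \<T> (pullback X (tuple m f) E r) \<T>' (pullback X h C q)"
    and "functorial_on \<T>' (pullback X h C q) \<T> (pullback X (tuple m f) E r)"
  shows "dD_diagonal \<T> X E m r f = dcat1_map \<T>' X C q h"
proof -
  obtain \<phi> where \<phi>: "fibre_map (pullback X (tuple m f) E r) fst (pullback X h C q) fst \<phi>"
    by (rule fibre_map_diagonal_to_universal)
  obtain \<psi> where \<psi>: "fibre_map (pullback X h C q) fst (pullback X (tuple m f) E r) fst \<psi>"
    by (rule fibre_map_universal_to_diagonal)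
  show ?thesis
    unfolding dD_diagonal_def dcat1_map_def
    by (rule antisym[OF dsecat_fibre_map_le[OF \<psi> assms(2)] dsecat_fibre_map_le[OF \<phi> assms(1)]])
qed

end

end

context
  fixes t :: "nat \<Rightarrow> real" and z0 :: "nat \<Rightarrow> 'g"
  assumes t: "strict_mono_on {1..m} t" and t1: "t 1 = 0" and tm: "t m = 1"
    and z0: "z0 \<in> topspace Gq"
begin

lemma D_maps_eq_cat_map: "D_maps X T m f = cat_map X Gq z0 h"
  using obtain_path[OF ones_in_topspace z0] D_maps_eq_cat_map_along[OF t t1 tm z0] by metis

lemma dD_maps_eq_dcat_map:
  assumes "functorial_on \<T> (path_pullback X T m t f) \<T>' (based_path_pullback X Gq z0 h)"
    and "functorial_on \<T>' (based_path_pullback X Gq z0 h) \<T> (path_pullback X T m t f)"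
  shows "dD_maps \<T> X T m t f = dcat_map \<T>' X Gq z0 h"
proof -
  obtain c where c: "pathin Gq c" "c 0 = (\<lambda>i\<in>{1..m - 1}. \<one>)" "c 1 = z0"
    using obtain_path[OF ones_in_topspace z0] .
  show ?thesis
    unfolding dD_maps_def dcat_map_def
    using dsecat_fibre_map_le[OF fibre_map_to_based[OF t t1 tm z0 c] assms(1), of X]
      dsecat_fibre_map_le[OF fibre_map_of_based[OF t t1 tm z0 c] assms(2), of X]
    by (rule antisym[rotated])
qed

end

end

section \<open>Comparison of the invariants\<close>

theorem theorem1p1:
  fixes m :: nat
    and G :: "('g, 'z) monoid_scheme"
    and T :: "'g topology"
    and X :: "'x topology"
    and f :: "nat \<Rightarrow> 'x \<Rightarrow> 'g"
    and t :: "nat \<Rightarrow> real"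
    and g\<^sub>0 :: 'g
    and z\<^sub>0 :: "nat \<Rightarrow> 'g"
    and C :: "'c topology" and q :: "'c \<Rightarrow> nat \<Rightarrow> 'g"
    and E :: "'e topology" and r :: "'e \<Rightarrow> nat \<Rightarrow> 'g"
  assumes "m \<ge> 2"
    and "topological_group G T"
    and "path_connected_space T"
    and "\<forall>i\<in>{1..m}. continuous_map X T (f i)"
    and "strict_mono_on {1..m} t" and "t 1 = 0" and "t m = 1"
    and "g\<^sub>0 \<in> topspace T"
    and "z\<^sub>0 \<in> topspace (power_space T (m - 1))"
  shows
   "D_maps X T m f = cat_map X (power_space T (m - 1)) z\<^sub>0 (quotients_map G m \<circ> tuple m f) \<and>
    dD_maps symmetric_join_topology X T m t f
      = dcat_map symmetric_join_topology X (power_space T (m - 1)) z\<^sub>0 (quotients_map G m \<circ> tuple m f) \<and>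
    (\<forall>d d'. metrizes d (path_pullback X T m t f) \<and>
            metrizes d' (based_path_pullback X (power_space T (m - 1)) z\<^sub>0 (quotients_map G m \<circ> tuple m f))
      \<longrightarrow> dD_maps (levy_prokhorov_topology d) X T m t f
          = dcat_map (levy_prokhorov_topology d') X (power_space T (m - 1)) z\<^sub>0 (quotients_map G m \<circ> tuple m f)) \<and>
    (locally_path_connected_space T \<and> semilocally_simply_connected_space T \<and>
     universal_covering C (power_space T (m - 1)) q
      \<longrightarrow> (locally_path_connected_space X
            \<longrightarrow> D_diagonal X T g\<^sub>0 m f = cat1_map X C q (quotients_map G m \<circ> tuple m f)) \<and>
          (diagonal_covering E T g\<^sub>0 m r
            \<longrightarrow> D_diagonal_secat X E m r f = cat1_map X C q (quotients_map G m \<circ> tuple m f) \<and>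
                dD_diagonal symmetric_join_topology X E m r f
                  = dcat1_map symmetric_join_topology X C q (quotients_map G m \<circ> tuple m f) \<and>
                (\<forall>d d'. metrizes d (pullback X (tuple m f) E r) \<and>
                        metrizes d' (pullback X (quotients_map G m \<circ> tuple m f) C q)
                  \<longrightarrow> dD_diagonal (levy_prokhorov_topology d) X E m r f
                      = dcat1_map (levy_prokhorov_topology d') X C q (quotients_map G m \<circ> tuple m f))))"
proof -
  interpret maps_into_group G T m X f
    by unfold_locales (use assms in auto)
  note t = assms(5-7) and g0 = assms(8) and z0 = assms(9)
  show ?thesis
  proof (intro conjI impI allI)
    show "D_maps X T m f = cat_map X Gq z\<^sub>0 h"
      by (rule D_maps_eq_cat_map[OF t z0])
    show "dD_maps symmetric_join_topology X T m t f = dcat_map symmetric_join_topology X Gq z\<^sub>0 h"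
      by (intro dD_maps_eq_dcat_map[OF t z0] functorial_symmetric_join)
    show "dD_maps (levy_prokhorov_topology d) X T m t f = dcat_map (levy_prokhorov_topology d') X Gq z\<^sub>0 h"
      if "metrizes d (path_pullback X T m t f) \<and> metrizes d' (based_path_pullback X Gq z\<^sub>0 h)" for d d'
      using that by (intro dD_maps_eq_dcat_map[OF t z0] functorial_levy_prokhorov) auto
    assume "locally_path_connected_space T \<and> semilocally_simply_connected_space T \<and> universal_covering C Gq q"
    then have cov: "locally_path_connected_space T" "universal_covering C Gq q" by auto
    show "D_diagonal X T g\<^sub>0 m f = cat1_map X C q h" if "locally_path_connected_space X"
      by (rule D_diagonal_eq_cat1_map[OF g0 cov that])
    assume diag: "diagonal_covering E T g\<^sub>0 m r"
    show "D_diagonal_secat X E m r f = cat1_map X C q h"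
      by (rule D_diagonal_secat_eq_cat1_map[OF g0 cov diag])
    show "dD_diagonal symmetric_join_topology X E m r f = dcat1_map symmetric_join_topology X C q h"
      by (intro dD_diagonal_eq_dcat1_map[OF g0 cov diag] functorial_symmetric_join)
    show "dD_diagonal (levy_prokhorov_topology d) X E m r f = dcat1_map (levy_prokhorov_topology d') X C q h"
      if "metrizes d (pullback X (tuple m f) E r) \<and> metrizes d' (pullback X h C q)" for d d'
      using that by (intro dD_diagonal_eq_dcat1_map[OF g0 cov diag] functorial_levy_prokhorov) auto
  qed
qed

end
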